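(* Fix $k\in\mathbb{N}$. Let $c_1<c_2<c_3<\cdots$ be the cyclic numbers listed in increasing order (so $c_1=1$, $c_2=2$, $c_3=3$, $c_4=5,\ldots$). Then, as $n\to\infty$, $$c_1^k+c_2^k+\cdots+c_n^k \sim \frac{n\,c_n^k}{k+1} \sim \frac{n^{k+1}e^{k\gamma}(\log\log\log n)^k}{k+1}.$$ In particular, $c_1+\cdots+c_n \sim n c_n/2 \sim n^2 e^{\gamma}\log\log\log n/2$ as $n\to\infty$. Moreover, for positive real $x$, as $x\to\infty$, the sum $\sum_{c\text{ cyclic},\, c\le x} c^k$ of the $k$th powers of all cyclic numbers less than or equal to $x$ is asymptotic to $$\frac{C(x)\,c_{C(x)}^k}{k+1}\sim \frac{C(x)\,x^k}{k+1}\sim \frac{x^{k+1}}{(k+1)e^{\gamma}\log\log\log x}\left(1-\frac{\gamma}{\log\log\log x}\right).$$ In particular, the sum of all cyclic numbers less than or equal to $x$ is asymptotic to $$\frac{C(x)\,x}{2}\sim \frac{x^{2}}{2e^{\gamma}\log\log\log x}\left(1-\frac{\gamma}{\log\log\log x}\right)\quad\text{as } x\to\infty.$$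
   Context: A positive integer $n$ is called cyclic if every group of order $n$ is cyclic; equivalently, $\gcd(n,\varphi(n))=1$, where $\varphi$ is Euler's totient function. For positive real $x$, $C(x)$ denotes the number of cyclic numbers $m$ with $m\le x$. The constant $\gamma\approx 0.5772$ is the Euler–Mascheroni constant, and $\log$ is the natural logarithm. For functions $f,g$, $f\sim g$ means $f/g\to 1$. *)

theory Defs
  imports
    "HOL-Library.Infinite_Set"
    "HOL-Library.Landau_Symbols"
    "HOL-Computational_Algebra.Primes"
    "HOL-Analysis.Harmonic_Numbers"
    "HOL-Algebra.Elementary_Groups"
    "HOL-Algebra.Multiplicative_Group"
begin

text \<open>
  A definition cannot quantify over types, so the groups of order \<open>n\<close> range over carriers in
  \<open>nat\<close>. This loses nothing: every finite group is isomorphic to one of these, and lemma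
  \<open>cyclic_number_imp_cyclic_group\<close> recovers the property for groups over any type.
\<close>

definition cyclic_number :: "nat \<Rightarrow> bool" where
  "cyclic_number n \<longleftrightarrow>
     0 < n \<and> (\<forall>G :: nat monoid. group G \<longrightarrow> Coset.order G = n \<longrightarrow> cyclic_group G)"

lemma cyclic_number_imp_cyclic_group:
  fixes G :: "'a monoid"
  assumes n: "cyclic_number n" and G: "group G" and ord: "Coset.order G = n"
  shows "cyclic_group G"
proof -
  interpret G: group G by fact
  have fin: "finite (carrier G)"
    using n ord by (auto simp: cyclic_number_def Coset.order_def card_gt_0_iff)
  obtain f :: "'a \<Rightarrow> nat" where f: "inj_on f (carrier G)"
    using finite_imp_inj_to_nat_seg[OF fin] by blast
  define g where "g = the_inv_into (carrier G) f"
  have gf: "g (f x) = x" if "x \<in> carrier G" for x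
    using that f by (simp add: g_def the_inv_into_f_f)
  define H :: "nat monoid" where
    "H = \<lparr>carrier = f ` carrier G, mult = (\<lambda>a b. f (g a \<otimes>\<^bsub>G\<^esub> g b)), one = f \<one>\<^bsub>G\<^esub>\<rparr>"
  have H: "group H"
  proof (rule groupI)
    fix a assume "a \<in> carrier H"
    then obtain x where x: "x \<in> carrier G" "a = f x" by (auto simp: H_def)
    have "f (inv\<^bsub>G\<^esub> x) \<in> carrier H" "f (inv\<^bsub>G\<^esub> x) \<otimes>\<^bsub>H\<^esub> a = \<one>\<^bsub>H\<^esub>"
      using x by (auto simp: H_def gf)
    then show "\<exists>b\<in>carrier H. b \<otimes>\<^bsub>H\<^esub> a = \<one>\<^bsub>H\<^esub>" by blast
  qed (auto simp: H_def gf G.m_assoc)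
  have "f \<in> iso G H"
    using f by (auto simp: iso_def hom_def bij_betw_def H_def gf)
  then have iso: "G \<cong> H" by (auto simp: is_iso_def)
  have "Coset.order H = n"
    using ord f by (simp add: Coset.order_def H_def card_image)
  then have "cyclic_group H"
    using n H by (simp add: cyclic_number_def)
  then show ?thesis
    using isomorphic_group_cyclicity[OF iso G H] by simp
qed

lemma prime_imp_cyclic_number:
  assumes "prime p"
  shows "cyclic_number p"
  unfolding cyclic_number_def
proof (intro conjI allI impI)
  show "0 < p" using assms by (rule prime_gt_0_nat)
  fix G :: "nat monoid"
  assume "group G" and ord: "Coset.order G = p"
  interpret G: group G by fact
  have fin: "finite (carrier G)"
    using assms ord by (metis Coset.order_def card.infinite not_prime_0)
  have "card (carrier G) > 1"
    using prime_gt_1_nat[OF assms] ord by (simp add: Coset.order_def)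
  then have "\<not> carrier G \<subseteq> {\<one>\<^bsub>G\<^esub>}"
    using card_mono[of "{\<one>\<^bsub>G\<^esub>}" "carrier G"] by auto
  then obtain x where x: "x \<in> carrier G" "x \<noteq> \<one>\<^bsub>G\<^esub>"
    by blast
  have "G.ord x \<noteq> 1"
    using x G.ord_eq_1 by simp
  moreover have "G.ord x dvd p"
    using G.ord_dvd_group_order[OF x(1)] ord by simp
  ultimately have "G.ord x = p"
    using assms prime_nat_iff by blast
  then have "card (generate G {x}) = card (carrier G)"
    using G.generate_pow_card[OF x(1)] ord by (simp add: Coset.order_def)
  then have "generate G {x} = carrier G"
    using fin x by (intro card_subset_eq) (auto intro: G.generate_in_carrier)
  then have "subgroup_generated G {x} = G"
    using x by (simp add: subgroup_generated_def Int_absorb1)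
  then show "cyclic_group G"
    using x unfolding cyclic_group_def by blast
qed

lemma infinite_cyclic_numbers: "infinite {m. cyclic_number m}"
  using primes_infinite prime_imp_cyclic_number
  by (metis (mono_tags, lifting) Collect_mono finite_subset)

text \<open>
  The increasing enumeration \<open>c\<^sub>1 < c\<^sub>2 < \<dots>\<close> is indexed from 1, whereas \<open>enumerate\<close> starts at 0;
  the value at index 0 is junk.
\<close>

definition nth_cyclic :: "nat \<Rightarrow> nat" where
  "nth_cyclic n = enumerate {m. cyclic_number m} (n - 1)"

definition cyclic_count :: "real \<Rightarrow> nat" where
  "cyclic_count x = card {m. cyclic_number m \<and> real m \<le> x}"

end

theory Submission
  imports Defs "HOL-Number_Theory.Number_Theory" "HOL-Analysis.Analysis" "HOL-Real_Asymp.Real_Asymp"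
    "HOL-Algebra.Sylow"
begin

text \<open>
  A number is cyclic iff it is squarefree and has no two prime factors \<open>p\<close>, \<open>q\<close> with
  \<open>q \<equiv> 1 (mod p)\<close>. Put \<open>Y = (ln (ln N))\<^sup>a\<close>. If \<open>a < 1\<close>, then for every prime
  \<open>p \<le> Y\<close> almost all multiples of \<open>p\<close> up to \<open>N\<close> have a prime factor \<open>\<equiv> 1 (mod p)\<close>, so almost
  all cyclic numbers have no prime factor up to \<open>Y\<close>. If \<open>a > 1\<close>, then almost all numbers without prime
  factors up to \<open>Y\<close> are cyclic, because multiples of \<open>p\<^sup>2\<close> or of \<open>p * q\<close> with \<open>p > Y\<close> and
  \<open>q \<equiv> 1 (mod p)\<close> are rare. In both cases \<open>Y\<close> is so small that the numbers without prime factors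
  up to \<open>Y\<close> are counted by Legendre's sieve and Mertens' product, with main term
  \<open>exp (- \<gamma>) * N / (a * ln (ln (ln N)))\<close>; let \<open>a\<close> tend to 1. Hence
  \<open>C(x) \<sim> exp (- \<gamma>) * x / ln (ln (ln x))\<close>, which inverts to \<open>c\<^sub>n \<sim> exp \<gamma> * n * ln (ln (ln n))\<close>,
  and the Stolz--Cesaro theorem sums the powers. The factor \<open>1 - \<gamma> / ln (ln (ln x))\<close> tends to 1
  and plays no role for asymptotic equivalence.
\<close>

section \<open>Cyclic numbers and the totient function\<close>

text \<open>The size of Y decides what has to be sharp. Y enters the main term only through ln Y, so
  constant factors and factors ln p may be wasted everywhere except in Mertens' constant. Write L =
  ln ln N. For a < 1, Dirichlet's theorem is needed uniformly for p up to L^a: once the reciprocals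
  of the primes q congruent to 1 modulo p add up to a constant times L/p, only O(N/L) multiples of p
  can be cyclic, in total N L^(a-1), which is o(N / ln L). Halving ln ln R in that theorem is
  harmless, but its error may not exceed about p ln p before the division by p - 1. This rules out
  bounding the L-values one character at a time; they are controlled jointly through the product
  over all characters. For a > 1 the numbers with a bad pair p, q amount to about N L (ln p) / p^2
  for each p, in total N L^(1-a) up to a small power of L, so an upper bound for the primes in the
  class 1 that is too large by a factor ln p suffices.\<close>

lemma (in group) conj_nat_pow:
  assumes "g \<in> carrier G" "y \<in> carrier G"
  shows "g \<otimes> (y [^] (n::nat)) \<otimes> inv g = (g \<otimes> y \<otimes> inv g) [^] n"
proof (induction n)
  case (Suc n)
  have "g \<otimes> (y [^] Suc n) \<otimes> inv g = (g \<otimes> (y [^] n) \<otimes> inv g) \<otimes> (g \<otimes> y \<otimes> inv g)"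
    using assms by (simp add: m_assoc inv_solve_left)
  then show ?case using Suc assms by simp
qed (use assms in simp)

text \<open>Conjugation by \<open>g\<close> multiplies the exponents of powers of \<open>x\<close>
  by \<open>a\<close>, modulo the order of \<open>x\<close>. The multiplicative order of
  \<open>a\<close> divides the order of \<open>g\<close>, hence the group order, and also the
  totient of the order of \<open>x\<close>, hence the totient of the group order. Coprimality forces
  it to be 1.\<close>

lemma (in group) central_if_conj_powers:
  assumes x: "x \<in> carrier G" and g: "g \<in> carrier G" and conj: "g \<otimes> x \<otimes> inv g = x [^] (a::nat)"
    and fin: "finite (carrier G)" and cop: "coprime (Coset.order G) (totient (Coset.order G))"
  shows "g \<otimes> x = x \<otimes> g"
proof -
  define m where "m = local.ord x"
  define k where "k = local.ord g"
  have m: "m dvd Coset.order G" and k: "k dvd Coset.order G" "k > 0"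
    using x g fin ord_dvd_group_order ord_ge_1 by (auto simp: m_def k_def Suc_le_eq)
  have iter: "(g [^] i) \<otimes> x \<otimes> inv (g [^] i) = x [^] (a ^ i)" for i :: nat
  proof (induction i)
    case (Suc i)
    have "(g [^] Suc i) = g \<otimes> (g [^] i)" using g by (simp add: nat_pow_comm[of g i 1, simplified] nat_pow_Suc2)
    then have "(g [^] Suc i) \<otimes> x \<otimes> inv (g [^] Suc i) = g \<otimes> ((g [^] i) \<otimes> x \<otimes> inv (g [^] i)) \<otimes> inv g"
      using g x by (simp add: m_assoc inv_mult_group)
    also have "\<dots> = (x [^] a) [^] (a ^ i)" unfolding Suc using conj_nat_pow[OF g x] conj by simp
    also have "\<dots> = x [^] (a ^ Suc i)" using x by (simp add: nat_pow_pow)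
    finally show ?case .
  qed (use x in simp)
  have pow_eq: "x [^] b = x [^] c \<longleftrightarrow> [b = c] (mod m)" for b c :: nat
  proof -
    have "x [^] b = x [^] c \<longleftrightarrow> x [^] int b = x [^] int c" by (simp add: int_pow_int)
    also have "\<dots> \<longleftrightarrow> int m dvd int c - int b" using x by (simp add: int_pow_eq m_def)
    also have "\<dots> \<longleftrightarrow> [int c = int b] (mod int m)" by (simp add: cong_iff_dvd_diff)
    also have "\<dots> \<longleftrightarrow> [b = c] (mod m)" by (simp add: cong_int_iff cong_sym_eq)
    finally show ?thesis .
  qed
  have "x [^] (a ^ k) = x [^] (1::nat)" using iter[of k] x g by (simp add: k_def)
  then have ak: "[a ^ k = 1] (mod m)" by (simp only: pow_eq)
  then have "coprime (a ^ k) m" using cong_imp_coprime cong_sym coprime_1_left by metis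
  then have am: "coprime m a" using k(2) by (simp add: coprime_commute)
  have "Pocklington.ord m a dvd k" using ak ord_divides by blast
  moreover have "Pocklington.ord m a dvd totient m" by (rule order_divides_totient[OF am])
  moreover have "totient m dvd totient (Coset.order G)" using m by (rule totient_dvd)
  ultimately have "Pocklington.ord m a = 1" using k(1) cop
    by (meson coprime_common_divisor_nat dvd_trans)
  then have "[a = 1] (mod m)" using ord[of a m] by simp
  then have "x [^] a = x" using pow_eq[of a 1] x by simp
  then have "g \<otimes> x \<otimes> inv g \<otimes> g = x \<otimes> g" using conj by simp
  then show ?thesis using g x by (simp add: m_assoc)
qed

text \<open>
  If \<open>G\<close> were not abelian, the centralizers of the non-central elements would be abelian,
  self-normalizing and pairwise equal or meeting in the centre \<open>Z\<close>. The conjugates of one of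
  them cover at least half of \<open>G\<close> but not all of \<open>G - Z\<close>, and two disjoint such
  families do not fit into \<open>G - Z\<close>.
\<close>

lemma (in group) comm_group_if_proper_subgroups_cyclic:
  assumes fin: "finite (carrier G)" and cop: "coprime (Coset.order G) (totient (Coset.order G))"
    and sub: "\<And>H. subgroup H G \<Longrightarrow> H \<noteq> carrier G \<Longrightarrow> \<exists>x\<in>H. \<forall>y\<in>H. \<exists>k::nat. y = x [^] k"
  shows "comm_group G"
proof (rule ccontr)
  assume nab: "\<not> comm_group G"
  define Z where "Z = {z \<in> carrier G. \<forall>g\<in>carrier G. g \<otimes> z = z \<otimes> g}"
  define C where "C x = {g \<in> carrier G. g \<otimes> x = x \<otimes> g}" for x
  have inv_comm: "inv a \<otimes> x = x \<otimes> inv a" if "a \<in> carrier G" "x \<in> carrier G" "a \<otimes> x = x \<otimes> a" for a x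
  proof -
    have "inv a \<otimes> x = inv a \<otimes> (x \<otimes> a) \<otimes> inv a" using that(1,2) by (simp add: m_assoc)
    also have "\<dots> = inv a \<otimes> (a \<otimes> x) \<otimes> inv a" using that(3) by simp
    also have "\<dots> = x \<otimes> inv a" using that(1,2) by (simp add: m_assoc[symmetric])
    finally show ?thesis .
  qed
  have mult_comm: "(a \<otimes> b) \<otimes> x = x \<otimes> (a \<otimes> b)"
    if "a \<in> carrier G" "b \<in> carrier G" "x \<in> carrier G" "a \<otimes> x = x \<otimes> a" "b \<otimes> x = x \<otimes> b" for a b x
  proof -
    have "(a \<otimes> b) \<otimes> x = a \<otimes> (x \<otimes> b)" using that by (simp add: m_assoc)
    also have "\<dots> = (x \<otimes> a) \<otimes> b" using that by (simp add: m_assoc[symmetric])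
    also have "\<dots> = x \<otimes> (a \<otimes> b)" using that by (simp add: m_assoc)
    finally show ?thesis .
  qed
  have ZG: "Z \<subseteq> carrier G" unfolding Z_def by blast
  have Zd: "g \<otimes> z = z \<otimes> g" if "z \<in> Z" "g \<in> carrier G" for g z
    using that unfolding Z_def by blast
  have Zi: "z \<in> Z" if "z \<in> carrier G" "\<And>g. g \<in> carrier G \<Longrightarrow> g \<otimes> z = z \<otimes> g" for z
    using that unfolding Z_def by blast
  have Csub: "subgroup (C x) G" if "x \<in> carrier G" for x
  proof (rule subgroupI)
    show "C x \<noteq> {}" using that by (auto simp: C_def intro!: exI[of _ x])
    fix a assume a: "a \<in> C x"
    then show "inv a \<in> C x" using that inv_comm[of a x] by (simp add: C_def)
  next
    fix a b assume "a \<in> C x" "b \<in> C x"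
    then show "a \<otimes> b \<in> C x" using that mult_comm[of a b x] by (simp add: C_def)
  qed (auto simp: C_def)
  have Zsub: "subgroup Z G"
  proof (rule subgroupI)
    have "\<one> \<in> Z" by (rule Zi) auto
    then show "Z \<noteq> {}" by blast
    fix a assume a: "a \<in> Z"
    show "inv a \<in> Z"
    proof (rule Zi)
      fix g assume g: "g \<in> carrier G"
      show "g \<otimes> inv a = inv a \<otimes> g"
        by (rule inv_comm[OF _ g Zd[OF a g, symmetric], symmetric]) (use a ZG in blast)
    qed (use a ZG in blast)
  next
    fix a b assume ab: "a \<in> Z" "b \<in> Z"
    then have abG: "a \<in> carrier G" "b \<in> carrier G" using ZG by auto
    show "a \<otimes> b \<in> Z"
    proof (rule Zi)
      fix g assume g: "g \<in> carrier G"
      show "g \<otimes> (a \<otimes> b) = a \<otimes> b \<otimes> g"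
        by (rule mult_comm[OF abG g Zd[OF ab(1) g, symmetric] Zd[OF ab(2) g, symmetric], symmetric])
    qed (use abG in simp)
  qed (rule ZG)
  have subab: "x \<otimes> y = y \<otimes> x" if H: "subgroup H G" "H \<noteq> carrier G" and xy: "x \<in> H" "y \<in> H" for H x y
  proof -
    from sub[OF H] obtain w where w: "w \<in> H" "\<forall>y\<in>H. \<exists>k::nat. y = w [^] k" by blast
    then obtain i j :: nat where "x = w [^] i" "y = w [^] j" using xy by blast
    moreover have "w \<in> carrier G" using w H subgroup.mem_carrier by fastforce
    ultimately show ?thesis by (simp add: nat_pow_mult add.commute)
  qed
  have Cne: "C x \<noteq> carrier G" if "x \<in> carrier G" "x \<notin> Z" for x
    using that unfolding C_def Z_def by blast
  have xC: "x \<in> C x" if "x \<in> carrier G" for x using that by (simp add: C_def)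
  have ZC: "Z \<subseteq> C x" if x: "x \<in> carrier G" for x
  proof
    fix z assume z: "z \<in> Z"
    then show "z \<in> C x" unfolding C_def using Zd[OF z x, symmetric] ZG by blast
  qed
  have Ceq: "C y = C x" if x: "x \<in> carrier G" "x \<notin> Z" and y: "y \<in> C x" "y \<notin> Z" for x y
  proof -
    have yG: "y \<in> carrier G" using y by (simp add: C_def)
    have "C x \<subseteq> C y"
    proof
      fix w assume w: "w \<in> C x"
      then have "w \<otimes> y = y \<otimes> w" using subab[OF Csub[OF x(1)] Cne[OF x]] y by blast
      then show "w \<in> C y" using w by (simp add: C_def)
    qed
    moreover have "C y \<subseteq> C x"
    proof
      fix w assume w: "w \<in> C y"
      have "x \<in> C y" using x y by (simp add: C_def)
      then have "w \<otimes> x = x \<otimes> w" using subab[OF Csub[OF yG] Cne[OF yG y(2)]] w by blast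
      then show "w \<in> C x" using w by (simp add: C_def)
    qed
    ultimately show ?thesis by blast
  qed
  define cj where "cj g y = g \<otimes> y \<otimes> inv g" for g y
  have cjG: "cj g y \<in> carrier G" if "g \<in> carrier G" "y \<in> carrier G" for g y using that by (simp add: cj_def)
  have cj_mult: "cj (g \<otimes> h) y = cj g (cj h y)" if "g \<in> carrier G" "h \<in> carrier G" "y \<in> carrier G" for g h y
    using that by (simp add: cj_def m_assoc inv_mult_group)
  have cj_one: "cj \<one> y = y" if "y \<in> carrier G" for y using that by (simp add: cj_def)
  have cj_inv: "cj (inv g) (cj g y) = y" "cj g (cj (inv g) y) = y" if "g \<in> carrier G" "y \<in> carrier G" for g y
    using that by (simp_all add: cj_mult[symmetric] cj_one)
  have cj_dist: "cj g (y \<otimes> w) = cj g y \<otimes> cj g w" if "g \<in> carrier G" "y \<in> carrier G" "w \<in> carrier G" for g y w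
    using that by (simp add: cj_def m_assoc inv_solve_left)
  have cj_fix: "cj g y = y \<longleftrightarrow> g \<in> C y" if "g \<in> carrier G" "y \<in> carrier G" for g y
    using that inv_solve_right[of y "g \<otimes> y" g] unfolding cj_def C_def by (simp add: eq_commute[of y])
  have cj_C: "cj g w \<in> C (cj g y)" if "g \<in> carrier G" "y \<in> carrier G" "w \<in> C y" for g w y
  proof -
    have w: "w \<in> carrier G" "w \<otimes> y = y \<otimes> w" using that by (auto simp: C_def)
    then have "cj g w \<otimes> cj g y = cj g y \<otimes> cj g w"
      using cj_dist[OF that(1) w(1) that(2)] cj_dist[OF that(1,2) w(1)] by simp
    then show ?thesis using that w by (simp add: C_def cjG)
  qed
  have cjZ: "cj g y \<in> Z \<longleftrightarrow> y \<in> Z" if g: "g \<in> carrier G" and y: "y \<in> carrier G" for g y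
  proof -
    have fixZ: "cj h w = w" if "w \<in> Z" "h \<in> carrier G" for h w
    proof -
      have "w \<in> carrier G" "h \<otimes> w = w \<otimes> h" using that ZG Zd[OF that] by auto
      then show ?thesis using that(2) by (simp add: cj_fix C_def)
    qed
    show ?thesis using fixZ[of y g] fixZ[of "cj g y" "inv g"] cj_inv(1)[OF g y] g by auto
  qed
  \<comment> \<open>If the normalizer \<open>N\<close> of \<open>C x\<close> is proper, it is
    abelian and so centralizes its member \<open>x\<close>. If it is the whole group, conjugation
    sends a generator of the cyclic group \<open>C x\<close> to powers of itself;
    \<open>central_if_conj_powers\<close> makes the generator central, and \<open>x\<close> with it.
    This is how coprimality with the totient enters.\<close>
  have normalizer: "h \<in> C x" if x: "x \<in> carrier G" "x \<notin> Z" and h: "h \<in> carrier G"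
    and hC: "cj h ` C x = C x" for x h
  proof (rule ccontr)
    assume hn: "h \<notin> C x"
    define N where "N = {h \<in> carrier G. cj h ` C x = C x}"
    have CG: "C x \<subseteq> carrier G" by (auto simp: C_def)
    have "subgroup N G"
    proof (rule subgroupI)
      have "cj \<one> ` C x = C x" using cj_one CG by (auto simp: image_def subset_eq)
      then show "N \<noteq> {}" by (auto simp: N_def)
      fix a assume a: "a \<in> N"
      have "cj (inv a) ` C x = cj (inv a) ` (cj a ` C x)" using a by (simp add: N_def)
      also have "\<dots> = C x"
      proof -
        have "cj (inv a) ` (cj a ` C x) = (\<lambda>w. w) ` C x"
          unfolding image_image by (rule image_cong[OF refl cj_inv(1)]) (use a CG in \<open>auto simp: N_def\<close>)
        then show ?thesis by simp
      qed
      finally show "inv a \<in> N" using a by (simp add: N_def)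
    next
      fix a b assume ab: "a \<in> N" "b \<in> N"
      have "cj (a \<otimes> b) ` C x = cj a ` (cj b ` C x)"
        unfolding image_image using ab CG by (intro image_cong refl cj_mult) (auto simp: N_def)
      then show "a \<otimes> b \<in> N" using ab by (simp add: N_def)
    qed (auto simp: N_def)
    have xN: "x \<in> N"
    proof -
      have "cj x w = w" if "w \<in> C x" for w
        using that x by (subst cj_fix) (auto simp: C_def)
      then show ?thesis using x by (auto simp: N_def image_def)
    qed
    show False
    proof (cases "N = carrier G")
      case False
      have "h \<in> N" using h hC by (simp add: N_def)
      then have "h \<otimes> x = x \<otimes> h" using subab[OF \<open>subgroup N G\<close> False] xN by blast
      then show False using hn h by (simp add: C_def)
    next
      case True
      from sub[OF Csub[OF x(1)] Cne[OF x]] obtain y where y: "y \<in> C x" "\<forall>u\<in>C x. \<exists>k::nat. u = y [^] k" by blast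
      have yG: "y \<in> carrier G" using y CG by blast
      have "g \<otimes> y = y \<otimes> g" if g: "g \<in> carrier G" for g
      proof -
        have "cj g y \<in> C x" using g True y(1) by (auto simp: N_def)
        then obtain a :: nat where "cj g y = y [^] a" using y(2) by blast
        then show ?thesis
          using central_if_conj_powers[OF yG g _ fin cop] by (simp add: cj_def)
      qed
      then have "y \<in> Z" using yG Zi by blast
      from xC[OF x(1)] y(2) obtain k :: nat where "x = y [^] k" by blast
      moreover have "y [^] k \<in> Z" for k :: nat
      proof (induction k)
        case 0 show ?case using subgroup.one_closed[OF Zsub] by simp
      next
        case (Suc k) then show ?case using subgroup.m_closed[OF Zsub _ \<open>y \<in> Z\<close>] by simp
      qed
      ultimately show False using x by blast
    qed
  qed
  define n where "n = card (carrier G)"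
  define U where "U x = (\<lambda>(g, y). cj g y) ` (carrier G \<times> (C x - Z))" for x
  \<comment> \<open>Pairs \<open>(g, y)\<close> are counted by their conjugate
    \<open>cj g y\<close>. A fibre is one coset of \<open>C x\<close> with one \<open>y\<close>: an
    \<open>h\<close> carrying \<open>y\<close> to \<open>y0\<close> maps the common centralizer
    \<open>C x\<close> to itself, so it lies in \<open>C x\<close> by \<open>normalizer\<close> and
    fixes \<open>y\<close>.\<close>
  have cardU: "card (U x) * card (C x) = n * (card (C x) - card Z)" if x: "x \<in> carrier G" "x \<notin> Z" for x
  proof -
    define S where "S = carrier G \<times> (C x - Z)"
    have CG: "C x \<subseteq> carrier G" by (auto simp: C_def)
    have finS: "finite S" using fin finite_subset[OF CG] by (simp add: S_def)
    have fibre: "card {s \<in> S. (\<lambda>(g, y). cj g y) s = u} = card (C x)" if u: "u \<in> U x" for u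
    proof -
      from u obtain g0 y0 where g0: "g0 \<in> carrier G" and y0: "y0 \<in> C x" "y0 \<notin> Z" and u: "u = cj g0 y0"
        by (auto simp: U_def)
      have y0G: "y0 \<in> carrier G" using y0 CG by blast
      have "{s \<in> S. (\<lambda>(g, y). cj g y) s = u} = (\<lambda>h. (g0 \<otimes> h, y0)) ` C x"
      proof (intro equalityI subsetI)
        fix s assume "s \<in> (\<lambda>h. (g0 \<otimes> h, y0)) ` C x"
        then obtain h where h: "h \<in> C x" "s = (g0 \<otimes> h, y0)" by blast
        have "h \<in> C y0" using h Ceq[OF x y0] by simp
        then have "cj h y0 = y0" using cj_fix[of h y0] y0G h(1) CG by auto
        then show "s \<in> {s \<in> S. (\<lambda>(g, y). cj g y) s = u}"
          using h g0 y0 y0G CG cj_mult[of g0 h y0] by (auto simp: S_def u)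
      next
        fix s assume "s \<in> {s \<in> S. (\<lambda>(g, y). cj g y) s = u}"
        then obtain g y where s: "s = (g, y)" "g \<in> carrier G" "y \<in> C x" "y \<notin> Z" "cj g y = u"
          by (auto simp: S_def)
        have yG: "y \<in> carrier G" using s CG by blast
        define h where "h = inv g0 \<otimes> g"
        have hG: "h \<in> carrier G" using g0 s by (simp add: h_def)
        have g: "g = g0 \<otimes> h" using g0 s by (simp add: h_def m_assoc[symmetric])
        have hy: "cj h y = y0"
          unfolding h_def using cj_mult[of "inv g0" g y] s g0 yG cj_inv(1)[OF g0 y0G] u by simp
        have "cj h ` C x = C x"
        proof (intro equalityI subsetI)
          fix w assume "w \<in> cj h ` C x"
          then obtain v where v: "v \<in> C y" "w = cj h v" using Ceq[OF x s(3,4)] by blast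
          then show "w \<in> C x" using cj_C[OF hG yG v(1)] hy Ceq[OF x y0] by simp
        next
          fix w assume w: "w \<in> C x"
          then have wG: "w \<in> carrier G" using CG by blast
          have "cj (inv h) y0 = y" using hy cj_inv(1)[OF hG yG] by simp
          then have "cj (inv h) w \<in> C x"
            using cj_C[of "inv h" y0 w] hG y0G w Ceq[OF x y0] Ceq[OF x s(3,4)] by simp
          then show "w \<in> cj h ` C x" using cj_inv(2)[OF hG wG] by force
        qed
        then have hC: "h \<in> C x" by (rule normalizer[OF x hG])
        then have "h \<in> C y" using Ceq[OF x s(3,4)] by simp
        then have "y = y0" using cj_fix[OF hG yG] hy by simp
        then show "s \<in> (\<lambda>h. (g0 \<otimes> h, y0)) ` C x" using s g hC by blast
      qed
      moreover have "inj_on (\<lambda>h. (g0 \<otimes> h, y0)) (C x)"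
        using g0 CG by (auto simp: inj_on_def subset_eq)
      ultimately show ?thesis by (simp add: card_image)
    qed
    have "card S = (\<Sum>u\<in>U x. card {s \<in> S. (\<lambda>(g, y). cj g y) s = u})"
      using sum.group[OF finS, of "U x" "\<lambda>(g, y). cj g y" "\<lambda>_. 1::nat"] finS
      by (auto simp: U_def S_def)
    also have "\<dots> = card (U x) * card (C x)" using fibre by simp
    finally have "card (U x) * card (C x) = card S" by simp
    also have "\<dots> = n * (card (C x) - card Z)"
      unfolding S_def n_def card_cartesian_product
      using ZC[OF x(1)] finite_subset[OF ZG fin] by (simp add: card_Diff_subset)
    finally show ?thesis .
  qed
  have n0: "n > 0" using fin one_closed by (auto simp: n_def card_gt_0_iff)
  have Zpos: "card Z > 0" using finite_subset[OF ZG fin] subgroup.one_closed[OF Zsub] by (auto simp: card_gt_0_iff)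
  \<comment> \<open>By Lagrange the proper subgroup \<open>Z\<close> has index at least 2 in
    \<open>C x\<close>, so the share 1 - |Z| / |C x| of the group that \<open>cardU\<close> assigns
    to \<open>U x\<close> is at least 1/2.\<close>
  have half: "n \<le> 2 * card (U x)" if x: "x \<in> carrier G" "x \<notin> Z" for x
  proof -
    have finC: "finite (C x)" using fin by (auto simp: C_def)
    interpret Cg: group "G\<lparr>carrier := C x\<rparr>" using Csub[OF x(1)] by (rule subgroup_imp_group)
    have "subgroup Z (G\<lparr>carrier := C x\<rparr>)"
      using subgroup_incl[OF Zsub Csub[OF x(1)] ZC[OF x(1)]] .
    from Cg.lagrange[OF this] have "card Z dvd card (C x)"
      unfolding Coset.order_def by (simp add: dvd_def) (metis mult.commute)
    then obtain t where t: "card (C x) = card Z * t" by auto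
    have "card Z < card (C x)" using ZC[OF x(1)] xC[OF x(1)] x finC by (intro psubset_card_mono) auto
    then have "t \<ge> 2" using t Zpos by (cases t; cases "t - 1") auto
    then have "card (C x) \<ge> 2 * card Z" unfolding t by (simp add: mult.commute)
    then have "n * card (C x) \<le> n * (2 * (card (C x) - card Z))" by (intro mult_le_mono) auto
    also have "\<dots> = 2 * card (U x) * card (C x)" using cardU[OF x] by simp
    finally show ?thesis using \<open>card Z < card (C x)\<close> by simp
  qed
  have finU: "finite (U x)" for x unfolding U_def using fin by (auto simp: C_def)
  have UG: "U x \<subseteq> carrier G - Z" if x: "x \<in> carrier G" for x
    using cjG cjZ by (auto simp: U_def C_def)
  have "Z \<noteq> carrier G"
  proof
    assume "Z = carrier G"
    then have "comm_group G" using Zd by (intro group_comm_groupI) blast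
    with nab show False ..
  qed
  then obtain x where x: "x \<in> carrier G" "x \<notin> Z" using ZG by blast
  \<comment> \<open>Equality would turn \<open>cardU\<close> into
    \<open>card Z * card (C x) = n * card Z\<close>, although \<open>C x\<close> is proper.\<close>
  have "U x \<noteq> carrier G - Z"
  proof
    assume "U x = carrier G - Z"
    then have "card (U x) = n - card Z"
      using finite_subset[OF ZG fin] ZG by (simp add: card_Diff_subset n_def)
    then have e: "(n - card Z) * card (C x) = n * (card (C x) - card Z)" using cardU[OF x] by simp
    have zc: "card Z \<le> card (C x)" using ZC[OF x(1)] fin by (intro card_mono) (auto simp: C_def)
    have lt: "card (C x) < n"
      unfolding n_def using Cne[OF x] fin by (intro psubset_card_mono) (auto simp: C_def)
    have "n * card Z \<le> n * card (C x)" "card Z * card (C x) \<le> n * card (C x)"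
      using zc lt by (auto intro!: mult_le_mono)
    moreover have "n * card (C x) - card Z * card (C x) = n * card (C x) - n * card Z"
      using e by (simp only: diff_mult_distrib diff_mult_distrib2)
    ultimately have "card Z * card (C x) = n * card Z" by linarith
    then show False using Zpos lt by simp
  qed
  then obtain y where y: "y \<in> carrier G" "y \<notin> Z" "y \<notin> U x" using UG[OF x(1)] by blast
  \<comment> \<open>A common non-central element would make the two centralizers conjugate and put
    \<open>y\<close> into \<open>U x\<close>.\<close>
  have "U x \<inter> U y = {}"
  proof (rule ccontr)
    assume "U x \<inter> U y \<noteq> {}"
    then obtain g a h b where ga: "g \<in> carrier G" "a \<in> C x" "a \<notin> Z" and hb: "h \<in> carrier G" "b \<in> C y" "b \<notin> Z"
      and eq: "cj g a = cj h b" by (auto simp: U_def)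
    have aG: "a \<in> carrier G" "b \<in> carrier G" using ga hb by (auto simp: C_def)
    define k where "k = inv g \<otimes> h"
    have kG: "k \<in> carrier G" using ga hb by (simp add: k_def)
    have ka: "cj k b = a"
      unfolding k_def using cj_mult[of "inv g" h b] ga hb aG cj_inv(1)[OF ga(1) aG(1)] eq by simp
    have "y \<in> C b" using Ceq[OF y(1,2) hb(2,3)] xC[OF y(1)] by simp
    then have "cj k y \<in> C x" using cj_C[OF kG aG(2)] ka Ceq[OF x ga(2,3)] by metis
    moreover have "cj k y \<notin> Z" using cjZ[OF kG y(1)] y by simp
    moreover have "y = cj (inv k) (cj k y)" using cj_inv(1)[OF kG y(1)] by simp
    ultimately have "y \<in> U x" unfolding U_def using kG by (intro image_eqI[of _ _ "(inv k, cj k y)"]) auto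
    with y show False by blast
  qed
  then have "card (U x) + card (U y) = card (U x \<union> U y)" using finU by (simp add: card_Un_disjoint)
  also have "\<dots> \<le> card (carrier G - Z)" using UG x y fin by (intro card_mono) auto
  also have "\<dots> = n - card Z" using finite_subset[OF ZG fin] ZG by (simp add: card_Diff_subset n_def)
  finally show False using half[OF x] half[OF y(1,2)] n0 Zpos by linarith
qed

section \<open>Squarefree orders and the arithmetic criterion\<close>

text \<open>Raising \<open>(x \<otimes> y) [^] k = \<one>\<close> to the order of \<open>y\<close>
  removes the factor \<open>y\<close>, so the order of \<open>x\<close> divides \<open>k\<close>
  times that of \<open>y\<close> and, by coprimality, \<open>k\<close> itself.\<close>

lemma (in comm_group) ord_mult_coprime:
  assumes x: "x \<in> carrier G" and y: "y \<in> carrier G" and cop: "coprime (local.ord x) (local.ord y)"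
  shows "local.ord x * local.ord y dvd local.ord (x \<otimes> y)"
proof -
  define k where "k = local.ord (x \<otimes> y)"
  have e: "x [^] (k * i) \<otimes> y [^] (k * i) = \<one>" for i
  proof -
    have "x [^] (k * i) \<otimes> y [^] (k * i) = (x \<otimes> y) [^] (k * i)"
      using x y by (simp add: pow_mult_distrib m_comm)
    also have "\<dots> = \<one>" using x y by (subst pow_eq_id) (auto simp: k_def)
    finally show ?thesis .
  qed
  have "y [^] (k * local.ord y) = \<one>" "x [^] (k * local.ord x) = \<one>" using x y by (auto simp: pow_eq_id)
  then have "x [^] (k * local.ord y) = \<one>" "y [^] (k * local.ord x) = \<one>"
    using e[of "local.ord y"] e[of "local.ord x"] x y by auto
  then have "local.ord x dvd k * local.ord y" "local.ord y dvd k * local.ord x"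
    using x y by (auto simp: pow_eq_id)
  then have "local.ord x dvd k" "local.ord y dvd k"
    using cop by (auto simp: coprime_dvd_mult_left_iff coprime_commute)
  then show ?thesis using cop by (simp add: k_def divides_mult)
qed

text \<open>An element of maximal order \<open>M\<close> generates the group. Otherwise a prime p
  divides |G| / M, and not \<open>M\<close> since |G| is squarefree; multiplying by an element of
  order p, which Sylow's theorem supplies, would raise the order to at least M p.\<close>

lemma (in comm_group) cyclic_group_if_squarefree_order:
  assumes fin: "finite (carrier G)" and sqf: "\<And>p. prime p \<Longrightarrow> \<not> p\<^sup>2 dvd Coset.order G"
  shows "cyclic_group G"
proof -
  define M where "M = Max (local.ord ` carrier G)"
  have "M \<in> local.ord ` carrier G" unfolding M_def using fin by (intro Max_in) auto
  then obtain g where g: "g \<in> carrier G" "local.ord g = M" by blast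
  have max: "local.ord h \<le> M" if "h \<in> carrier G" for h unfolding M_def using that fin by (intro Max_ge) auto
  have Mdvd: "M dvd Coset.order G" using ord_dvd_group_order[OF g(1)] g by simp
  have "M = Coset.order G"
  proof (rule ccontr)
    assume ne: "M \<noteq> Coset.order G"
    obtain t where t: "Coset.order G = M * t" using Mdvd by auto
    have "t \<noteq> 1" using t ne by auto
    then obtain p where p: "prime p" "p dvd t" using prime_factor_nat by blast
    then obtain t' where "t = p * t'" by auto
    then have t': "Coset.order G = p ^ 1 * (M * t')" using t by simp
    have "\<not> p dvd M"
    proof
      assume "p dvd M"
      then have "p * p dvd Coset.order G" unfolding t using p by (intro mult_dvd_mono) auto
      then show False using sqf[OF p(1)] by (simp add: power2_eq_square)
    qed
    from sylow_thm[OF p(1) is_group t' fin] obtain H where H: "subgroup H G" "card H = p" by auto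
    have "\<exists>x\<in>H. x \<noteq> \<one>"
    proof (rule ccontr)
      assume "\<not> (\<exists>x\<in>H. x \<noteq> \<one>)"
      then have "H \<subseteq> {\<one>}" by blast
      then have "card H \<le> 1" using card_mono[of "{\<one>}" H] by simp
      then show False using H prime_gt_1_nat[OF p(1)] by simp
    qed
    then obtain x where x: "x \<in> H" "x \<noteq> \<one>" by blast
    have xG: "x \<in> carrier G" using subgroup.mem_carrier[OF H(1) x(1)] .
    have "generate G {x} \<subseteq> H" using H(1) x(1) by (simp add: generate_subgroup_incl)
    interpret Hg: group "G\<lparr>carrier := H\<rparr>" using H(1) by (rule subgroup_imp_group)
    have "x [^]\<^bsub>G\<lparr>carrier := H\<rparr>\<^esub> card H = \<one>" using Hg.pow_order_eq_1[of x] x(1) by (simp add: Coset.order_def)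
    then have "x [^] p = \<one>" using H(2) by (simp add: nat_pow_consistent[symmetric])
    then have "local.ord x dvd p" using xG by (simp add: pow_eq_id)
    moreover have "local.ord x \<noteq> 1" using ord_eq_1[OF xG] x by simp
    ultimately have ox: "local.ord x = p" using p(1) prime_nat_iff by blast
    have "coprime (local.ord g) (local.ord x)"
      using \<open>\<not> p dvd M\<close> p(1) by (metis ox g(2) prime_imp_coprime coprime_commute)
    from ord_mult_coprime[OF g(1) xG this] have "M * p dvd local.ord (g \<otimes> x)" by (simp add: ox g)
    moreover have "local.ord (g \<otimes> x) > 0" using ord_ge_1[OF fin, of "g \<otimes> x"] g(1) xG by simp
    ultimately have "M * p \<le> local.ord (g \<otimes> x)" by (rule dvd_imp_le)
    also have "\<dots> \<le> M" using max g(1) xG by simp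
    finally have "M * p \<le> M * 1" by simp
    moreover have "M > 0" using ord_ge_1[OF fin g(1)] g(2) by simp
    ultimately show False using prime_gt_1_nat[OF p(1)] by simp
  qed
  then have "card (generate G {g}) = card (carrier G)"
    using generate_pow_card[OF g(1)] g(2) by (simp add: Coset.order_def)
  then have "generate G {g} = carrier G"
    using fin g(1) by (intro card_subset_eq) (auto intro: generate_in_carrier)
  then have "subgroup_generated G {g} = G"
    using g(1) by (simp add: subgroup_generated_def Int_absorb1)
  then show ?thesis using g(1) unfolding cyclic_group_def by blast
qed

lemma coprime_totient_imp_squarefree:
  assumes "coprime n (totient n)" "prime p"
  shows "\<not> p\<^sup>2 dvd n"
proof
  assume d: "p\<^sup>2 dvd n"
  then have "totient (p\<^sup>2) dvd totient n" by (rule totient_dvd)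
  moreover have "totient (p\<^sup>2) = p * (p - 1)" using totient_prime_power[OF assms(2), of 2] by simp
  ultimately have "p dvd totient n" by (metis dvd_mult_left)
  moreover have "p dvd n" using d by (simp add: power2_eq_square dvd_mult_left)
  ultimately show False using assms coprime_common_divisor_nat[of n "totient n" p] by auto
qed

text \<open>Coprimality with the totient passes to divisors, so by Lagrange and induction on the
  order all proper subgroups are cyclic. This gives commutativity, and squarefreeness gives
  cyclicity.\<close>

lemma cyclic_number_if_coprime_totient:
  assumes "n > 0" "coprime n (totient n)"
  shows "cyclic_number n"
  using assms
proof (induction n rule: less_induct)
  case (less n)
  show ?case unfolding cyclic_number_def
  proof (intro conjI allI impI)
    show "0 < n" by fact
    fix G :: "nat monoid" assume "group G" and ord: "Coset.order G = n"
    interpret group G by fact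
    have fin: "finite (carrier G)" using ord less.prems by (metis Coset.order_def card.infinite less_numeral_extra(3))
    have "comm_group G"
    proof (rule comm_group_if_proper_subgroups_cyclic[OF fin])
      show "coprime (Coset.order G) (totient (Coset.order G))" using ord less.prems by simp
      fix H assume H: "subgroup H G" "H \<noteq> carrier G"
      have HG: "H \<subseteq> carrier G" using H(1) by (rule subgroup.subset)
      have finH: "finite H" using HG fin finite_subset by blast
      have "card H dvd n" using lagrange[OF H(1)] ord by (metis dvd_triv_right)
      moreover have "card H < n" using HG H fin ord by (metis Coset.order_def psubsetI psubset_card_mono)
      moreover have "card H > 0" using finH subgroup.one_closed[OF H(1)] by (auto simp: card_gt_0_iff)
      moreover have "coprime (card H) (totient (card H))"
        using less.prems(2) \<open>card H dvd n\<close> totient_dvd[OF \<open>card H dvd n\<close>] by (meson coprime_divisors)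
      ultimately have "cyclic_number (card H)" by (intro less.IH)
      moreover have Hgrp: "group (G\<lparr>carrier := H\<rparr>)" using H(1) by (rule subgroup_imp_group)
      ultimately have "cyclic_group (G\<lparr>carrier := H\<rparr>)"
        by (rule cyclic_number_imp_cyclic_group) (simp add: Coset.order_def)
      then obtain x where x: "x \<in> H" "H = range (\<lambda>n::int. x [^]\<^bsub>G\<lparr>carrier := H\<rparr>\<^esub> n)"
        using group.cyclic_group[OF Hgrp] by auto
      have xG: "x \<in> carrier G" using x(1) HG by blast
      have "\<exists>k::nat. y = x [^]\<^bsub>G\<^esub> k" if y: "y \<in> H" for y
      proof -
        from x(2) y obtain i :: int where "y = x [^]\<^bsub>G\<lparr>carrier := H\<rparr>\<^esub> i" by blast
        then have i: "y = x [^]\<^bsub>G\<^esub> i" using int_pow_consistent[OF H(1) x(1)] by simp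
        define k where "k = nat (i mod int (group.ord G x))"
        have "group.ord G x > 0" using ord_ge_1[OF fin xG] by simp
        then have "int k = i mod int (group.ord G x)" by (simp add: k_def)
        then have "int (group.ord G x) dvd int k - i" by (simp add: mod_eq_dvd_iff[symmetric])
        then have "x [^]\<^bsub>G\<^esub> i = x [^]\<^bsub>G\<^esub> int k" using int_pow_eq[OF xG] by blast
        then show ?thesis using i by (auto simp: int_pow_int)
      qed
      then show "\<exists>x\<in>H. \<forall>y\<in>H. \<exists>k::nat. y = x [^]\<^bsub>G\<^esub> k" using x(1) by blast
    qed
    then show "cyclic_group G"
      by (rule comm_group.cyclic_group_if_squarefree_order[OF _ fin])
         (use ord less.prems coprime_totient_imp_squarefree in blast)
  qed
qed

text \<open>For squarefree \<open>n\<close> the totient is the product of q - 1 over the primes q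
  dividing \<open>n\<close>; a prime p dividing both \<open>n\<close> and this product divides some
  q - 1.\<close>

lemma coprime_totient_if_no_congruent_primes:
  assumes n: "n > 0" and sqf: "\<And>p. prime p \<Longrightarrow> \<not> p\<^sup>2 dvd n"
    and pq: "\<And>p q. prime p \<Longrightarrow> prime q \<Longrightarrow> p dvd n \<Longrightarrow> q dvd n \<Longrightarrow> \<not> [q = 1] (mod p)"
  shows "coprime n (totient n)"
proof (rule ccontr)
  assume "\<not> coprime n (totient n)"
  then obtain p where p: "prime p" "p dvd n" "p dvd totient n"
    using n by (metis coprime_iff_gcd_eq_1 gcd_greatest_iff prime_factor_nat)
  have "totient n = (\<Prod>q\<in>prime_factors n. q ^ (multiplicity q n - 1) * (q - 1))"
    by (rule totient_formula1[OF n])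
  then obtain q where q: "q \<in> prime_factors n" "p dvd q ^ (multiplicity q n - 1) * (q - 1)"
    using p prime_dvd_prod_iff[of "prime_factors n" p] by auto
  have pq': "prime q" "q dvd n" using q by (auto simp: prime_factors_dvd)
  have "multiplicity q n < 2"
    using sqf[OF pq'(1)] n pq'(1) by (metis multiplicity_dvd' not_less)
  then have "p dvd q - 1" using q(2) by (cases "multiplicity q n") auto
  then have "[q = 1] (mod p)" using prime_ge_1_nat[OF pq'(1)]
    by (metis cong_altdef_nat cong_sym)
  then show False using pq[OF p(1) pq'(1) p(2) pq'(2)] by blast
qed

text \<open>Since p divides q - 1, there is a nonabelian semidirect product of Z/q by Z/p. Its
  direct product with a cyclic group of order n / (p q) has order \<open>n\<close> and is
  nonabelian.\<close>

lemma not_cyclic_number_if_congruent_primes: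
  assumes p: "prime p" "p dvd n" and q: "prime q" "q dvd n" and cong: "[q = 1] (mod p)"
  shows "\<not> cyclic_number n"
proof
  assume cyc: "cyclic_number n"
  then have n: "n > 0" by (simp add: cyclic_number_def)
  have p1: "p > 1" and q1: "q > 1" using p q prime_gt_1_nat by auto
  have pq: "p \<noteq> q" using cong p1 by (auto simp: Cong.cong_def)
  have "coprime p q" using p q pq by (simp add: primes_coprime)
  then have "p * q dvd n" using p q by (simp add: divides_mult)
  then obtain m where m: "n = p * q * m" by auto
  have m0: "m > 0" using m n by (cases m) auto
  have "p dvd q - 1" using cong q1 by (metis cong_altdef_nat cong_sym less_imp_le)
  then obtain k where k: "q - 1 = p * k" by auto
  obtain g where g: "residue_primroot q g" using prime_primitive_root_exists[OF q1 q(1)] by blast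
  have ordg: "Pocklington.ord q g = p * k" using g q(1) k by (simp add: residue_primroot_def totient_prime)
  \<comment> \<open>The primitive root \<open>g\<close> has order p k = q - 1 modulo q, so
    \<open>r\<close> has order p. In the group below, \<open>(0, 1)\<close> acts on the first
    coordinate as multiplication by \<open>r\<close>.\<close>
  define r where "r = g ^ k"
  have k0: "k > 0" using k q1 by (cases k) auto
  have rp: "[r ^ p = 1] (mod q)"
    using ord_divides[of g "p * k" q] ordg by (simp add: r_def power_mult[symmetric] mult.commute)
  have r1: "\<not> [r = 1] (mod q)"
  proof
    assume "[r = 1] (mod q)"
    then have "p * k dvd k" unfolding r_def ordg[symmetric] using ord_divides by blast
    then show False using k0 p1 dvd_imp_le[of "p * k" k] by simp
  qed
  have rmod: "[r ^ (i mod p) = r ^ i] (mod q)" for i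
  proof -
    have "r ^ i = (r ^ p) ^ (i div p) * r ^ (i mod p)"
      by (simp add: power_mult[symmetric] power_add[symmetric])
    also have "[(r ^ p) ^ (i div p) * r ^ (i mod p) = 1 ^ (i div p) * r ^ (i mod p)] (mod q)"
      by (intro cong_mult cong_pow rp cong_refl)
    finally show ?thesis by (simp add: cong_sym_eq)
  qed
  \<comment> \<open>the nonabelian group of order \<open>pq\<close>\<close>
  define S :: "(nat \<times> nat) monoid" where
    "S = \<lparr>carrier = {..<q} \<times> {..<p},
          mult = (\<lambda>(a, b) (a', b'). ((a + r ^ b * a') mod q, (b + b') mod p)), one = (0, 0)\<rparr>"
  have "group S"
  proof (rule groupI)
    fix x y z assume "x \<in> carrier S" "y \<in> carrier S" "z \<in> carrier S"
    obtain a b where x: "x = (a, b)" by fastforce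
    obtain a' b' where y: "y = (a', b')" by fastforce
    obtain a'' b'' where z: "z = (a'', b'')" by fastforce
    have "[(a + r ^ b * a') mod q + r ^ ((b + b') mod p) * a'' = (a + r ^ b * a') + r ^ (b + b') * a''] (mod q)"
      by (intro cong_add cong_mult rmod cong_refl) (simp add: Cong.cong_def)
    moreover have "[a + r ^ b * ((a' + r ^ b' * a'') mod q) = a + r ^ b * (a' + r ^ b' * a'')] (mod q)"
      by (intro cong_add cong_mult cong_refl) (simp add: Cong.cong_def)
    ultimately have "((a + r ^ b * a') mod q + r ^ ((b + b') mod p) * a'') mod q
       = (a + r ^ b * ((a' + r ^ b' * a'') mod q)) mod q"
      by (simp add: Cong.cong_def algebra_simps power_add)
    then show "x \<otimes>\<^bsub>S\<^esub> y \<otimes>\<^bsub>S\<^esub> z = x \<otimes>\<^bsub>S\<^esub> (y \<otimes>\<^bsub>S\<^esub> z)"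
      by (simp add: S_def x y z mod_simps add.assoc)
  next
    fix x assume x: "x \<in> carrier S"
    then obtain a b where ab: "x = (a, b)" "a < q" "b < p" by (auto simp: S_def)
    define b' where "b' = (p - b) mod p"
    define a' where "a' = (q - (r ^ b' * a) mod q) mod q"
    have "(a' + r ^ b' * a) mod q = 0"
    proof -
      have "(a' + r ^ b' * a) mod q = ((q - (r ^ b' * a) mod q) + (r ^ b' * a) mod q) mod q"
        by (simp add: a'_def mod_simps)
      then show ?thesis using q1 by simp
    qed
    moreover have "(b' + b) mod p = 0"
    proof -
      have "(b' + b) mod p = ((p - b) + b) mod p" by (simp add: b'_def mod_simps)
      then show ?thesis using ab by simp
    qed
    ultimately have "(a', b') \<otimes>\<^bsub>S\<^esub> x = \<one>\<^bsub>S\<^esub>" by (simp add: S_def ab)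
    moreover have "(a', b') \<in> carrier S" using p1 q1 by (simp add: S_def a'_def b'_def)
    ultimately show "\<exists>y\<in>carrier S. y \<otimes>\<^bsub>S\<^esub> x = \<one>\<^bsub>S\<^esub>" by blast
  qed (use p1 q1 in \<open>auto simp: S_def\<close>)
  define P where "P = S \<times>\<times> integer_mod_group m"
  have grp: "group P" unfolding P_def using \<open>group S\<close> by (intro DirProd_group) auto
  have "Coset.order P = n"
    using m0 by (simp add: Coset.order_def P_def DirProd_def S_def carrier_integer_mod_group card_cartesian_product m mult_ac)
  then have "cyclic_group P" using cyclic_number_imp_cyclic_group[OF cyc grp] by simp
  then have "comm_group P" using group.cyclic_imp_abelian_group[OF grp] by simp
  then interpret P: comm_group P .
  \<comment> \<open>The products in the two orders are \<open>((1, 1), 0)\<close> and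
    \<open>((r mod q, 1), 0)\<close>.\<close>
  let ?x = "((1, 0), 0) :: (nat \<times> nat) \<times> int" and ?y = "((0, 1), 0) :: (nat \<times> nat) \<times> int"
  have "?x \<in> carrier P" "?y \<in> carrier P" using p1 q1 by (auto simp: P_def DirProd_def S_def)
  then have "?x \<otimes>\<^bsub>P\<^esub> ?y = ?y \<otimes>\<^bsub>P\<^esub> ?x" by (rule P.m_comm)
  then have "r mod q = 1 mod q" using q1 by (simp add: P_def DirProd_def S_def)
  then show False using r1 by (simp add: Cong.cong_def)
qed

section \<open>A quantitative Dirichlet theorem for the residue class 1\<close>

text \<open>Dirichlet's test by Abel summation. The variation of \<open>w\<close> is majorized by
  the decrements of a second sequence \<open>v\<close>, so that the non-monotone weights of
  \<open>L_lipschitz\<close> are covered and the bound telescopes to \<open>v 0\<close>.\<close>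

lemma bounded_variation_series:
  fixes a :: "nat \<Rightarrow> 'a::banach" and w v :: "nat \<Rightarrow> real"
  assumes B: "\<And>N. norm (\<Sum>n<N. a n) \<le> B"
    and wv: "\<And>n. \<bar>w n - w (Suc n)\<bar> \<le> v n - v (Suc n)"
    and w: "w \<longlonglongrightarrow> 0" and v: "v \<longlonglongrightarrow> 0"
  shows "summable (\<lambda>n. w n *\<^sub>R a n)" and "norm (\<Sum>n. w n *\<^sub>R a n) \<le> B * v 0"
proof -
  define S where "S N = (\<Sum>n<N. a n)" for N
  define T where "T n = (w n - w (Suc n)) *\<^sub>R S (Suc n)" for n
  have parts: "(\<Sum>n<N. w n *\<^sub>R a n) = w N *\<^sub>R S N + (\<Sum>n<N. T n)" for N
    by (induction N) (simp_all add: S_def T_def algebra_simps)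
  have bd: "norm (T n) \<le> B * (v n - v (Suc n))" for n
    unfolding T_def using mult_mono[OF wv[of n] B[of "Suc n"]] wv[of n]
    by (simp add: S_def mult.commute)
  have vs: "(\<lambda>n. B * (v n - v (Suc n))) sums (B * v 0)"
    using sums_mult[OF telescope_sums'[OF v], of B] by simp
  have Ts: "summable (\<lambda>n. norm (T n))"
    by (rule summable_comparison_test'[OF sums_summable[OF vs], of 0]) (use bd in auto)
  have Tb: "norm (\<Sum>n. T n) \<le> B * v 0"
  proof -
    have "norm (\<Sum>n. T n) \<le> (\<Sum>n. norm (T n))" by (rule summable_norm[OF Ts])
    also have "\<dots> \<le> (\<Sum>n. B * (v n - v (Suc n)))"
      by (intro suminf_le Ts sums_summable[OF vs] bd)
    also have "\<dots> = B * v 0" using vs by (simp add: sums_iff)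
    finally show ?thesis .
  qed
  have "(\<lambda>N. w N *\<^sub>R S N) \<longlonglongrightarrow> 0"
  proof (rule Lim_null_comparison)
    show "\<forall>\<^sub>F N in sequentially. norm (w N *\<^sub>R S N) \<le> \<bar>w N\<bar> * B"
      using B by (intro always_eventually allI) (simp add: S_def mult_left_mono)
    show "(\<lambda>N. \<bar>w N\<bar> * B) \<longlonglongrightarrow> 0"
      using tendsto_mult_left_zero[OF tendsto_rabs_zero[OF w]] by simp
  qed
  moreover have "(\<lambda>N. \<Sum>n<N. T n) \<longlonglongrightarrow> (\<Sum>n. T n)"
    using summable_norm_cancel[OF Ts] by (rule summable_LIMSEQ)
  ultimately have "(\<lambda>N. \<Sum>n<N. w n *\<^sub>R a n) \<longlonglongrightarrow> 0 + (\<Sum>n. T n)"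
    unfolding parts by (rule tendsto_add)
  then have "(\<lambda>n. w n *\<^sub>R a n) sums (\<Sum>n. T n)" by (simp add: sums_def)
  then show "summable (\<lambda>n. w n *\<^sub>R a n)" and "norm (\<Sum>n. w n *\<^sub>R a n) \<le> B * v 0"
    using Tb by (simp_all add: sums_iff)
qed

text \<open>The term at n = 0 vanishes because \<open>0 powr x\<close> is 0.\<close>

definition L_series :: "(nat \<Rightarrow> complex) \<Rightarrow> real \<Rightarrow> complex" where
  "L_series \<psi> s = (\<Sum>n. (real n powr - s) *\<^sub>R \<psi> n)"

locale mod_character =
  fixes p :: nat and \<psi> :: "nat \<Rightarrow> complex"
  assumes prime_p: "prime p"
    and mult: "\<psi> (m * n) = \<psi> m * \<psi> n"
    and periodic: "\<psi> (n + p) = \<psi> n"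
    and eq_0_iff: "\<psi> n = 0 \<longleftrightarrow> p dvd n"
    and norm_le_1: "norm (\<psi> n) \<le> 1"
begin

lemma at_0 [simp]: "\<psi> 0 = 0"
  by (simp add: eq_0_iff)

lemma at_1 [simp]: "\<psi> (Suc 0) = 1"
  using mult[of 1 1] eq_0_iff[of 1] prime_p by (auto simp: prime_nat_iff)

lemma power: "\<psi> (n ^ k) = \<psi> n ^ k"
  by (induction k) (simp_all add: mult)

lemma periodic_mult: "\<psi> (n + p * k) = \<psi> n"
proof (induction k)
  case (Suc k)
  then show ?case using periodic[of "n + p * k"] by (simp add: algebra_simps)
qed simp

end

locale nonprincipal_character = mod_character +
  assumes sum_period: "(\<Sum>n<p. \<psi> n) = 0"
begin

text \<open>Complete periods sum to 0, which leaves fewer than \<open>p\<close> terms of norm at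
  most 1.\<close>

lemma norm_partial_sum_le: "norm (\<Sum>n<N. \<psi> (Suc n)) \<le> real p"
proof -
  have *: "(\<Sum>n<p * k + r. \<psi> n) = (\<Sum>n<r. \<psi> n)" for k r
  proof (induction k)
    case (Suc k)
    have "(\<Sum>n<p + M. \<psi> n) = (\<Sum>n<p. \<psi> n) + (\<Sum>n<M. \<psi> n)" for M
      by (induction M) (simp_all add: periodic add.commute[of p])
    from this[of "p * k + r"] show ?case
      using Suc sum_period by (simp add: algebra_simps)
  qed simp
  have "(\<Sum>n<N. \<psi> (Suc n)) = (\<Sum>n<Suc N. \<psi> n)"
    by (simp add: sum.lessThan_Suc_shift del: sum.lessThan_Suc)
  also have "\<dots> = (\<Sum>n<Suc N mod p. \<psi> n)"
    using *[of "Suc N div p" "Suc N mod p"] by (simp del: sum.lessThan_Suc)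
  also have "norm \<dots> \<le> (\<Sum>n<Suc N mod p. 1)"
    by (rule order_trans[OF norm_sum sum_mono]) (rule norm_le_1)
  also have "\<dots> \<le> real p"
    using prime_gt_0_nat[OF prime_p] by (simp add: less_imp_le)
  finally show ?thesis .
qed

lemma suminf_shift:
  assumes "summable (\<lambda>n. w (Suc n) *\<^sub>R \<psi> (Suc n))"
  shows "summable (\<lambda>n. w n *\<^sub>R \<psi> n)" "(\<Sum>n. w n *\<^sub>R \<psi> n) = (\<Sum>n. w (Suc n) *\<^sub>R \<psi> (Suc n))"
proof -
  show 1: "summable (\<lambda>n. w n *\<^sub>R \<psi> n)" using assms by (subst (asm) summable_Suc_iff)
  show "(\<Sum>n. w n *\<^sub>R \<psi> n) = (\<Sum>n. w (Suc n) *\<^sub>R \<psi> (Suc n))"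
    using suminf_split_head[OF 1] by simp
qed

text \<open>The variation condition starts at n = 1: the majorants in use are 0 at n = 0 by the
  conventions for \<open>powr\<close> and division and need not decrease there, while
  \<open>\<psi> 0 = 0\<close> removes that term.\<close>

lemma weighted_series:
  fixes w v :: "nat \<Rightarrow> real"
  assumes "\<And>n. n > 0 \<Longrightarrow> \<bar>w n - w (Suc n)\<bar> \<le> v n - v (Suc n)" "w \<longlonglongrightarrow> 0" "v \<longlonglongrightarrow> 0"
  shows "summable (\<lambda>n. w n *\<^sub>R \<psi> n)" and "norm (\<Sum>n. w n *\<^sub>R \<psi> n) \<le> p * v 1"
proof -
  note * = bounded_variation_series[where a="\<lambda>n. \<psi> (Suc n)" and B="real p" and w="\<lambda>n. w (Suc n)"
      and v="\<lambda>n. v (Suc n)", OF norm_partial_sum_le assms(1) LIMSEQ_Suc[OF assms(2)] LIMSEQ_Suc[OF assms(3)]]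
  show "summable (\<lambda>n. w n *\<^sub>R \<psi> n)" using suminf_shift(1)[OF *(1)] by simp
  show "norm (\<Sum>n. w n *\<^sub>R \<psi> n) \<le> p * v 1" using suminf_shift(2)[OF *(1)] *(2) by simp
qed

lemma
  assumes "s \<ge> 1"
  shows summable_L: "summable (\<lambda>n. (real n powr - s) *\<^sub>R \<psi> n)"
    and norm_L_le: "norm (L_series \<psi> s) \<le> real p"
proof -
  have 1: "(\<lambda>n. real n powr - s) \<longlonglongrightarrow> 0"
    by (rule tendsto_neg_powr) (use assms filterlim_real_sequentially in auto)
  have 2: "\<bar>real n powr - s - real (Suc n) powr - s\<bar> \<le> real n powr - s - real (Suc n) powr - s"
    if "n > 0" for n
    using powr_mono2'[of "-s" "real n" "real (Suc n)"] that assms by auto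
  note * = weighted_series[where v="\<lambda>n. real n powr - s", OF 2 1 1]
  show "summable (\<lambda>n. (real n powr - s) *\<^sub>R \<psi> n)" by (rule *)
  show "norm (L_series \<psi> s) \<le> real p"
    using *(2) by (simp add: L_series_def)
qed

text \<open>The weights t^(-s) - t^(-1) are not monotone, but their derivative is bounded by (s - 1)
  (1 + ln t) / t^2. The majorant \<open>v t\<close> is the integral of this bound from t to
  infinity, and \<open>v 1 = 2 * (s - 1)\<close> gives the constant.\<close>

lemma L_lipschitz:
  assumes s: "s \<ge> 1"
  shows "norm (L_series \<psi> s - L_series \<psi> 1) \<le> 2 * real p * (s - 1)"
proof -
  define w where "w t = t powr - s - t powr - 1" for t :: real
  define v where "v t = (s - 1) * (2 + ln t) / t" for t :: real
  have der: "\<exists>d. (w has_real_derivative d) (at t) \<and> \<bar>d\<bar> \<le> (s - 1) * (1 + ln t) / t\<^sup>2" if "t \<ge> 1" for t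
  proof (intro exI conjI)
    have "((\<lambda>t. t powr r) has_real_derivative r * t powr (r - 1)) (at t)" for r
      using that by (intro has_real_derivative_powr) simp
    from DERIV_diff[OF this[of "-s"] this[of "-1"]]
    show "(w has_real_derivative (- s * t powr (- s - 1) + t powr (- 2))) (at t)"
      unfolding w_def by simp
    define u where "u = t powr (- (s - 1))"
    have u: "t powr (- s - 1) = u / t\<^sup>2" "t powr (- 2) = 1 / t\<^sup>2"
    proof -
      show 2: "t powr (- 2) = 1 / t\<^sup>2"
        using that by (simp add: powr_minus inverse_eq_divide)
      have "t powr (- s - 1) = t powr (- (s - 1) + (- 2))" by (rule arg_cong[of _ _ "\<lambda>r. t powr r"]) simp
      then show "t powr (- s - 1) = u / t\<^sup>2" unfolding powr_add 2 u_def by simp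
    qed
    have "u \<le> t powr 0" unfolding u_def using that s by (intro powr_mono) auto
    then have u1: "u \<le> 1" "u > 0" using that by (simp_all add: u_def)
    \<comment> \<open>The derivative is (1 - s u) / t^2. Above, 1 - s u <= 1 - u <= (s - 1) ln t;
      below, s u - 1 <= s - 1.\<close>
    have "1 + (- (s - 1) * ln t) \<le> u"
      unfolding u_def powr_def using that by (simp add: exp_ge_add_one_self)
    moreover have "u \<le> s * u" using s u1 by simp
    moreover have "s * u \<le> s * 1" using u1 s by (intro mult_left_mono) auto
    moreover have "0 \<le> (s - 1) * ln t" using s that by simp
    moreover have "(s - 1) * (1 + ln t) = (s - 1) + (s - 1) * ln t" by (simp add: algebra_simps)
    ultimately have "\<bar>1 - s * u\<bar> \<le> (s - 1) * (1 + ln t)"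
      using s unfolding abs_le_iff by linarith
    then show "\<bar>- s * t powr (- s - 1) + t powr (- 2)\<bar> \<le> (s - 1) * (1 + ln t) / t\<^sup>2"
    proof -
      assume *: "\<bar>1 - s * u\<bar> \<le> (s - 1) * (1 + ln t)"
      have "- s * t powr (- s - 1) + t powr (- 2) = (1 - s * u) / t\<^sup>2"
        unfolding u by (simp add: diff_divide_distrib)
      then have "\<bar>- s * t powr (- s - 1) + t powr (- 2)\<bar> = \<bar>1 - s * u\<bar> / t\<^sup>2"
        by simp
      then show ?thesis using * by (simp add: divide_right_mono)
    qed
  qed
  have derv: "(v has_real_derivative - ((s - 1) * (1 + ln t) / t\<^sup>2)) (at t)" if "t \<ge> 1" for t
  proof -
    have "((\<lambda>t. 2 + ln t) has_real_derivative 0 + 1 / t) (at t)"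
      using that by (intro DERIV_add DERIV_const DERIV_ln_divide) simp
    from DERIV_divide[OF DERIV_cmult[OF this, of "s - 1"] DERIV_ident] that
    have "((\<lambda>t. (s - 1) * (2 + ln t) / t) has_real_derivative
       ((s - 1) * (0 + 1 / t) * t - (s - 1) * (2 + ln t) * 1) / (t * t)) (at t)" by simp
    moreover have "((s - 1) * (0 + 1 / t) * t - (s - 1) * (2 + ln t) * 1) / (t * t) = - ((s - 1) * (1 + ln t) / t\<^sup>2)"
      using that by (simp add: power2_eq_square field_simps)
    ultimately show ?thesis unfolding v_def by simp
  qed
  have "\<bar>w (real n) - w (real (Suc n))\<bar> \<le> v (real n) - v (real (Suc n))" if "n > 0" for n
  proof -
    have "w (real n) + v (real n) \<ge> w (real (Suc n)) + v (real (Suc n))"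
    proof (rule DERIV_nonpos_imp_nonincreasing[where f="\<lambda>t. w t + v t"])
      fix t assume "real n \<le> t" "t \<le> real (Suc n)"
      then have t: "t \<ge> 1" using that by linarith
      from der[OF t] obtain d where d: "(w has_real_derivative d) (at t)" "\<bar>d\<bar> \<le> (s - 1) * (1 + ln t) / t\<^sup>2"
        by blast
      show "\<exists>y. ((\<lambda>t. w t + v t) has_real_derivative y) (at t) \<and> y \<le> 0"
        using DERIV_add[OF d(1) derv[OF t]] d(2) by (intro exI conjI) auto
    qed auto
    moreover have "v (real n) - w (real n) \<ge> v (real (Suc n)) - w (real (Suc n))"
    proof (rule DERIV_nonpos_imp_nonincreasing[where f="\<lambda>t. v t - w t"])
      fix t assume "real n \<le> t" "t \<le> real (Suc n)"
      then have t: "t \<ge> 1" using that by linarith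
      from der[OF t] obtain d where d: "(w has_real_derivative d) (at t)" "\<bar>d\<bar> \<le> (s - 1) * (1 + ln t) / t\<^sup>2"
        by blast
      show "\<exists>y. ((\<lambda>t. v t - w t) has_real_derivative y) (at t) \<and> y \<le> 0"
        using DERIV_diff[OF derv[OF t] d(1)] d(2) by (intro exI conjI) auto
    qed auto
    ultimately show ?thesis by linarith
  qed
  moreover have "(\<lambda>n. w (real n)) \<longlonglongrightarrow> 0"
  proof -
    have "(\<lambda>n. real n powr - s) \<longlonglongrightarrow> 0" "(\<lambda>n. real n powr - 1) \<longlonglongrightarrow> 0"
      by (rule tendsto_neg_powr; use assms filterlim_real_sequentially in simp)+
    from tendsto_diff[OF this] show ?thesis by (simp add: w_def)
  qed
  moreover have "(\<lambda>n. v (real n)) \<longlonglongrightarrow> 0"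
    unfolding v_def by real_asymp
  ultimately have "norm (\<Sum>n. w (real n) *\<^sub>R \<psi> n) \<le> p * v (real 1)"
    by (rule weighted_series(2))
  moreover have "(\<Sum>n. w (real n) *\<^sub>R \<psi> n) = L_series \<psi> s - L_series \<psi> 1"
    unfolding w_def scaleR_diff_left L_series_def
    using summable_L[of 1] summable_L[OF s] by (subst suminf_diff) auto
  ultimately show ?thesis by (simp add: v_def mult_ac)
qed

end

section \<open>Characters modulo a prime\<close>

text \<open>The characters are \<open>w ^ (j * ind n)\<close>, with \<open>ind\<close> the discrete
  logarithm to a primitive root \<open>g\<close> and \<open>w\<close> a primitive root of unity of
  order p - 1, so most of the properties become arithmetic of exponents modulo p - 1.\<close>

lemma exists_mod_characters:
  assumes p: "prime p"
  obtains \<psi> :: "nat \<Rightarrow> nat \<Rightarrow> complex"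
  where "\<And>j. mod_character p (\<psi> j)"
    and "\<And>j. 0 < j \<Longrightarrow> j < p - 1 \<Longrightarrow> nonprincipal_character p (\<psi> j)"
    and "\<And>n. \<psi> 0 n = (if p dvd n then 0 else 1)"
    and "\<And>n. (\<Sum>j<p - 1. \<psi> j n) = (if [n = 1] (mod p) then of_nat (p - 1) else 0)"
    and "\<And>j n. j < p - 1 \<Longrightarrow> 0 < j \<Longrightarrow> \<psi> (p - 1 - j) n = cnj (\<psi> j n)"
proof -
  define m where "m = p - 1"
  have m: "m > 0" "p > 1" using prime_gt_1_nat[OF p] by (auto simp: m_def)
  from prime_primitive_root_exists[OF m(2) p] obtain g where g: "residue_primroot p g" by blast
  have ordg: "ord p g = m" and cop: "coprime p g"
    using g p by (auto simp: residue_primroot_def totient_prime m_def)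
  define ind where "ind n = (SOME i. [g ^ i = n] (mod p))" for n
  have ind: "[g ^ ind n = n] (mod p)" if "\<not> p dvd n" for n
  proof -
    have "coprime n p" using p that by (metis prime_imp_coprime coprime_commute)
    then have "n mod p \<in> totatives p"
      using m by (auto simp: in_totatives_iff coprime_commute intro!: Nat.gr0I)
    then have "n mod p \<in> (\<lambda>i. g ^ i mod p) ` {..<totient p}"
      using residue_primroot_is_generator[OF m(2) g] by (simp add: bij_betw_def)
    then obtain i where "n mod p = g ^ i mod p" by blast
    then have "\<exists>i. [g ^ i = n] (mod p)" unfolding Cong.cong_def by (intro exI[of _ i]) simp
    then show ?thesis unfolding ind_def by (rule someI_ex)
  qed
  have ind_eq: "[ind n = i] (mod m)" if "[g ^ i = n] (mod p)" "\<not> p dvd n" for i n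
    using ind[OF that(2)] that(1) order_divides_expdiff[OF cop] unfolding ordg
    by (metis cong_sym cong_trans)
  define w where "w = exp (2 * of_real pi * \<i> / of_nat m)"
  have wpow: "w ^ k = exp (2 * of_real pi * \<i> * of_nat k / of_nat m)" for k
    unfolding w_def by (simp add: exp_of_nat_mult[symmetric] field_simps)
  have w_eq: "w ^ a = w ^ b \<longleftrightarrow> [a = b] (mod m)" for a b
    unfolding wpow Cong.cong_def using complex_root_unity_eq[of m a b] m by simp
  have normw: "norm w = 1" by (simp add: w_def norm_exp_eq_Re)
  have w0: "w \<noteq> 0" using normw by auto
  define \<psi> where "\<psi> j n = (if p dvd n then 0 else w ^ (j * ind n))" for j n
  have char: "mod_character p (\<psi> j)" for j
  proof
    fix a b
    show "\<psi> j (a * b) = \<psi> j a * \<psi> j b"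
    proof (cases "p dvd a * b")
      case True
      then show ?thesis using p by (auto simp: \<psi>_def prime_dvd_mult_iff)
    next
      case False
      then have nd: "\<not> p dvd a" "\<not> p dvd b" using p by (auto simp: prime_dvd_mult_iff)
      have "[g ^ (ind a + ind b) = a * b] (mod p)"
        unfolding power_add by (intro cong_mult ind nd)
      from ind_eq[OF this False] have "[j * ind (a * b) = j * (ind a + ind b)] (mod m)"
        by (rule cong_scalar_left)
      then have "w ^ (j * ind (a * b)) = w ^ (j * (ind a + ind b))" by (simp add: w_eq)
      then show ?thesis using False nd by (simp add: \<psi>_def power_add distrib_left)
    qed
    show "\<psi> j (a + p) = \<psi> j a"
    proof (cases "p dvd a")
      case False
      have "[ind (a + p) = ind a] (mod m)"
        using False ind[OF False] by (intro ind_eq) (auto simp: Cong.cong_def)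
      then have "[j * ind (a + p) = j * ind a] (mod m)" by (rule cong_scalar_left)
      then show ?thesis using False by (simp add: \<psi>_def w_eq)
    qed (simp add: \<psi>_def)
    show "\<psi> j a = 0 \<longleftrightarrow> p dvd a" using w0 by (simp add: \<psi>_def)
    show "norm (\<psi> j a) \<le> 1" using normw by (simp add: \<psi>_def norm_power)
  qed (rule p)
  have nonpr: "nonprincipal_character p (\<psi> j)" if "0 < j" "j < p - 1" for j
  proof -
    interpret mod_character p "\<psi> j" by (rule char)

    have gnd: "\<not> p dvd g" using coprime_common_divisor[OF cop dvd_refl] m by auto
    have "[ind g = 1] (mod m)" using gnd by (intro ind_eq) auto
    then have "[j * ind g = j * 1] (mod m)" by (rule cong_scalar_left)
    then have "\<psi> j g = w ^ j" using gnd by (simp add: \<psi>_def w_eq)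
    moreover have "w ^ j \<noteq> w ^ 0" unfolding w_eq using that by (simp add: Cong.cong_def m_def)
    ultimately have g1: "\<psi> j g \<noteq> 1" by simp
    have modp: "\<psi> j (a mod p) = \<psi> j a" for a
      using periodic_mult[of "a mod p" "a div p"] by simp
    have bij: "bij_betw (\<lambda>n. (g * n) mod p) {..<p} {..<p}"
    proof -
      have "inj_on (\<lambda>n. (g * n) mod p) {..<p}"
      proof (rule inj_onI)
        fix x y assume xy: "x \<in> {..<p}" "y \<in> {..<p}" "(g * x) mod p = (g * y) mod p"
        then have "[g * x = g * y] (mod p)" by (simp add: Cong.cong_def)
        then have "[x = y] (mod p)" using cong_mult_lcancel_nat[of g p x y] cop by (simp add: coprime_commute)
        then show "x = y" using xy by (simp add: Cong.cong_def)
      qed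
      moreover from this have "(\<lambda>n. (g * n) mod p) ` {..<p} = {..<p}"
        by (intro endo_inj_surj) (use m in auto)
      ultimately show ?thesis by (simp add: bij_betw_def)
    qed
    \<comment> \<open>Multiplication by \<open>g\<close> permutes the residues and multiplies the
      sum by \<open>\<psi> j g\<close>, which is not 1.\<close>
    have "(\<Sum>n<p. \<psi> j n) = (\<Sum>n<p. \<psi> j ((g * n) mod p))"
      using sum.reindex_bij_betw[OF bij, of "\<psi> j"] by simp
    also have "\<dots> = \<psi> j g * (\<Sum>n<p. \<psi> j n)"
      by (simp add: modp mult sum_distrib_left)
    finally have "(\<Sum>n<p. \<psi> j n) = 0" using g1 by (metis mult_cancel_right1)
    then show ?thesis by unfold_locales
  qed
  have orth: "(\<Sum>j<p - 1. \<psi> j n) = (if [n = 1] (mod p) then of_nat (p - 1) else 0)" for n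
  proof (cases "p dvd n")
    case True
    then have "\<not> [n = 1] (mod p)" using m
      using cong_dvd_iff by force
    then show ?thesis using True by (simp add: \<psi>_def)
  next
    case nd: False
    have *: "\<psi> j n = (w ^ ind n) ^ j" for j using nd by (simp add: \<psi>_def power_mult[symmetric] mult.commute)
    have "w ^ ind n = w ^ 0 \<longleftrightarrow> [n = 1] (mod p)"
    proof
      assume "w ^ ind n = w ^ 0"
      then have "[ind n = 0] (mod m)" by (simp only: w_eq)
      then have "[g ^ ind n = g ^ 0] (mod p)" using order_divides_expdiff[OF cop] ordg by blast
      then show "[n = 1] (mod p)" using ind[OF nd] by (metis cong_sym cong_trans power_0)
    next
      assume "[n = 1] (mod p)"
      then have "[g ^ 0 = n] (mod p)" by (simp add: cong_sym_eq)
      from ind_eq[OF this nd] show "w ^ ind n = w ^ 0" by (simp only: w_eq)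
    qed
    moreover have "(w ^ ind n) ^ m = 1"
      using w_eq[of "ind n * m" 0] by (simp add: power_mult[symmetric] Cong.cong_def)
    ultimately show ?thesis unfolding * m_def[symmetric]
      by (cases "w ^ ind n = 1") (simp_all add: sum_gp_strict)
  qed
  have conj: "\<psi> (p - 1 - j) n = cnj (\<psi> j n)" if "j < p - 1" for j n
  proof (cases "p dvd n")
    case False
    have "[(m - j) * ind n + j * ind n = 0] (mod m)"
      using that by (simp add: m_def Cong.cong_def distrib_right[symmetric])
    then have "w ^ ((m - j) * ind n) * w ^ (j * ind n) = 1"
      using w_eq[of "(m - j) * ind n + j * ind n" 0] by (simp add: power_add)
    moreover have "cnj (w ^ (j * ind n)) * w ^ (j * ind n) = 1"
      using complex_norm_square[of "w ^ (j * ind n)"] normw by (simp add: norm_power mult.commute)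
    ultimately have "w ^ ((m - j) * ind n) = cnj (w ^ (j * ind n))"
      using w0 by (metis mult_cancel_right power_not_zero)
    then show ?thesis using False by (simp add: \<psi>_def m_def)
  qed (simp add: \<psi>_def)
  show thesis
    by (rule that[of \<psi>]) (use char nonpr orth conj in \<open>auto simp: \<psi>_def\<close>)
qed

section \<open>Euler products\<close>

text \<open>By complete multiplicativity the multiples of \<open>q\<close> among the survivors
  contribute \<open>f q\<close> times the sum over all survivors, so removing them multiplies the
  sum by \<open>1 - f q\<close>.\<close>

lemma euler_sieve:
  fixes f :: "nat \<Rightarrow> 'a::{real_normed_field,banach}"
  assumes mult: "\<And>m n. f (m * n) = f m * f n"
    and summ: "summable (\<lambda>n. norm (f n))" and "finite Q" and "\<And>q. q \<in> Q \<Longrightarrow> prime q"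
  shows "infsum f {n. \<forall>q\<in>Q. \<not> q dvd n} = (\<Prod>q\<in>Q. 1 - f q) * suminf f"
  using assms(3,4)
proof (induction Q rule: finite_induct)
  case empty
  have "(f has_sum suminf f) UNIV"
    by (rule norm_summable_imp_has_sum[OF summ summable_sums[OF summable_norm_cancel[OF summ]]])
  then show ?case by (simp add: infsumI)
next
  case (insert q Q)
  define S where "S = {n. \<forall>q\<in>Q. \<not> q dvd n}"
  have q: "prime q" and Q: "\<And>r. r \<in> Q \<Longrightarrow> prime r" using insert.prems by auto
  have sum: "f summable_on A" for A
    using norm_summable_imp_summable_on[OF summ] summable_on_subset_banach by blast
  have split: "S = {n. \<forall>r\<in>insert q Q. \<not> r dvd n} \<union> (\<lambda>n. q * n) ` S"
  proof (intro equalityI subsetI)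
    fix n assume n: "n \<in> S"
    show "n \<in> {n. \<forall>r\<in>insert q Q. \<not> r dvd n} \<union> (\<lambda>n. q * n) ` S"
    proof (cases "q dvd n")
      case True
      then obtain m where m: "n = q * m" by auto
      with n have "m \<in> S" by (auto simp: S_def)
      with m show ?thesis by blast
    qed (use n in \<open>auto simp: S_def\<close>)
  next
    fix n assume n: "n \<in> {n. \<forall>r\<in>insert q Q. \<not> r dvd n} \<union> (\<lambda>n. q * n) ` S"
    have "\<not> r dvd q * m" if "r \<in> Q" "m \<in> S" for r m
    proof
      assume "r dvd q * m"
      then have "r dvd q \<or> r dvd m" using Q[OF that(1)] by (simp add: prime_dvd_mult_iff)
      moreover have "r \<noteq> q" using that insert.hyps by auto
      ultimately show False
        using Q[OF that(1)] q that primes_dvd_imp_eq by (auto simp: S_def)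
    qed
    with n show "n \<in> S" by (auto simp: S_def)
  qed
  have "infsum f S = infsum f {n. \<forall>r\<in>insert q Q. \<not> r dvd n} + infsum f ((\<lambda>n. q * n) ` S)"
    by (subst split, rule infsum_Un_disjoint[OF sum sum]) auto
  also have "infsum f ((\<lambda>n. q * n) ` S) = infsum (\<lambda>n. f q * f n) S"
    using prime_gt_0_nat[OF q] by (subst infsum_reindex) (auto simp: inj_on_def o_def mult)
  also have "\<dots> = f q * infsum f S" by (rule infsum_cmult_right')
  finally have "infsum f {n. \<forall>r\<in>insert q Q. \<not> r dvd n} = infsum f S - f q * infsum f S"
    by (metis add_diff_cancel_right')
  also have "\<dots> = (1 - f q) * infsum f S" by (simp only: left_diff_distrib mult_1_left)
  also have "infsum f S = (\<Prod>q\<in>Q. 1 - f q) * suminf f" unfolding S_def by (rule insert.IH[OF Q])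
  finally show ?case by (simp only: prod.insert[OF insert.hyps] mult.assoc)
qed

definition primes_upto :: "nat \<Rightarrow> nat set" where
  "primes_upto N = {q. prime q \<and> q \<le> N}"

lemma finite_primes_upto [simp]: "finite (primes_upto N)"
  unfolding primes_upto_def by (rule finite_subset[of _ "{..N}"]) auto

text \<open>After sieving by the primes up to N there remain 1 and numbers above N, which contribute
  at most a tail of the series. Stating the limit for product times sum avoids dividing by a sum
  that might vanish; \<open>ln_euler_product\<close> reads its non-vanishing off the limit
  1.\<close>

lemma euler_product:
  fixes f :: "nat \<Rightarrow> 'a::{real_normed_field,banach}"
  assumes mult: "\<And>m n. f (m * n) = f m * f n" and f0: "f 0 = 0" and f1: "f (Suc 0) = 1"
    and summ: "summable (\<lambda>n. norm (f n))"
  shows "(\<lambda>N. (\<Prod>q\<in>primes_upto N. 1 - f q) * suminf f) \<longlonglongrightarrow> 1"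
proof -
  have abs: "f abs_summable_on UNIV"
    using summ by (subst summable_on_UNIV_nonneg_real_iff) auto
  have bd: "norm ((\<Prod>q\<in>primes_upto N. 1 - f q) * suminf f - 1) \<le> (\<Sum>n. norm (f (n + Suc N)))" for N
  proof -
    define A where "A = {n. \<forall>q\<in>primes_upto N. \<not> q dvd n}"
    have abA: "f abs_summable_on B" for B using abs summable_on_subset_banach by blast
    have sA: "f summable_on B" for B using abs_summable_summable[OF abA] .
    have "(\<Prod>q\<in>primes_upto N. 1 - f q) * suminf f = infsum f A"
      unfolding A_def by (rule euler_sieve[of f, OF mult summ, symmetric]) (auto simp: primes_upto_def)
    also have "infsum f A = infsum f {1} + infsum f (A - {1})"
    proof -
      have "A = {1} \<union> (A - {1})" by (auto simp: A_def primes_upto_def)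
      then show ?thesis using infsum_Un_disjoint[OF sA sA, of "{1}" "A - {1}"] by auto
    qed
    finally have "norm ((\<Prod>q\<in>primes_upto N. 1 - f q) * suminf f - 1) = norm (infsum f (A - {1}))"
      by (simp add: f1)
    also have "\<dots> \<le> infsum (\<lambda>n. norm (f n)) (A - {1})" by (rule norm_infsum_bound[OF abA])
    also have "\<dots> \<le> infsum (\<lambda>n. norm (f n)) ((\<lambda>n. n + Suc N) ` UNIV)"
    proof (rule infsum_mono_neutral[OF abA abA])
      fix n assume n: "n \<in> (A - {1}) - (\<lambda>n. n + Suc N) ` UNIV"
      have "n \<le> N"
      proof (rule ccontr)
        assume "\<not> n \<le> N"
        then have "n = (n - Suc N) + Suc N" by simp
        then show False using n by blast
      qed
      \<comment> \<open>The value 0 survives only if there is no prime up to N;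
        \<open>f 0 = 0\<close> makes it harmless.\<close>
      moreover have "n = 0 \<or> n > N"
      proof (rule ccontr)
        assume c: "\<not> (n = 0 \<or> n > N)"
        then obtain q where "prime q" "q dvd n" using n prime_factor_nat[of n] by auto
        moreover from this have "q \<le> N" using c dvd_imp_le[of q n] by auto
        ultimately show False using n by (auto simp: A_def primes_upto_def)
      qed
      ultimately show "norm (f n) \<le> 0" using f0 by auto
    next
      fix n show "norm (f n) \<ge> 0" by simp
    qed (rule order_refl)
    also have "\<dots> = infsum (\<lambda>n. norm (f (n + Suc N))) UNIV"
      by (subst infsum_reindex) (auto simp: o_def inj_def)
    also have "\<dots> = (\<Sum>n. norm (f (n + Suc N)))"
    proof (rule infsumI, rule norm_summable_imp_has_sum)
      have "summable (\<lambda>n. norm (f (n + Suc N)))" using summ by (rule summable_ignore_initial_segment)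
      then show "summable (\<lambda>n. norm (norm (f (n + Suc N))))"
         "(\<lambda>n. norm (f (n + Suc N))) sums (\<Sum>n. norm (f (n + Suc N)))" by (simp_all add: summable_sums)
    qed
    finally show ?thesis .
  qed
  have "(\<lambda>N. \<Sum>n. norm (f (n + Suc N))) \<longlonglongrightarrow> 0"
    using LIMSEQ_Suc[OF suminf_exist_split2[OF summ]] by simp
  with bd have "(\<lambda>N. (\<Prod>q\<in>primes_upto N. 1 - f q) * suminf f - 1) \<longlonglongrightarrow> 0"
    by (rule Lim_null_comparison[OF always_eventually[OF allI]])
  then show ?thesis by (rule LIM_zero_cancel)
qed

lemma ln_euler_product:
  fixes f :: "nat \<Rightarrow> 'a::{real_normed_field,banach}"
  assumes mult: "\<And>m n. f (m * n) = f m * f n" and f0: "f 0 = 0" and f1: "f (Suc 0) = 1"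
    and summ: "summable (\<lambda>n. norm (f n))" and lt1: "\<And>q. prime q \<Longrightarrow> norm (f q) < 1"
  shows "suminf f \<noteq> 0" and "(\<lambda>N. \<Sum>q\<in>primes_upto N. - ln (norm (1 - f q))) \<longlonglongrightarrow> ln (norm (suminf f))"
proof -
  have lim: "(\<lambda>N. (\<Prod>q\<in>primes_upto N. 1 - f q) * suminf f) \<longlonglongrightarrow> 1"
    by (rule euler_product[of f]) (fact assms)+
  show nz: "suminf f \<noteq> 0"
  proof
    assume z: "suminf f = 0"
    from lim have "(\<lambda>N. 0 :: 'a) \<longlonglongrightarrow> 1" unfolding z mult_zero_right .
    then show False by (simp add: LIMSEQ_const_iff)
  qed
  have pos: "norm (1 - f q) > 0" if "prime q" for q
    using lt1[OF that] by auto
  have "(\<lambda>N. ln (norm ((\<Prod>q\<in>primes_upto N. 1 - f q) * suminf f))) \<longlonglongrightarrow> ln (norm (1::'a))"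
    by (intro tendsto_ln tendsto_norm lim) auto
  also have "(\<lambda>N. ln (norm ((\<Prod>q\<in>primes_upto N. 1 - f q) * suminf f)))
      = (\<lambda>N. ln (norm (suminf f)) - (\<Sum>q\<in>primes_upto N. - ln (norm (1 - f q))))"
  proof
    fix N
    have "norm (\<Prod>q\<in>primes_upto N. 1 - f q) > 0"
      unfolding prod_norm[symmetric] using pos
      by (intro prod_pos) (auto simp: primes_upto_def)
    then have "ln (norm ((\<Prod>q\<in>primes_upto N. 1 - f q) * suminf f))
        = ln (\<Prod>q\<in>primes_upto N. norm (1 - f q)) + ln (norm (suminf f))"
      using nz by (simp add: norm_mult ln_mult prod_norm)
    also have "ln (\<Prod>q\<in>primes_upto N. norm (1 - f q)) = (\<Sum>q\<in>primes_upto N. ln (norm (1 - f q)))"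
      using pos by (intro ln_prod) (auto simp: primes_upto_def)
    finally show "ln (norm ((\<Prod>q\<in>primes_upto N. 1 - f q) * suminf f))
      = ln (norm (suminf f)) - (\<Sum>q\<in>primes_upto N. - ln (norm (1 - f q)))"
      by (simp add: sum_negf)
  qed
  finally have l: "(\<lambda>N. ln (norm (suminf f)) - (\<Sum>q\<in>primes_upto N. - ln (norm (1 - f q)))) \<longlonglongrightarrow> 0"
    by simp
  have "(\<lambda>N. ln (norm (suminf f)) - (ln (norm (suminf f)) - (\<Sum>q\<in>primes_upto N. - ln (norm (1 - f q)))))
     \<longlonglongrightarrow> ln (norm (suminf f)) - 0" by (intro tendsto_diff tendsto_const l)
  then show "(\<lambda>N. \<Sum>q\<in>primes_upto N. - ln (norm (1 - f q))) \<longlonglongrightarrow> ln (norm (suminf f))" by simp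
qed

section \<open>The zeta series near 1\<close>

lemma powr_telescope_bounds:
  assumes s: "s > 1" and n: "n > 0"
  shows "(s - 1) * real (Suc n) powr - s \<le> real n powr (1 - s) - real (Suc n) powr (1 - s)"
    and "real n powr (1 - s) - real (Suc n) powr (1 - s) \<le> (s - 1) * real n powr - s"
proof -
  have "\<exists>z>real n. z < real (Suc n) \<and>
    real (Suc n) powr (1 - s) - real n powr (1 - s) = (real (Suc n) - real n) * ((1 - s) * z powr (1 - s - 1))"
  proof (rule MVT2)
    fix t assume "real n \<le> t" "t \<le> real (Suc n)"
    then show "((\<lambda>t. t powr (1 - s)) has_real_derivative (1 - s) * t powr (1 - s - 1)) (at t)"
      using n by (intro has_real_derivative_powr) simp
  qed simp
  then obtain z where z: "z > real n" "z < real (Suc n)"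
    and eq: "real n powr (1 - s) - real (Suc n) powr (1 - s) = (s - 1) * z powr - s"
    by (auto simp: algebra_simps)
  show "(s - 1) * real (Suc n) powr - s \<le> real n powr (1 - s) - real (Suc n) powr (1 - s)"
    unfolding eq using s z n by (intro mult_left_mono powr_mono2') auto
  show "real n powr (1 - s) - real (Suc n) powr (1 - s) \<le> (s - 1) * real n powr - s"
    unfolding eq using s z n by (intro mult_left_mono powr_mono2') auto
qed

lemma summable_powr: "s > 1 \<Longrightarrow> summable (\<lambda>n. real n powr - s)"
  by (simp add: summable_real_powr_iff)

lemma suminf_powr_tail_le:
  assumes s: "s > 1" and N: "N > 0"
  shows "(\<Sum>n. real (n + Suc N) powr - s) \<le> real N powr (1 - s) / (s - 1)"
proof -
  have lim: "(\<lambda>n. real (n + N) powr (1 - s)) \<longlonglongrightarrow> 0"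
    by (rule LIMSEQ_ignore_initial_segment[where f="\<lambda>n. real n powr (1 - s)"], rule tendsto_neg_powr)
       (use s filterlim_real_sequentially in auto)
  have sums: "(\<lambda>n. (real (n + N) powr (1 - s) - real (Suc n + N) powr (1 - s)) / (s - 1))
     sums (real N powr (1 - s) / (s - 1))"
    using sums_divide[OF telescope_sums'[OF lim], of "s - 1"] by simp
  have "(\<Sum>n. real (n + Suc N) powr - s) \<le>
    (\<Sum>n. (real (n + N) powr (1 - s) - real (Suc n + N) powr (1 - s)) / (s - 1))"
  proof (rule suminf_le)
    fix n show "real (n + Suc N) powr - s \<le> (real (n + N) powr (1 - s) - real (Suc n + N) powr (1 - s)) / (s - 1)"
      using powr_telescope_bounds(1)[OF s, of "n + N"] N s by (simp add: le_divide_eq mult.commute)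
    show "summable (\<lambda>n. real (n + Suc N) powr - s)"
      using summable_ignore_initial_segment[OF summable_powr[OF s], of "Suc N"] by simp
  qed (rule sums_summable[OF sums])
  then show ?thesis unfolding sums_unique[OF sums, symmetric] .
qed

lemma zeta_bounds:
  assumes s: "s > 1"
  shows "1 / (s - 1) \<le> (\<Sum>n. real n powr - s)" and "(\<Sum>n. real n powr - s) \<le> 1 + 1 / (s - 1)"
proof -
  have 1: "(\<Sum>n. real n powr - s) = 1 + (\<Sum>n. real (n + Suc 1) powr - s)"
    using suminf_split_initial_segment[OF summable_powr[OF s], of "Suc 1"] by simp
  then show "(\<Sum>n. real n powr - s) \<le> 1 + 1 / (s - 1)"
    using suminf_powr_tail_le[OF s, of 1] by simp
  have lim: "(\<lambda>n. real (Suc n) powr (1 - s)) \<longlonglongrightarrow> 0"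
    by (rule LIMSEQ_Suc, rule tendsto_neg_powr) (use s filterlim_real_sequentially in auto)
  have sums: "(\<lambda>n. (real (Suc n) powr (1 - s) - real (Suc (Suc n)) powr (1 - s)) / (s - 1)) sums (1 / (s - 1))"
    using sums_divide[OF telescope_sums'[OF lim], of "s - 1"] by simp
  have "1 / (s - 1) = (\<Sum>n. (real (Suc n) powr (1 - s) - real (Suc (Suc n)) powr (1 - s)) / (s - 1))"
    by (rule sums_unique[OF sums])
  also have "\<dots> \<le> (\<Sum>n. real (Suc n) powr - s)"
  proof (rule suminf_le)
    fix n show "(real (Suc n) powr (1 - s) - real (Suc (Suc n)) powr (1 - s)) / (s - 1) \<le> real (Suc n) powr - s"
      using powr_telescope_bounds(2)[OF s, of "Suc n"] s by (simp add: divide_le_eq mult.commute)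
    show "summable (\<lambda>n. real (Suc n) powr - s)"
      using summable_powr[OF s] by (subst summable_Suc_iff)
  qed (rule sums_summable[OF sums])
  also have "\<dots> = (\<Sum>n. real n powr - s)"
    using suminf_split_head[OF summable_powr[OF s]] by simp
  finally show "1 / (s - 1) \<le> (\<Sum>n. real n powr - s)" .
qed

section \<open>Lower bound for L(1) of a real character\<close>

definition divisor_sum :: "(nat \<Rightarrow> real) \<Rightarrow> nat \<Rightarrow> real" where
  "divisor_sum c n = (\<Sum>d | d dvd n. c d)"

lemma divisor_sum_prime_power_mult:
  assumes mult: "\<And>m n. c (m * n) = c m * c n" and c1: "c (Suc 0) = 1"
    and q: "prime q" and m: "\<not> q dvd m"
  shows "divisor_sum c (q ^ k * m) = (\<Sum>i\<le>k. c q ^ i) * divisor_sum c m"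
proof -
  have q0: "q > 0" "q \<noteq> 1" using q prime_gt_0_nat by (auto simp: prime_nat_iff)
  have cpow: "c (q ^ i) = c q ^ i" for i by (induction i) (simp_all add: mult c1)
  have bij: "bij_betw (\<lambda>(i, d). q ^ i * d) ({..k} \<times> {d. d dvd m}) {d. d dvd q ^ k * m}"
    unfolding bij_betw_def
  proof
    show "inj_on (\<lambda>(i, d). q ^ i * d) ({..k} \<times> {d. d dvd m})"
    proof (rule inj_onI, clarsimp)
      fix i d i' d' assume d: "d dvd m" "d' dvd m" and eq: "q ^ i * d = q ^ i' * d'"
      have "\<not> q dvd d" "\<not> q dvd d'" using d m dvd_trans by blast+
      then have "multiplicity q (q ^ i * d) = i" "multiplicity q (q ^ i' * d') = i'"
        using q0 by (auto intro: multiplicity_decomposeI)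
      then have "i = i'" using eq by simp
      then show "i = i' \<and> d = d'" using eq q0 by simp
    qed
    show "(\<lambda>(i, d). q ^ i * d) ` ({..k} \<times> {d. d dvd m}) = {d. d dvd q ^ k * m}"
    proof (intro equalityI subsetI)
      fix d assume "d \<in> {d. d dvd q ^ k * m}"
      then obtain a b where ab: "d = a * b" "a dvd q ^ k" "b dvd m"
        using division_decomp[of d "q ^ k" m] by auto
      from ab(2) obtain i where "i \<le> k" "a = q ^ i" using divides_primepow_nat[OF q] by blast
      then show "d \<in> (\<lambda>(i, d). q ^ i * d) ` ({..k} \<times> {d. d dvd m})" using ab by force
    next
      fix d assume "d \<in> (\<lambda>(i, d). q ^ i * d) ` ({..k} \<times> {d. d dvd m})"
      then show "d \<in> {d. d dvd q ^ k * m}" by (auto intro!: mult_dvd_mono le_imp_power_dvd)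
    qed
  qed
  have "divisor_sum c (q ^ k * m) = (\<Sum>x\<in>{..k} \<times> {d. d dvd m}. c ((\<lambda>(i, d). q ^ i * d) x))"
    unfolding divisor_sum_def by (rule sum.reindex_bij_betw[OF bij, symmetric])
  also have "\<dots> = (\<Sum>(i, d)\<in>{..k} \<times> {d. d dvd m}. c q ^ i * c d)"
    by (intro sum.cong refl) (auto simp: mult cpow)
  also have "\<dots> = (\<Sum>i\<le>k. c q ^ i) * divisor_sum c m"
    unfolding divisor_sum_def sum_product by (rule sum.cartesian_product[symmetric])
  finally show ?thesis .
qed

lemma
  fixes c :: real
  assumes "c \<in> {-1, 0, 1}"
  shows geometric_sum_sign_nonneg: "(\<Sum>i\<le>k. c ^ i) \<ge> 0"
    and geometric_sum_sign_even: "(\<Sum>i\<le>2 * j. c ^ i) \<ge> 1"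
proof -
  have m1: "(\<Sum>i\<le>k. (-1::real) ^ i) = (if even k then 1 else 0)" for k
    by (induction k) auto
  have z: "(\<Sum>i\<le>k. (0::real) ^ i) = 1" for k
    by (induction k) auto
  show "(\<Sum>i\<le>k. c ^ i) \<ge> 0" using assms m1[of k] z[of k] by auto
  show "(\<Sum>i\<le>2 * j. c ^ i) \<ge> 1" using assms m1[of "2 * j"] z[of "2 * j"] by auto
qed

text \<open>The divisor sum is multiplicative, and its factor at q^k is the geometric sum of
  \<open>c q\<close> with exponents 0 to k. For \<open>c q\<close> in {-1, 0, 1} this is
  nonnegative, and at least 1 when k is even. The induction splits off one prime power at a
  time.\<close>

lemma
  assumes mult: "\<And>m n. c (m * n) = c m * c n" and c1: "c (Suc 0) = 1"
    and c: "\<And>n. c n \<in> {-1, 0, 1}"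
  shows divisor_sum_nonneg: "n > 0 \<Longrightarrow> divisor_sum c n \<ge> 0"
    and divisor_sum_square: "n > 0 \<Longrightarrow> divisor_sum c (n\<^sup>2) \<ge> 1"
proof -
  have decomp: "\<exists>q k m. prime q \<and> \<not> q dvd m \<and> n = q ^ k * m \<and> 0 < m \<and> m < n" if n1: "n > 1" for n :: nat
  proof -
    have "n \<noteq> 1" using n1 by simp
    then obtain q where q: "prime q" "q dvd n" using prime_factor_nat by blast
    obtain m where m: "n = q ^ multiplicity q n * m" "\<not> q dvd m"
      by (rule multiplicity_decompose'[of n q]) (use n1 q not_prime_unit in auto)
    have "multiplicity q n > 0" using q n1 by (simp add: prime_multiplicity_gt_zero_iff)
    then have "q ^ multiplicity q n > 1" using prime_gt_1_nat[OF q(1)] by (intro one_less_power) auto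
    moreover have "m > 0" using m(1) n1 by (cases m) auto
    ultimately have "m < n" by (subst m(1)) simp
    with q m \<open>m > 0\<close> show ?thesis by blast
  qed
  have one: "divisor_sum c (Suc 0) = 1" by (simp add: divisor_sum_def c1)
  show "n > 0 \<Longrightarrow> divisor_sum c n \<ge> 0"
  proof (induction n rule: less_induct)
    case (less n)
    show ?case
    proof (cases "n > 1")
      case True
      from decomp[OF this] obtain q k m where d: "prime q" "\<not> q dvd m" "n = q ^ k * m" "0 < m" "m < n" by blast
      show ?thesis unfolding d(3) divisor_sum_prime_power_mult[of c, OF mult c1 d(1,2)]
        by (intro mult_nonneg_nonneg geometric_sum_sign_nonneg c less.IH d)
    qed (use less.prems one in \<open>cases "n = Suc 0"; simp\<close>)
  qed
  show "n > 0 \<Longrightarrow> divisor_sum c (n\<^sup>2) \<ge> 1"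
  proof (induction n rule: less_induct)
    case (less n)
    show ?case
    proof (cases "n > 1")
      case True
      from decomp[OF this] obtain q k m where d: "prime q" "\<not> q dvd m" "n = q ^ k * m" "0 < m" "m < n" by blast
      have "n\<^sup>2 = q ^ (2 * k) * m\<^sup>2" by (simp add: d(3) power_mult_distrib power_mult[symmetric] mult.commute)
      moreover have "\<not> q dvd m\<^sup>2" using d prime_dvd_power by blast
      ultimately have "divisor_sum c (n\<^sup>2) = (\<Sum>i\<le>2 * k. c q ^ i) * divisor_sum c (m\<^sup>2)"
        using divisor_sum_prime_power_mult[of c, OF mult c1 d(1)] by simp
      moreover have "1 * 1 \<le> (\<Sum>i\<le>2 * k. c q ^ i) * divisor_sum c (m\<^sup>2)"
        using less.IH[OF d(5,4)] geometric_sum_sign_even[OF c, of q k] by (intro mult_mono) auto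
      ultimately show ?thesis by simp
    qed (use less.prems one in \<open>cases "n = Suc 0"; simp\<close>)
  qed
qed

text \<open>Writing N = n k and collecting by the divisor n gives the Lambert series identity, here
  truncated so that no convergence is involved.\<close>

lemma sum_divisor_sum_power:
  "(\<Sum>N=1..K. divisor_sum c N * z ^ N) = (\<Sum>n=1..K. c n * (\<Sum>k=1..K div n. (z ^ n) ^ k))"
proof -
  have "(\<Sum>N=1..K. divisor_sum c N * z ^ N) = (\<Sum>N=1..K. \<Sum>d | d dvd N. c d * z ^ N)"
    by (simp add: divisor_sum_def sum_distrib_right)
  also have "\<dots> = (\<Sum>(N, d)\<in>Sigma {1..K} (\<lambda>N. {d. d dvd N}). c d * z ^ N)"
    by (rule sum.Sigma) auto
  also have "\<dots> = (\<Sum>(n, k)\<in>Sigma {1..K} (\<lambda>n. {1..K div n}). c n * (z ^ n) ^ k)"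
  proof (rule sum.reindex_bij_witness[where j="\<lambda>(N, d). (d, N div d)" and i="\<lambda>(n, k). (n * k, n)"])
    fix x assume "x \<in> Sigma {1..K} (\<lambda>N. {d. d dvd N})"
    then obtain d k where x: "x = (d * k, d)" "1 \<le> d * k" "d * k \<le> K" by (auto elim!: dvdE)
    then have d: "d > 0" "k > 0" by (auto intro!: Nat.gr0I)
    then have "k \<le> K div d" using x(3) by (simp add: less_eq_div_iff_mult_less_eq mult.commute)
    moreover have "d \<le> K" using x(3) d by (metis dvd_imp_le dvd_triv_left le_trans mult_pos_pos)
    ultimately show "(case x of (N, d) \<Rightarrow> (d, N div d)) \<in> Sigma {1..K} (\<lambda>n. {1..K div n})"
      "(case case x of (N, d) \<Rightarrow> (d, N div d) of (n, k) \<Rightarrow> (n * k, n)) = x"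
      "(case case x of (N, d) \<Rightarrow> (d, N div d) of (n, k) \<Rightarrow> c n * (z ^ n) ^ k) = (case x of (N, d) \<Rightarrow> c d * z ^ N)"
      using x d by (auto simp: power_mult)
  next
    fix x assume "x \<in> Sigma {1..K} (\<lambda>n. {1..K div n})"
    then obtain n k where x: "x = (n, k)" "1 \<le> n" "1 \<le> k" "k \<le> K div n" by auto
    then have "n * k \<le> K" by (simp add: less_eq_div_iff_mult_less_eq mult.commute)
    then show "(case case x of (n, k) \<Rightarrow> (n * k, n) of (N, d) \<Rightarrow> (d, N div d)) = x"
      "(case x of (n, k) \<Rightarrow> (n * k, n)) \<in> Sigma {1..K} (\<lambda>N. {d. d dvd N})"
      using x by auto
  qed
  also have "\<dots> = (\<Sum>n=1..K. \<Sum>k=1..K div n. c n * (z ^ n) ^ k)"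
    by (rule sum.Sigma[symmetric]) auto
  finally show ?thesis by (simp add: sum_distrib_left)
qed

text \<open>Pairing the exponents i and n - 1 - i, the inequality of arithmetic and geometric means
  bounds each pair below by 2 y^(n-1).\<close>

lemma geometric_sum_ge_power:
  fixes y :: real
  assumes "0 \<le> y"
  shows "real n * y ^ (n - 1) \<le> (\<Sum>i<n. (y\<^sup>2) ^ i)"
proof -
  have "2 * (\<Sum>i<n. (y\<^sup>2) ^ i) = (\<Sum>i<n. (y\<^sup>2) ^ i) + (\<Sum>i<n. (y\<^sup>2) ^ (n - Suc i))"
    by (subst (2) sum.nat_diff_reindex[symmetric]) simp
  also have "\<dots> = (\<Sum>i<n. (y\<^sup>2) ^ i + (y\<^sup>2) ^ (n - Suc i))" by (simp add: sum.distrib)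
  also have "\<dots> \<ge> (\<Sum>i<n. 2 * y ^ (n - 1))"
  proof (rule sum_mono)
    fix i assume "i \<in> {..<n}"
    then have "y ^ (n - 1) = y ^ i * y ^ (n - Suc i)" by (simp add: power_add[symmetric])
    moreover have "0 \<le> (y ^ i - y ^ (n - Suc i))\<^sup>2" by simp
    ultimately show "2 * y ^ (n - 1) \<le> (y\<^sup>2) ^ i + (y\<^sup>2) ^ (n - Suc i)"
      by (simp add: power2_diff power_mult[symmetric] mult_ac)
  qed
  finally show ?thesis by simp
qed

text \<open>With g n = (1 - z^n) / (1 - z), the drop of z^n / g n from n to n + 1 is z^n / (g n g
  (n+1)). By \<open>geometric_sum_ge_power\<close> with \<open>y = sqrt z\<close>, g n >= n y^n and
  g (n+1) >= (n+1) y^n, so the drop is at most 1/n - 1/(n+1).\<close>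

lemma lambert_weight_antimono:
  fixes z :: real
  assumes z: "0 < z" "z < 1" and n: "n > 0"
  defines "b \<equiv> \<lambda>n. 1 / (real n * (1 - z)) - z ^ n / (1 - z ^ n)"
  shows "b (Suc n) \<le> b n"
proof -
  define y where "y = sqrt z"
  have y: "0 \<le> y" "y \<le> 1" "z = y\<^sup>2" using z by (auto simp: y_def)
  define g where "g n = (\<Sum>i<n. z ^ i)" for n :: nat
  have gz: "1 - z ^ n = (1 - z) * g n" for n
    unfolding g_def by (simp add: one_diff_power_eq)
  have gS: "g (Suc n) = 1 + z * g n" for n
    unfolding g_def by (simp add: sum.lessThan_Suc_shift sum_distrib_left del: sum.lessThan_Suc)
  have gpos: "g n > 0" if "n > 0" for n
    using gz[of n] z that by (metis diff_gt_0_iff_gt power_Suc_less_one gr0_conv_Suc zero_less_mult_pos)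
  have ge1: "real n * y ^ n \<le> g n"
  proof -
    have "y ^ n \<le> y ^ (n - 1)" using y by (intro power_decreasing) auto
    then have "real n * y ^ n \<le> real n * y ^ (n - 1)" by (intro mult_left_mono) auto
    also have "\<dots> \<le> g n" unfolding g_def y(3) by (rule geometric_sum_ge_power[OF y(1)])
    finally show ?thesis .
  qed
  have ge2: "real (Suc n) * y ^ n \<le> g (Suc n)"
    using geometric_sum_ge_power[OF y(1), of "Suc n"] unfolding g_def y(3) by simp
  have prod: "real n * real (Suc n) * z ^ n \<le> g n * g (Suc n)"
  proof -
    have "real n * real (Suc n) * z ^ n = (real n * y ^ n) * (real (Suc n) * y ^ n)"
      unfolding y(3) by (simp add: power2_eq_square power_mult_distrib)
    also have "\<dots> \<le> g n * g (Suc n)"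
      using ge1 ge2 y gpos[OF n] by (intro mult_mono) auto
    finally show ?thesis .
  qed
  have "z ^ n / g n - z ^ Suc n / g (Suc n) = z ^ n / (g n * g (Suc n))"
  proof -
    have "z ^ n / g n - z ^ Suc n / g (Suc n) = (z ^ n * g (Suc n) - z ^ Suc n * g n) / (g n * g (Suc n))"
      using gpos[OF n] gpos[of "Suc n"] by (simp add: diff_frac_eq)
    also have "z ^ n * g (Suc n) - z ^ Suc n * g n = z ^ n" unfolding gS by (simp add: algebra_simps)
    finally show ?thesis .
  qed
  also have "\<dots> \<le> 1 / (real n * real (Suc n))"
    using prod gpos[OF n] gpos[of "Suc n"] n by (simp add: divide_simps mult_ac)
  also have "\<dots> = 1 / real n - 1 / real (Suc n)" using n by (simp add: field_simps)
  finally have "1 / real (Suc n) - z ^ Suc n / g (Suc n) \<le> 1 / real n - z ^ n / g n" by linarith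
  then have "(1 / real (Suc n) - z ^ Suc n / g (Suc n)) / (1 - z) \<le> (1 / real n - z ^ n / g n) / (1 - z)"
    using z by (intro divide_right_mono) auto
  then show ?thesis unfolding b_def gz by (simp add: diff_divide_distrib mult.commute)
qed

text \<open>
  The divisor sums \<open>r = \<psi> * 1\<close> satisfy \<open>r \<ge> 0\<close> and \<open>r (m\<^sup>2) \<ge> 1\<close>, and
  \<open>\<Sum>n. \<psi> n * z\<^sup>n / (1 - z\<^sup>n) = \<Sum>N. r N * z\<^sup>N\<close>. Replacing the Lambert weights by
  \<open>1 / (n * (1 - z))\<close>, which turns the left-hand side into \<open>L(1) / (1 - z)\<close>, costs at most \<open>p\<close>
  since the difference of the weights decreases from 1 to 0.
\<close>

lemma (in nonprincipal_character) lambert_series_le: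
  fixes z :: real and M :: nat
  assumes real: "\<And>n. Im (\<psi> n) = 0" and z: "0 < z" "z < 1"
  shows "(\<Sum>m=1..M. z ^ (m\<^sup>2)) \<le> Re (L_series \<psi> 1) / (1 - z) + real p"
proof -
  define c where "c n = Re (\<psi> n)" for n
  have c_mult: "c (m * n) = c m * c n" for m n by (simp add: c_def mult real)
  have c1: "c (Suc 0) = 1" by (simp add: c_def)
  \<comment> \<open>Unless p divides n, the value is a root of unity by Euler's theorem; being real,
    it is 1 or -1.\<close>
  have c_sign: "c n \<in> {-1, 0, 1}" for n
  proof (cases "p dvd n")
    case True
    then show ?thesis using eq_0_iff[of n] by (simp add: c_def)
  next
    case False
    have pp: "prime p" by (rule prime_p)
    have "coprime n p" using pp False by (metis prime_imp_coprime coprime_commute)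
    then have "[n ^ totient p = 1] (mod p)" by (rule euler_theorem)
    then have "n ^ totient p mod p = 1" using prime_gt_1_nat[OF pp] by (simp add: Cong.cong_def)
    then have "\<psi> (n ^ totient p) = \<psi> 1"
      using periodic_mult by (metis mod_mult_div_eq)
    then have *: "\<psi> n ^ totient p = 1" by (simp add: power)
    have "\<psi> n = of_real (c n)" by (simp add: c_def complex_eq_iff real)
    then have "c n ^ totient p = 1" using * by (metis of_real_eq_1_iff of_real_power)
    then have "\<bar>c n\<bar> ^ totient p = 1" by (simp add: power_abs[symmetric])
    then have "\<bar>c n\<bar> = 1"
      using prime_gt_1_nat[OF pp] totient_prime[OF pp] power_eq_iff_eq_base[of "totient p" "\<bar>c n\<bar>" 1] by simp
    then show ?thesis by (auto simp: abs_if split: if_splits)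
  qed
  define g where "g n = z ^ n / (1 - z ^ n)" for n :: nat
  define b where "b n = 1 / (real n * (1 - z)) - g n" for n
  have b_dec: "b (Suc n) \<le> b n" if "n > 0" for n
    using lambert_weight_antimono[OF z that] by (simp add: b_def g_def)
  have b_lim: "b \<longlonglongrightarrow> 0"
  proof -
    have zn: "(\<lambda>n. z ^ n) \<longlonglongrightarrow> 0" using z by (intro LIMSEQ_realpow_zero) auto
    have "(\<lambda>n. 1 / (real n * (1 - z))) \<longlonglongrightarrow> 0"
      using tendsto_divide[OF lim_1_over_n tendsto_const[of "1 - z"]] z by simp
    moreover have "g \<longlonglongrightarrow> 0 / (1 - 0)"
      unfolding g_def by (intro tendsto_divide zn tendsto_diff tendsto_const) simp
    ultimately have "b \<longlonglongrightarrow> 0 - 0 / (1 - 0)" unfolding b_def by (intro tendsto_diff)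
    then show ?thesis by simp
  qed
  have b1: "b 1 = 1" using z by (simp add: b_def g_def diff_divide_distrib[symmetric])
  have bs: "summable (\<lambda>n. b n *\<^sub>R \<psi> n)" "norm (\<Sum>n. b n *\<^sub>R \<psi> n) \<le> p"
    using weighted_series[of b b] b_dec b_lim b1 by auto
  have "(\<lambda>n. Re (b n *\<^sub>R \<psi> n)) sums Re (\<Sum>n. b n *\<^sub>R \<psi> n)"
    by (rule sums_Re[OF summable_sums[OF bs(1)]])
  then have s1: "(\<lambda>n. b n * c n) sums Re (\<Sum>n. b n *\<^sub>R \<psi> n)" by (simp add: c_def)
  have "(\<lambda>n. Re ((real n powr - 1) *\<^sub>R \<psi> n)) sums Re (L_series \<psi> 1)"
    unfolding L_series_def by (rule sums_Re[OF summable_sums[OF summable_L]]) simp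
  then have "(\<lambda>n. c n / real n / (1 - z)) sums (Re (L_series \<psi> 1) / (1 - z))"
    by (intro sums_divide) (simp add: c_def powr_minus divide_simps)
  from sums_diff[OF this s1]
  have "(\<lambda>n. c n / real n / (1 - z) - b n * c n) sums (Re (L_series \<psi> 1) / (1 - z) - Re (\<Sum>n. b n *\<^sub>R \<psi> n))" .
  moreover have "c n / real n / (1 - z) - b n * c n = c n * g n" for n
    by (simp add: b_def algebra_simps)
  ultimately have s2: "(\<lambda>n. c n * g n) sums (Re (L_series \<psi> 1) / (1 - z) - Re (\<Sum>n. b n *\<^sub>R \<psi> n))"
    by simp
  define S where "S = Re (L_series \<psi> 1) / (1 - z) - Re (\<Sum>n. b n *\<^sub>R \<psi> n)"
  \<comment> \<open>Cutting at K leaves \<open>K div n\<close> terms of the geometric series of each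
    n <= K and loses at most z^K / (1 - z) per n. The total error K z^K / (1 - z) tends to
    0.\<close>
  have partial: "(\<Sum>m=1..M. z ^ (m\<^sup>2)) - real K * z ^ K / (1 - z) \<le> (\<Sum>n<Suc K. c n * g n)" if K: "K \<ge> M\<^sup>2" for K
  proof -
    have "(\<Sum>m=1..M. z ^ (m\<^sup>2)) \<le> (\<Sum>m=1..M. divisor_sum c (m\<^sup>2) * z ^ (m\<^sup>2))"
      using divisor_sum_square[of c, OF c_mult c1 c_sign] z by (intro sum_mono) simp
    also have "\<dots> = (\<Sum>N\<in>(\<lambda>m. m\<^sup>2) ` {1..M}. divisor_sum c N * z ^ N)"
      by (subst sum.reindex) (auto simp: inj_on_def)
    also have "\<dots> \<le> (\<Sum>N=1..K. divisor_sum c N * z ^ N)"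
    proof (rule sum_mono2)
      show "(\<lambda>m. m\<^sup>2) ` {1..M} \<subseteq> {1..K}"
        using K by (auto intro: order_trans[OF power_mono])
      show "divisor_sum c N * z ^ N \<ge> 0" if "N \<in> {1..K} - (\<lambda>m. m\<^sup>2) ` {1..M}" for N
        using that z divisor_sum_nonneg[of c, OF c_mult c1 c_sign, of N] by simp
    qed simp
    also have "\<dots> = (\<Sum>n=1..K. c n * (\<Sum>k=1..K div n. (z ^ n) ^ k))" by (rule sum_divisor_sum_power)
    also have "\<dots> \<le> (\<Sum>n=1..K. c n * g n + z ^ K / (1 - z))"
    proof (rule sum_mono)
      fix n assume "n \<in> {1..K}"
      then have n: "n \<ge> 1" "n \<le> K" by auto
      define x where "x = z ^ n"
      have "z ^ n \<le> z ^ 1" using n z by (intro power_decreasing) auto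
      then have x: "0 < x" "x \<le> z" "x < 1" using z by (auto simp: x_def)
      define e where "e = x ^ Suc (K div n) / (1 - x)"
      have "(\<Sum>k=1..K div n. x ^ k) = g n - e"
      proof -
        have "(\<Sum>k=1..K div n. x ^ k) = (x ^ 1 - x ^ Suc (K div n)) / (1 - x)"
          by (subst sum_gp) (use x in \<open>auto simp: not_less\<close>)
        then show ?thesis by (simp add: g_def e_def x_def[symmetric] diff_divide_distrib)
      qed
      moreover have "\<bar>c n * e\<bar> \<le> z ^ K / (1 - z)"
      proof -
        have "K < n * Suc (K div n)" using n by (simp add: dividend_less_times_div)
        then have "x ^ Suc (K div n) \<le> z ^ K"
          unfolding x_def power_mult[symmetric] using z by (intro power_decreasing) auto
        then have "e \<le> z ^ K / (1 - z)" unfolding e_def using x z by (intro frac_le) auto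
        moreover have "e \<ge> 0" using x by (simp add: e_def)
        moreover have "\<bar>c n\<bar> \<le> 1" using c_sign[of n] by auto
        ultimately show ?thesis using mult_mono[of "\<bar>c n\<bar>" 1 e "z ^ K / (1 - z)"] by (simp add: abs_mult)
      qed
      ultimately show "c n * (\<Sum>k=1..K div n. (z ^ n) ^ k) \<le> c n * g n + z ^ K / (1 - z)"
        unfolding x_def[symmetric] by (simp add: right_diff_distrib)
    qed
    also have "\<dots> = (\<Sum>n=1..K. c n * g n) + real K * z ^ K / (1 - z)"
      by (simp add: sum.distrib)
    also have "(\<Sum>n=1..K. c n * g n) = (\<Sum>n<Suc K. c n * g n)"
      by (rule sum.mono_neutral_left) (auto simp: c_def not_le)
    finally show ?thesis by linarith
  qed
  have lim1: "(\<lambda>K. \<Sum>n<Suc K. c n * g n) \<longlonglongrightarrow> S"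
    using LIMSEQ_Suc s2 unfolding sums_def S_def by blast
  have lim2: "(\<lambda>K. (\<Sum>m=1..M. z ^ (m\<^sup>2)) - real K * z ^ K / (1 - z)) \<longlonglongrightarrow> (\<Sum>m=1..M. z ^ (m\<^sup>2)) - 0 / (1 - z)"
    using powser_times_n_limit_0[of z] z by (intro tendsto_intros) auto
  have "(\<Sum>m=1..M. z ^ (m\<^sup>2)) - 0 / (1 - z) \<le> S"
    by (rule LIMSEQ_le[OF lim2 lim1]) (use partial in blast)
  moreover have "- Re (\<Sum>n. b n *\<^sub>R \<psi> n) \<le> p"
    using bs(2) abs_Re_le_cmod[of "\<Sum>n. b n *\<^sub>R \<psi> n"] by linarith
  ultimately show ?thesis by (simp add: S_def)
qed

text \<open>In \<open>lambert_series_le\<close> take M = 4 p and 1 - z = 1 / (2 M^2). By Bernoulli's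
  inequality each of the M terms is at least 1/2, so the left-hand side is at least 2 p and survives
  the loss p. What remains is p <= 2 M^2 L(1) = 32 p^2 L(1).\<close>

lemma (in nonprincipal_character) L_one_real_ge:
  assumes real: "\<And>n. Im (\<psi> n) = 0"
  shows "Re (L_series \<psi> 1) \<ge> 1 / (32 * real p)"
proof -
  have p: "p \<ge> 2" using prime_ge_2_nat[OF prime_p] .
  define M where "M = 4 * p"
  define z where "z = 1 - 1 / (2 * real M ^ 2)"
  have M: "real M \<ge> 8" using p by (simp add: M_def)
  then have M2: "real M ^ 2 \<ge> 64" using power_mono[of 8 "real M" 2] by simp
  have M3: "1 < 2 * real M ^ 2" using M2 by linarith
  then have z: "0 < z" "z < 1" unfolding z_def using M by (simp_all add: divide_less_eq)
  have "1 / 2 \<le> z ^ (m\<^sup>2)" if "m \<in> {1..M}" for m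
  proof -
    have "m\<^sup>2 \<le> M\<^sup>2" using that by (intro power_mono) auto
    have "1 / 2 = 1 + real (M\<^sup>2) * (- 1 / (2 * real M ^ 2))" using M by (simp add: field_simps)
    also have "\<dots> \<le> (1 + (- 1 / (2 * real M ^ 2))) ^ (M\<^sup>2)"
      using M3 M by (intro Bernoulli_inequality) (simp add: divide_le_eq)
    also have "\<dots> = z ^ (M\<^sup>2)" by (simp add: z_def)
    also have "\<dots> \<le> z ^ (m\<^sup>2)" using \<open>m\<^sup>2 \<le> M\<^sup>2\<close> z by (intro power_decreasing) auto
    finally show ?thesis .
  qed
  then have "(\<Sum>m=1..M. 1 / 2) \<le> (\<Sum>m=1..M. z ^ (m\<^sup>2))" by (intro sum_mono)
  also have "\<dots> \<le> Re (L_series \<psi> 1) / (1 - z) + real p" by (rule lambert_series_le[OF real z])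
  finally have "real p \<le> Re (L_series \<psi> 1) * (2 * real M ^ 2)" using M by (simp add: z_def M_def)
  then have "real p * 1 \<le> real p * (Re (L_series \<psi> 1) * (32 * real p))"
    by (simp add: M_def power2_eq_square mult_ac)
  then have "1 \<le> Re (L_series \<psi> 1) * (32 * real p)" using p by (subst (asm) mult_le_cancel_left_pos) auto
  then show ?thesis using p by (simp add: divide_le_eq)
qed

section \<open>The product of all L-series modulo p\<close>

lemma neg_ln_norm_one_minus_sums:
  fixes z :: complex
  assumes "norm z < 1"
  shows "(\<lambda>k. Re (z ^ k) / real k) sums (- ln (norm (1 - z)))"
proof -
  have nz: "1 - z \<noteq> 0" using assms by auto
  have "(\<lambda>k. - ((- (- z)) ^ k) / of_nat k) sums ln (1 + (- z))"
    by (rule Ln_series') (use assms in simp)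
  then have "(\<lambda>k. - Re (- ((- (- z)) ^ k) / of_nat k)) sums (- Re (ln (1 + (- z))))"
    by (intro sums_minus sums_Re)
  moreover have "Re (ln (1 + (- z))) = ln (norm (1 - z))" using nz by simp
  ultimately show ?thesis by simp
qed

lemma neg_ln_norm_one_minus_le:
  fixes z :: complex
  assumes "norm z \<le> 1 / 2"
  shows "- ln (norm (1 - z)) \<le> Re z + 2 * norm z ^ 2"
proof -
  have nz: "1 - z \<noteq> 0" using assms by auto
  have "norm (ln (1 + (- z)) - (- z)) \<le> norm (- z) ^ 2 / (1 - norm (- z))"
    by (rule Ln_approx_linear) (use assms in auto)
  also have "\<dots> \<le> norm z ^ 2 / (1 / 2)" using assms by (intro frac_le) auto
  finally have 1: "norm (ln (1 - z) + z) \<le> 2 * norm z ^ 2" by simp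
  have "Re (ln (1 - z)) = ln (norm (1 - z))" using nz by simp
  then have "- ln (norm (1 - z)) - Re z = - Re (ln (1 - z) + z)" by simp
  also have "\<dots> \<le> norm (ln (1 - z) + z)" using abs_Re_le_cmod[of "ln (1 - z) + z"] by linarith
  finally show ?thesis using 1 by linarith
qed

locale mod_character_group =
  fixes p :: nat and \<psi> :: "nat \<Rightarrow> nat \<Rightarrow> complex"
  assumes prime_p: "prime p"
    and character: "\<And>j. mod_character p (\<psi> j)"
    and nonprincipal: "\<And>j. 0 < j \<Longrightarrow> j < p - 1 \<Longrightarrow> nonprincipal_character p (\<psi> j)"
    and principal: "\<And>n. \<psi> 0 n = (if p dvd n then 0 else 1)"
    and orthogonal: "\<And>n. (\<Sum>j<p - 1. \<psi> j n) = (if [n = 1] (mod p) then of_nat (p - 1) else 0)"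
    and conjugate: "\<And>j n. j < p - 1 \<Longrightarrow> 0 < j \<Longrightarrow> \<psi> (p - 1 - j) n = cnj (\<psi> j n)"
begin

text \<open>The product behind it is the Dedekind zeta function of the p-th cyclotomic field without
  its Euler factor at p.\<close>

definition log_L :: "real \<Rightarrow> real" where
  "log_L s = (\<Sum>j<p - 1. ln (norm (L_series (\<psi> j) s)))"

definition prime_term :: "real \<Rightarrow> nat \<Rightarrow> real" where
  "prime_term s q = (\<Sum>j<p - 1. - ln (norm (1 - (real q powr - s) *\<^sub>R \<psi> j q)))"

lemma p_ge_2: "p \<ge> 2"
  using prime_ge_2_nat[OF prime_p] .

lemma norm_character_le: "norm (\<psi> j n) \<le> 1"
  using mod_character.norm_le_1[OF character] .

lemma summable_norm_L:
  assumes "s > 1"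
  shows "summable (\<lambda>n. norm ((real n powr - s) *\<^sub>R \<psi> j n))"
proof (rule summable_comparison_test'[OF summable_powr[OF assms], of 0])
  fix n show "norm (norm ((real n powr - s) *\<^sub>R \<psi> j n)) \<le> real n powr - s"
    using norm_character_le[of j n] by (simp add: mult_left_le)
qed

lemma prime_powr_le_half:
  assumes "s > 1" "prime q"
  shows "real q powr - s \<le> 1 / 2"
proof -
  have q: "real q \<ge> 2" using prime_ge_2_nat[OF assms(2)] by simp
  then have "real q powr - s \<le> real q powr - 1" using assms by (intro powr_mono) auto
  also have "\<dots> \<le> 1 / 2" using q by (simp add: powr_minus divide_simps)
  finally show ?thesis .
qed

lemma
  assumes s: "s > 1"
  shows L_nonzero: "L_series (\<psi> j) s \<noteq> 0"
    and log_L_limit: "(\<lambda>N. \<Sum>q\<in>primes_upto N. prime_term s q) \<longlonglongrightarrow> log_L s"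
proof -
  define f where "f j n = (real n powr - s) *\<^sub>R \<psi> j n" for j n
  have lt1: "norm (f j q) < 1" if "prime q" for q j
    using prime_powr_le_half[OF s that] norm_character_le[of j q] mult_mono[of "real q powr - s" "1/2" "norm (\<psi> j q)" 1]
    by (simp add: f_def)
  have *: "suminf (f j) \<noteq> 0 \<and> (\<lambda>N. \<Sum>q\<in>primes_upto N. - ln (norm (1 - f j q))) \<longlonglongrightarrow> ln (norm (suminf (f j)))" for j
  proof -
    interpret mod_character p "\<psi> j" by (rule character)
    have m: "f j (a * b) = f j a * f j b" for a b
      by (simp add: f_def mult powr_mult)
    have f0: "f j 0 = 0" and f1: "f j (Suc 0) = 1" by (simp_all add: f_def)
    have summ: "summable (\<lambda>n. norm (f j n))" unfolding f_def by (rule summable_norm_L[OF s])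
    show ?thesis
      by (intro conjI ln_euler_product[of "f j", OF m f0 f1 summ lt1])
  qed
  have Lf: "L_series (\<psi> j) s = suminf (f j)" for j by (simp add: L_series_def f_def[abs_def])
  show "L_series (\<psi> j) s \<noteq> 0" using * by (simp add: Lf)
  have "(\<lambda>N. \<Sum>j<p - 1. \<Sum>q\<in>primes_upto N. - ln (norm (1 - f j q))) \<longlonglongrightarrow> log_L s"
    unfolding log_L_def Lf by (intro tendsto_sum) (use * in blast)
  also have "(\<lambda>N. \<Sum>j<p - 1. \<Sum>q\<in>primes_upto N. - ln (norm (1 - f j q))) = (\<lambda>N. \<Sum>q\<in>primes_upto N. prime_term s q)"
    unfolding prime_term_def f_def by (subst sum.swap) (rule refl)
  finally show "(\<lambda>N. \<Sum>q\<in>primes_upto N. prime_term s q) \<longlonglongrightarrow> log_L s" .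
qed

text \<open>Expanding the logarithms and applying orthogonality to q^k leaves p - 1 times the sum of
  q^(-k s) / k over the k with q^k congruent to 1 modulo p, a series of nonnegative terms. For the
  upper bound the linear terms are summed exactly, and each of the p - 1 remainders is at most twice
  the square of q^(-s).\<close>

lemma
  assumes s: "s > 1" and q: "prime q"
  shows prime_term_nonneg: "prime_term s q \<ge> 0"
    and prime_term_le: "prime_term s q \<le> real (p - 1) * ((if [q = 1] (mod p) then real q powr - s else 0) + 2 * real q powr - 2)"
proof -
  define T where "T = real q powr - s"
  have T: "0 \<le> T" "T \<le> 1 / 2" using prime_powr_le_half[OF s q] by (auto simp: T_def)
  have nle: "norm (T *\<^sub>R \<psi> j q) \<le> T" for j
    using T norm_character_le[of j q] by (simp add: mult_left_le)
  have sm: "(\<lambda>k. \<Sum>j<p - 1. Re ((T *\<^sub>R \<psi> j q) ^ k) / real k) sums prime_term s q"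
    unfolding prime_term_def T_def[symmetric]
  proof (intro sums_sum neg_ln_norm_one_minus_sums)
    fix j show "norm (T *\<^sub>R \<psi> j q) < 1" using nle[of j] T by linarith
  qed
  have nn: "(\<Sum>j<p - 1. Re ((T *\<^sub>R \<psi> j q) ^ k) / real k) \<ge> 0" for k
  proof -
    have "(\<Sum>j<p - 1. Re ((T *\<^sub>R \<psi> j q) ^ k) / real k) = T ^ k * Re (\<Sum>j<p - 1. \<psi> j (q ^ k)) / real k"
      using mod_character.power[OF character]
      by (simp add: scaleR_power sum_divide_distrib[symmetric] sum_distrib_left)
    also have "\<dots> \<ge> 0" unfolding orthogonal using T by simp
    finally show ?thesis .
  qed
  show "prime_term s q \<ge> 0"
    by (rule sums_le[OF nn sums_zero sm])
  have "prime_term s q \<le> (\<Sum>j<p - 1. T * Re (\<psi> j q) + 2 * T ^ 2)"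
    unfolding prime_term_def T_def[symmetric]
  proof (rule sum_mono)
    fix j
    have "- ln (norm (1 - T *\<^sub>R \<psi> j q)) \<le> Re (T *\<^sub>R \<psi> j q) + 2 * norm (T *\<^sub>R \<psi> j q) ^ 2"
      by (rule neg_ln_norm_one_minus_le) (use nle[of j] T in linarith)
    also have "norm (T *\<^sub>R \<psi> j q) ^ 2 \<le> T ^ 2" using nle[of j] by (intro power_mono) auto
    finally show "- ln (norm (1 - T *\<^sub>R \<psi> j q)) \<le> T * Re (\<psi> j q) + 2 * T ^ 2" by simp
  qed
  also have "\<dots> = T * Re (\<Sum>j<p - 1. \<psi> j q) + real (p - 1) * (2 * T ^ 2)"
    by (simp add: sum.distrib sum_distrib_left)
  also have "\<dots> = real (p - 1) * ((if [q = 1] (mod p) then T else 0) + 2 * T ^ 2)"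
    unfolding orthogonal by (simp add: algebra_simps)
  also have "\<dots> \<le> real (p - 1) * ((if [q = 1] (mod p) then T else 0) + 2 * real q powr - 2)"
  proof -
    have "T \<le> real q powr - 1"
      unfolding T_def using s prime_gt_0_nat[OF q] by (intro powr_mono) (auto simp: Suc_le_eq)
    then have "T ^ 2 \<le> (real q powr - 1) ^ 2" using T by (intro power_mono)
    also have "\<dots> = real q powr - 2"
      using prime_gt_0_nat[OF q] by (simp add: powr_minus inverse_eq_divide power_divide)
    finally show ?thesis by (intro mult_left_mono add_left_mono) auto
  qed
  finally show "prime_term s q \<le> real (p - 1) * ((if [q = 1] (mod p) then real q powr - s else 0) + 2 * real q powr - 2)"
    by (simp only: T_def)
qed

lemma log_L_nonneg:
  assumes "s > 1"
  shows "log_L s \<ge> 0"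
proof (rule LIMSEQ_le_const[OF log_L_limit[OF assms]], intro exI[of _ 0] allI impI)
  fix N show "0 \<le> (\<Sum>q\<in>primes_upto N. prime_term s q)"
    using prime_term_nonneg[OF assms] by (intro sum_nonneg) (simp add: primes_upto_def)
qed

text \<open>For primes up to \<open>X\<close> the exponent s is replaced by 1; primes above
  \<open>X\<close> are bounded by the sum over all integers above \<open>X\<close>. The 4 is 2
  zeta(2) with zeta(2) <= 2.\<close>

lemma log_L_le:
  assumes s: "s > 1" and X: "X > 0"
  shows "log_L s \<le> real (p - 1) * ((\<Sum>q\<in>{q\<in>primes_upto X. [q = 1] (mod p)}. 1 / real q)
      + real X powr (1 - s) / (s - 1) + 4)"
proof (rule LIMSEQ_le_const2[OF log_L_limit[OF s]], intro exI[of _ 0] allI impI)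
  fix N :: nat
  let ?P = "{q\<in>primes_upto X. [q = 1] (mod p)}"
  have summ: "summable (\<lambda>n. real n powr - 2)" by (rule summable_powr) simp
  have "(\<Sum>q\<in>primes_upto N. real q powr - 2) \<le> (\<Sum>n. real n powr - 2)"
    by (rule sum_le_suminf[OF summ]) auto
  also have "\<dots> \<le> 1 + 1 / (2 - 1)" by (rule zeta_bounds(2)) simp
  finally have A: "(\<Sum>q\<in>primes_upto N. 2 * real q powr - 2) \<le> 4"
    by (simp add: sum_distrib_left[symmetric])
  define R where "R = {q\<in>primes_upto N. [q = 1] (mod p)}"
  have fin: "finite R" by (simp add: R_def)
  have "(\<Sum>q\<in>primes_upto N. if [q = 1] (mod p) then real q powr - s else 0) = (\<Sum>q\<in>R. real q powr - s)"
    unfolding R_def by (simp add: sum.inter_filter)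
  also have "\<dots> = (\<Sum>q\<in>R \<inter> {..X}. real q powr - s) + (\<Sum>q\<in>R - {..X}. real q powr - s)"
    by (rule sum.Int_Diff[OF fin])
  also have "(\<Sum>q\<in>R \<inter> {..X}. real q powr - s) \<le> (\<Sum>q\<in>R \<inter> {..X}. 1 / real q)"
  proof (rule sum_mono)
    fix q assume "q \<in> R \<inter> {..X}"
    then have "real q \<ge> 1" by (auto simp: R_def primes_upto_def dest: prime_ge_1_nat)
    then have "real q powr - s \<le> real q powr - 1" using s by (intro powr_mono) auto
    then show "real q powr - s \<le> 1 / real q" by (simp add: powr_minus inverse_eq_divide)
  qed
  also have "(\<Sum>q\<in>R \<inter> {..X}. 1 / real q) \<le> (\<Sum>q\<in>?P. 1 / real q)"
    by (rule sum_mono2) (auto simp: R_def primes_upto_def)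
  also have "(\<Sum>q\<in>R - {..X}. real q powr - s) = (\<Sum>n\<in>(\<lambda>q. q - Suc X) ` (R - {..X}). real (n + Suc X) powr - s)"
  proof (subst sum.reindex)
    show "inj_on (\<lambda>q. q - Suc X) (R - {..X})"
      by (rule inj_onI) auto
    show "(\<Sum>q\<in>R - {..X}. real q powr - s)
        = sum ((\<lambda>n. real (n + Suc X) powr - s) \<circ> (\<lambda>q. q - Suc X)) (R - {..X})"
    proof (rule sum.cong[OF refl])
      fix q assume "q \<in> R - {..X}"
      then have "q - Suc X + Suc X = q" by simp
      then show "real q powr - s = ((\<lambda>n. real (n + Suc X) powr - s) \<circ> (\<lambda>q. q - Suc X)) q"
        by (simp only: o_def)
    qed
  qed
  also have "\<dots> \<le> (\<Sum>n. real (n + Suc X) powr - s)"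
    by (rule sum_le_suminf) (use fin summable_ignore_initial_segment[OF summable_powr[OF s], of "Suc X"] in auto)
  also have "\<dots> \<le> real X powr (1 - s) / (s - 1)" by (rule suminf_powr_tail_le[OF s X])
  finally have B: "(\<Sum>q\<in>primes_upto N. if [q = 1] (mod p) then real q powr - s else 0)
    \<le> (\<Sum>q\<in>?P. 1 / real q) + real X powr (1 - s) / (s - 1)" by linarith
  have "(\<Sum>q\<in>primes_upto N. prime_term s q)
     \<le> (\<Sum>q\<in>primes_upto N. real (p - 1) * ((if [q = 1] (mod p) then real q powr - s else 0) + 2 * real q powr - 2))"
    by (intro sum_mono prime_term_le[OF s]) (simp add: primes_upto_def)
  also have "\<dots> = real (p - 1) * ((\<Sum>q\<in>primes_upto N. if [q = 1] (mod p) then real q powr - s else 0)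
     + (\<Sum>q\<in>primes_upto N. 2 * real q powr - 2))"
    by (simp only: sum_distrib_left[symmetric] sum.distrib)
  also have "\<dots> \<le> real (p - 1) * (((\<Sum>q\<in>?P. 1 / real q) + real X powr (1 - s) / (s - 1)) + 4)"
    using A B by (intro mult_left_mono add_mono) auto
  finally show "(\<Sum>q\<in>primes_upto N. prime_term s q)
    \<le> real (p - 1) * ((\<Sum>q\<in>?P. 1 / real q) + real X powr (1 - s) / (s - 1) + 4)" .
qed

text \<open>The factor 2 in the lower bound comes from the missing Euler factor: the principal
  series is zeta times 1 - p^(-s), which is at least 1/2.\<close>

lemma
  assumes s: "s > 1"
  shows L_principal_ge: "norm (L_series (\<psi> 0) s) \<ge> 1 / (2 * (s - 1))"
    and L_principal_le: "norm (L_series (\<psi> 0) s) \<le> 1 + 1 / (s - 1)"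
proof -
  have "norm (L_series (\<psi> 0) s) \<le> (\<Sum>n. norm ((real n powr - s) *\<^sub>R \<psi> 0 n))"
    unfolding L_series_def by (rule summable_norm[OF summable_norm_L[OF s]])
  also have "\<dots> \<le> (\<Sum>n. real n powr - s)"
    by (intro suminf_le summable_norm_L s summable_powr) (simp add: principal)
  also have "\<dots> \<le> 1 + 1 / (s - 1)" by (rule zeta_bounds(2)[OF s])
  finally show "norm (L_series (\<psi> 0) s) \<le> 1 + 1 / (s - 1)" .
  define f :: "nat \<Rightarrow> complex" where "f n = of_real (real n powr - s)" for n
  have nf: "norm (f n) = real n powr - s" for n by (simp add: f_def)
  have summ: "summable (\<lambda>n. norm (f n))" unfolding nf by (rule summable_powr[OF s])
  have m: "f (a * b) = f a * f b" for a b by (simp add: f_def powr_mult)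
  have "infsum f {n. \<forall>q\<in>{p}. \<not> q dvd n} = (\<Prod>q\<in>{p}. 1 - f q) * suminf f"
    by (rule euler_sieve[of f, OF m summ]) (use prime_p in auto)
  then have 1: "infsum f {n. \<not> p dvd n} = (1 - f p) * suminf f" by simp
  have "infsum f {n. \<not> p dvd n} = infsum (\<lambda>n. (real n powr - s) *\<^sub>R \<psi> 0 n) UNIV"
    by (rule infsum_cong_neutral) (auto simp: f_def principal scaleR_conv_of_real)
  also have "\<dots> = L_series (\<psi> 0) s"
    unfolding L_series_def
    by (intro infsumI norm_summable_imp_has_sum[OF summable_norm_L[OF s]]
         summable_sums[OF summable_norm_cancel[OF summable_norm_L[OF s]]])
  finally have "L_series (\<psi> 0) s = (1 - f p) * suminf f" using 1 by simp
  moreover have "suminf f = of_real (\<Sum>n. real n powr - s)"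
    unfolding f_def by (rule suminf_of_real[OF summable_powr[OF s], symmetric])
  ultimately have L: "L_series (\<psi> 0) s = of_real ((1 - real p powr - s) * (\<Sum>n. real n powr - s))"
    by (simp add: f_def)
  have "1 / 2 * (1 / (s - 1)) \<le> (1 - real p powr - s) * (\<Sum>n. real n powr - s)"
    using prime_powr_le_half[OF s prime_p] zeta_bounds(1)[OF s] s by (intro mult_mono) auto
  also have "\<dots> \<le> norm (L_series (\<psi> 0) s)" unfolding L norm_of_real by (rule abs_ge_self)
  finally show "norm (L_series (\<psi> 0) s) \<ge> 1 / (2 * (s - 1))" by (simp add: mult.commute)
qed

text \<open>
  A distance from 1 at which no nonprincipal \<open>L\<close> can be small: for real characters this is
  the bound at 1, and for a conjugate pair two small factors would outweigh the simple pole of the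
  principal factor and make \<open>log_L\<close> negative.
\<close>

definition \<eta> :: real where
  "\<eta> = 1 / (128 * real p ^ (p + 2))"

lemma \<eta>_pos: "0 < \<eta>" and \<eta>_le: "\<eta> \<le> 1 / (512 * real p ^ 2)" and \<eta>_le_1: "\<eta> \<le> 1"
proof -
  have p: "real p \<ge> 2" using p_ge_2 by simp
  show "0 < \<eta>" using p by (simp add: \<eta>_def)
  have "2 ^ 2 \<le> real p ^ 2" using p by (intro power_mono) auto
  also have "\<dots> \<le> real p ^ p" using p p_ge_2 by (intro power_increasing) auto
  finally have "4 * real p ^ 2 \<le> real p ^ p * real p ^ 2"
    by (intro mult_right_mono) auto
  then have "4 * real p ^ 2 \<le> real p ^ (p + 2)"
    by (simp only: power_add)
  then show le: "\<eta> \<le> 1 / (512 * real p ^ 2)" unfolding \<eta>_def using p by (intro divide_left_mono) auto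
  have "1 \<le> real p ^ 2" using p by simp
  then have "1 / (512 * real p ^ 2) \<le> 1" by (simp add: divide_le_eq)
  with le show "\<eta> \<le> 1" by linarith
qed

text \<open>A real character has L(1) >= 1 / (32 p), and L moves by at most 2 p \<eta> up to 1 +
  \<eta>. Otherwise the conjugate index \<open>i\<close> gives a factor of the same modulus, so in
  the nonnegative \<open>log_L (1 + \<eta>)\<close> the small factor counts twice, against at most
  ln (2 / \<eta>) from the principal factor and ln p from each other one. The bound 8 p \<eta> is
  twice the drift 4 p \<eta> that \<open>L_ratio_ge\<close> has to absorb.\<close>

lemma L_at_\<eta>_ge:
  assumes j: "0 < j" "j < p - 1"
  shows "norm (L_series (\<psi> j) (1 + \<eta>)) \<ge> 8 * real p * \<eta>"
proof -
  interpret nonprincipal_character p "\<psi> j" by (rule nonprincipal[OF j])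
  have p: "real p \<ge> 2" using p_ge_2 by simp
  show ?thesis
  proof (cases "j = p - 1 - j")
    case True
    have "Im (\<psi> j n) = 0" for n
      using conjugate[OF j(2,1), of n] True by (metis complex_cnj_cancel_iff cnj.sel(2) neg_equal_zero)
    then have "1 / (32 * real p) \<le> Re (L_series (\<psi> j) 1)" by (rule L_one_real_ge)
    also have "\<dots> \<le> norm (L_series (\<psi> j) 1)" by (rule complex_Re_le_cmod)
    also have "\<dots> \<le> norm (L_series (\<psi> j) (1 + \<eta>)) + norm (L_series (\<psi> j) (1 + \<eta>) - L_series (\<psi> j) 1)"
      by (metis norm_minus_commute norm_triangle_sub)
    also have "norm (L_series (\<psi> j) (1 + \<eta>) - L_series (\<psi> j) 1) \<le> 2 * real p * (1 + \<eta> - 1)"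
      using \<eta>_pos by (intro L_lipschitz) simp
    finally have 1: "1 / (32 * real p) - 2 * real p * \<eta> \<le> norm (L_series (\<psi> j) (1 + \<eta>))" by simp
    have "10 * real p * \<eta> \<le> 10 * real p * (1 / (512 * real p ^ 2))"
      using \<eta>_le by (intro mult_left_mono) auto
    also have "\<dots> \<le> 1 / (32 * real p)" using p by (simp add: power2_eq_square field_simps)
    finally show ?thesis using 1 by linarith
  next
    case False
    define i where "i = p - 1 - j"
    have i: "i \<noteq> j" "0 < i" "i < p - 1" using False j by (auto simp: i_def)
    define s where "s = 1 + \<eta>"
    have s: "s > 1" using \<eta>_pos by (simp add: s_def)
    have "L_series (\<psi> i) s = cnj (L_series (\<psi> j) s)"
    proof -
      have "(\<lambda>n. (real n powr - s) *\<^sub>R \<psi> j n) sums L_series (\<psi> j) s"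
        unfolding L_series_def by (rule summable_sums[OF summable_L]) (use s in simp)
      then have "(\<lambda>n. cnj ((real n powr - s) *\<^sub>R \<psi> j n)) sums cnj (L_series (\<psi> j) s)"
        by (simp only: sums_cnj)
      then have "(\<lambda>n. (real n powr - s) *\<^sub>R \<psi> i n) sums cnj (L_series (\<psi> j) s)"
        using conjugate[OF j(2,1)] by (simp add: i_def)
      then show ?thesis unfolding L_series_def by (simp add: sums_iff)
    qed
    then have eq: "norm (L_series (\<psi> i) s) = norm (L_series (\<psi> j) s)" by simp
    define l where "l k = ln (norm (L_series (\<psi> k) s))" for k
    have l_le: "l k \<le> ln (real p)" if "0 < k" "k < p - 1" for k
      unfolding l_def using L_nonzero[OF s, of k] nonprincipal_character.norm_L_le[OF nonprincipal[OF that], of s] s p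
      by (subst ln_le_cancel_iff) auto
    have l0: "l 0 \<le> ln (2 / \<eta>)"
    proof -
      have "norm (L_series (\<psi> 0) s) \<le> 1 + 1 / \<eta>" using L_principal_le[OF s] by (simp add: s_def)
      also have "\<dots> \<le> 2 / \<eta>" using \<eta>_pos \<eta>_le_1 by (simp add: field_simps)
      finally show ?thesis unfolding l_def using L_nonzero[OF s, of 0] \<eta>_pos by (subst ln_le_cancel_iff) auto
    qed
    have lnp: "ln (real p) \<ge> 0" using p by simp
    have "0 \<le> (\<Sum>k<p - 1. l k)" using log_L_nonneg[OF s] by (simp add: log_L_def l_def)
    also have "{..<p - 1} = {0, i, j} \<union> ({..<p - 1} - {0, i, j})" using i j by auto
    also have "(\<Sum>k\<in>\<dots>. l k) = (\<Sum>k\<in>{0, i, j}. l k) + (\<Sum>k\<in>{..<p - 1} - {0, i, j}. l k)"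
      by (rule sum.union_disjoint) auto
    also have "(\<Sum>k\<in>{0, i, j}. l k) = l 0 + 2 * l j" using i j eq by (simp add: l_def)
    also have "(\<Sum>k\<in>{..<p - 1} - {0, i, j}. l k) \<le> (\<Sum>k\<in>{..<p - 1} - {0, i, j}. ln (real p))"
      by (intro sum_mono l_le) auto
    also have "\<dots> = real (card ({..<p - 1} - {0, i, j})) * ln (real p)" by simp
    also have "\<dots> \<le> real p * ln (real p)"
    proof (rule mult_right_mono[OF _ lnp])
      have "card ({..<p - 1} - {0, i, j}) \<le> card {..<p - 1}" by (intro card_mono) auto
      then show "real (card ({..<p - 1} - {0, i, j})) \<le> real p" by simp
    qed
    finally have "- (ln (2 / \<eta>) + real p * ln (real p)) \<le> 2 * l j" using l0 by linarith
    then have "exp (- (ln (2 / \<eta>) + real p * ln (real p))) \<le> exp (l j) ^ 2"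
      by (subst exp_of_nat_mult[symmetric]) simp
    also have "exp (l j) = norm (L_series (\<psi> j) s)" unfolding l_def using L_nonzero[OF s, of j] by simp
    also have "exp (- (ln (2 / \<eta>) + real p * ln (real p))) = \<eta> / (2 * real p ^ p)"
    proof -
      have "exp (- (ln (2 / \<eta>) + real p * ln (real p))) = 1 / (exp (ln (2 / \<eta>)) * exp (ln (real p)) ^ p)"
        by (simp only: exp_minus exp_add exp_of_nat_mult inverse_eq_divide)
      then show ?thesis using \<eta>_pos p by simp
    qed
    finally have 2: "\<eta> / (2 * real p ^ p) \<le> norm (L_series (\<psi> j) s) ^ 2" .
    \<comment> \<open>The value of \<open>\<eta>\<close> is made for the identity 64 p^2 \<eta> = 1
      / (2 p^p).\<close>
    have "(8 * real p * \<eta>) ^ 2 = \<eta> * (64 * real p ^ 2 * \<eta>)"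
      by (simp add: power2_eq_square)
    also have "64 * real p ^ 2 * \<eta> = 1 / (2 * real p ^ p)"
      using p by (simp add: \<eta>_def power_add field_simps power2_eq_square)
    finally have "(8 * real p * \<eta>) ^ 2 \<le> norm (L_series (\<psi> j) s) ^ 2" using 2 by simp
    then show ?thesis unfolding s_def by (rule power2_le_imp_le) simp
  qed
qed

lemma L_ratio_ge:
  assumes j: "0 < j" "j < p - 1" and s: "1 < s" "s \<le> 1 + \<eta>"
  shows "norm (L_series (\<psi> j) s) \<ge> norm (L_series (\<psi> j) (1 + \<eta>)) / 2"
proof -
  interpret nonprincipal_character p "\<psi> j" by (rule nonprincipal[OF j])
  have "norm (L_series (\<psi> j) (1 + \<eta>) - L_series (\<psi> j) 1) \<le> 2 * real p * (1 + \<eta> - 1)"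
    using \<eta>_pos by (intro L_lipschitz) simp
  moreover have "norm (L_series (\<psi> j) s - L_series (\<psi> j) 1) \<le> 2 * real p * (s - 1)"
    using s by (intro L_lipschitz) simp
  moreover have "2 * real p * (s - 1) \<le> 2 * real p * \<eta>" using s by (intro mult_left_mono) auto
  moreover have "norm (L_series (\<psi> j) (1 + \<eta>)) \<le> norm (L_series (\<psi> j) s) +
      norm (L_series (\<psi> j) (1 + \<eta>) - L_series (\<psi> j) 1) + norm (L_series (\<psi> j) s - L_series (\<psi> j) 1)"
    using norm_triangle_ineq4[of "L_series (\<psi> j) (1 + \<eta>) - L_series (\<psi> j) 1" "L_series (\<psi> j) s - L_series (\<psi> j) 1"]
      norm_triangle_sub[of "L_series (\<psi> j) (1 + \<eta>)" "L_series (\<psi> j) s"] by simp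
  ultimately show ?thesis using L_at_\<eta>_ge[OF j] by simp
qed

text \<open>Positivity of \<open>log_L\<close> at 1 + \<eta> bounds the sum of all nonprincipal
  terms there below by - ln (2 / \<eta>), and moving to \<open>s\<close> costs ln 2 per character.
  Bounding the nonprincipal factors one at a time by \<open>L_at_\<eta>_ge\<close> would cost about
  p ln (1 / \<eta>), of order p^2 ln p, and confine the density argument to a < 1/2.\<close>

lemma log_L_ge:
  assumes s: "1 < s" "s \<le> 1 + \<eta>"
  shows "log_L s \<ge> ln (1 / (s - 1)) - ln (1 / \<eta>) - real (p - 1) * ln 2 - 2 * ln 2"
proof -
  define l where "l s k = ln (norm (L_series (\<psi> k) s))" for s k
  have s1: "1 + \<eta> > 1" using \<eta>_pos by simp
  have split: "log_L t = l t 0 + (\<Sum>k\<in>{1..<p - 1}. l t k)" for t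
  proof -
    have "{..<p - 1} = insert 0 {1..<p - 1}" using p_ge_2 by auto
    then show ?thesis unfolding log_L_def l_def by (simp only: sum.insert[of "{1..<p - 1}" 0]) simp
  qed
  have "(\<Sum>k\<in>{1..<p - 1}. l (1 + \<eta>) k - ln 2) \<le> (\<Sum>k\<in>{1..<p - 1}. l s k)"
  proof (rule sum_mono)
    fix k assume k: "k \<in> {1..<p - 1}"
    have pos: "norm (L_series (\<psi> k) (1 + \<eta>)) > 0" using L_nonzero[OF s1, of k] by simp
    have "ln (norm (L_series (\<psi> k) (1 + \<eta>)) / 2) \<le> l s k"
      unfolding l_def using L_ratio_ge[of k, OF _ _ s] k pos by (subst ln_le_cancel_iff) auto
    then show "l (1 + \<eta>) k - ln 2 \<le> l s k" unfolding l_def using pos by (simp add: ln_div)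
  qed
  then have "(\<Sum>k\<in>{1..<p - 1}. l (1 + \<eta>) k) - real (p - 1 - 1) * ln 2 \<le> (\<Sum>k\<in>{1..<p - 1}. l s k)"
    by (simp add: sum_subtractf)
  moreover have "real (p - 1 - 1) * ln 2 \<le> real (p - 1) * ln 2" by (intro mult_right_mono) auto
  moreover have "l (1 + \<eta>) 0 \<le> ln (2 / \<eta>)"
  proof -
    have "norm (L_series (\<psi> 0) (1 + \<eta>)) \<le> 1 + 1 / \<eta>" using L_principal_le[OF s1] by simp
    also have "\<dots> \<le> 2 / \<eta>" using \<eta>_pos \<eta>_le_1 by (simp add: field_simps)
    finally show ?thesis unfolding l_def using L_nonzero[OF s1, of 0] \<eta>_pos by (subst ln_le_cancel_iff) auto
  qed
  moreover have "ln (1 / (2 * (s - 1))) \<le> l s 0"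
    unfolding l_def using L_principal_ge[OF s(1)] L_nonzero[OF s(1), of 0] s by (subst ln_le_cancel_iff) auto
  moreover have "log_L (1 + \<eta>) \<ge> 0" by (rule log_L_nonneg[OF s1])
  moreover have "ln (2 / \<eta>) = ln 2 + ln (1 / \<eta>)" using \<eta>_pos by (simp add: ln_div)
  moreover have "ln (1 / (2 * (s - 1))) = ln (1 / (s - 1)) - ln 2"
  proof -
    have "1 / (2 * (s - 1)) = (1 / (s - 1)) / 2" by simp
    moreover have "ln (t / 2) = ln t - ln 2" if "t > 0" for t :: real using that by (simp add: ln_div)
    ultimately show ?thesis using s by (metis diff_gt_0_iff_gt zero_less_divide_1_iff)
  qed
  ultimately show ?thesis using split[of s] split[of "1 + \<eta>"] by linarith
qed

text \<open>
  Evaluating \<open>log_L\<close> at \<open>s = 1 + 1 / sqrt (ln X)\<close> makes the contribution of the primes above \<open>X\<close>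
  bounded while \<open>ln (1 / (s - 1))\<close> is half of \<open>ln (ln X)\<close>.
\<close>

lemma sum_inverse_primes_ge:
  assumes X: "X \<ge> 3"
  shows "(\<Sum>q\<in>{q\<in>primes_upto X. [q = 1] (mod p)}. 1 / real q) \<ge>
     (ln (ln (real X)) / 2 - 5 - 2 * real p * ln (real p)) / real (p - 1) - 8"
proof -
  define P where "P = (\<Sum>q\<in>{q\<in>primes_upto X. [q = 1] (mod p)}. 1 / real q)"
  have P: "P \<ge> 0" by (simp add: P_def sum_nonneg)
  have p: "real p \<ge> 2" using p_ge_2 by simp
  have lnp: "ln (real p) \<ge> 0" using p by simp
  have pm: "real (p - 1) \<ge> 1" using p_ge_2 by simp
  have "exp 1 \<le> real X" using exp_le X by (auto intro: order_trans[of _ 3])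
  then have lnX: "ln (real X) \<ge> 1" using X by (subst ln_ge_iff) auto
  define w where "w = sqrt (ln (real X))"
  have w: "w \<ge> 1" using lnX by (simp add: w_def)
  have lnw: "ln w = ln (ln (real X)) / 2" using lnX by (simp add: w_def ln_sqrt)
  \<comment> \<open>Here 1 / \<eta> = 128 p^(p+2), with ln 128 <= 5 and p + 2 <= 2 p.\<close>
  have ln\<eta>: "ln (1 / \<eta>) \<le> 5 + 2 * real p * ln (real p)"
  proof -
    have "ln (1 / \<eta>) = ln 128 + real (p + 2) * ln (real p)"
      using p by (simp add: \<eta>_def ln_mult ln_realpow algebra_simps)
    moreover have "ln (128 :: real) \<le> 5"
    proof -
      have "ln (128 :: real) = ln (2 ^ 7)" by simp
      also have "\<dots> = 7 * ln 2" by (subst ln_realpow) auto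
      also have "\<dots> \<le> 5" using ln2_le_25_over_36 by simp
      finally show ?thesis .
    qed
    moreover have "real (p + 2) * ln (real p) \<le> 2 * real p * ln (real p)"
      using p lnp by (intro mult_right_mono) auto
    ultimately show ?thesis by linarith
  qed
  show ?thesis unfolding P_def[symmetric]
  proof (cases "1 / w \<le> \<eta>")
    case True
    define s where "s = 1 + 1 / w"
    have s: "1 < s" "s \<le> 1 + \<eta>" using True w by (auto simp: s_def)
    \<comment> \<open>As ln X = w^2 and s - 1 = 1 / w, the tail equals w exp (-w).\<close>
    have tail: "real X powr (1 - s) / (s - 1) \<le> 1"
    proof -
      have "ln (real X) = w * w" using lnX by (simp add: w_def)
      then have "real X powr (1 - s) = exp (- w)" using X w by (simp add: s_def powr_def)
      then have "real X powr (1 - s) / (s - 1) = w / exp w" by (simp add: s_def exp_minus field_simps)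
      also have "\<dots> \<le> 1"
      proof -
        have "w \<le> exp w" using exp_ge_add_one_self[of w] by linarith
        then show ?thesis by (simp add: divide_le_eq)
      qed
      finally show ?thesis .
    qed
    have l2: "ln (2::real) \<le> 1" using ln2_le_25_over_36 by simp
    have "ln w - ln (1 / \<eta>) - real (p - 1) * ln 2 - 2 * ln 2 \<le> log_L s"
      using log_L_ge[OF s] w by (simp add: s_def)
    also have "\<dots> \<le> real (p - 1) * (P + real X powr (1 - s) / (s - 1) + 4)"
      unfolding P_def using X by (intro log_L_le s) auto
    also have "\<dots> \<le> real (p - 1) * (P + 5)" using tail by (intro mult_left_mono) auto
    finally have "ln w - ln (1 / \<eta>) \<le> real (p - 1) * (P + 5) + real (p - 1) * ln 2 + 2 * ln 2" by linarith
    also have "\<dots> \<le> real (p - 1) * (P + 5) + real (p - 1) * 1 + real (p - 1) * 2"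
      using l2 pm mult_left_mono[OF l2, of "real (p - 1)"] by linarith
    also have "\<dots> = real (p - 1) * (P + 8)" by (simp add: algebra_simps)
    finally have "ln w - 5 - 2 * real p * ln (real p) \<le> (P + 8) * real (p - 1)"
      using ln\<eta> by (simp add: mult.commute)
    then have "(ln w - 5 - 2 * real p * ln (real p)) / real (p - 1) \<le> P + 8"
      using pm by (subst pos_divide_le_eq) auto
    then show "P \<ge> (ln (ln (real X)) / 2 - 5 - 2 * real p * ln (real p)) / real (p - 1) - 8"
      by (simp add: lnw)
  next
    \<comment> \<open>Now X is small compared with p: the numerator of the claimed bound is at most
      0, while the sum is nonnegative.\<close>
    case False
    then have "w \<le> 1 / \<eta>" using w \<eta>_pos by (simp add: field_simps)
    then have "ln w \<le> ln (1 / \<eta>)" using w \<eta>_pos by (subst ln_le_cancel_iff) auto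
    then have "(ln w - 5 - 2 * real p * ln (real p)) / real (p - 1) \<le> 0"
      using ln\<eta> pm by (intro divide_nonpos_pos) auto
    then show "P \<ge> (ln (ln (real X)) / 2 - 5 - 2 * real p * ln (real p)) / real (p - 1) - 8"
      using P by (simp add: lnw)
  qed
qed

end

lemma sum_inverse_primes_1_mod_ge:
  assumes p: "prime p" and X: "X \<ge> 3"
  shows "(\<Sum>q\<in>{q\<in>primes_upto X. [q = 1] (mod p)}. 1 / real q) \<ge>
     (ln (ln (real X)) / 2 - 5 - 2 * real p * ln (real p)) / real (p - 1) - 8"
proof (rule exists_mod_characters[OF p])
  fix \<psi> :: "nat \<Rightarrow> nat \<Rightarrow> complex"
  assume *: "\<And>j. mod_character p (\<psi> j)"
    "\<And>j. 0 < j \<Longrightarrow> j < p - 1 \<Longrightarrow> nonprincipal_character p (\<psi> j)"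
    "\<And>n. \<psi> 0 n = (if p dvd n then 0 else 1)"
    "\<And>n. (\<Sum>j<p - 1. \<psi> j n) = (if [n = 1] (mod p) then of_nat (p - 1) else 0)"
    "\<And>j n. j < p - 1 \<Longrightarrow> 0 < j \<Longrightarrow> \<psi> (p - 1 - j) n = cnj (\<psi> j n)"
  interpret mod_character_group p \<psi>
    by (rule mod_character_group.intro[OF p *])
  show ?thesis by (rule sum_inverse_primes_ge[OF X])
qed

section \<open>Mertens' product theorem\<close>

lemma prod_primes_dvd:
  fixes n :: nat
  assumes "finite A" "\<And>p. p \<in> A \<Longrightarrow> prime p" "\<And>p. p \<in> A \<Longrightarrow> p dvd n"
  shows "\<Prod>A dvd n"
  using assms
proof (induction A rule: finite_induct)
  case (insert p A)
  have "coprime p (\<Prod>A)"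
    using insert by (intro prod_coprime_right) (metis insertCI primes_coprime)
  then show ?case using insert by (simp add: divides_mult)
qed simp

definition theta :: "nat \<Rightarrow> real" where
  "theta n = (\<Sum>p\<in>primes_upto n. ln (real p))"

text \<open>For n = 2m + 1 the primes in (m + 1, 2m + 1] divide the binomial coefficient of 2m + 1
  over m. It occurs twice in a row of sum 2^(2m+1), so it is at most 4^m. An even n > 2 adds no
  prime.\<close>

lemma theta_le: "theta n \<le> real n * ln 4"
proof (induction n rule: less_induct)
  case (less n)
  consider "n \<le> 1" | "n = 2" | "n > 2" "even n" | m where "n = 2 * m + 1" "m > 0"
    by (cases "n \<le> 1"; cases "n = 2"; cases "even n") (auto elim!: oddE)
  then show ?case
  proof cases
    case 1
    then have "primes_upto n = {}" by (auto simp: primes_upto_def dest: prime_gt_1_nat)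
    then show ?thesis by (simp add: theta_def)
  next
    case 2
    then have "primes_upto n = {2}" by (auto simp: primes_upto_def dest: prime_ge_2_nat)
    then have "theta n = ln 2" unfolding theta_def 2 by simp
    moreover have "ln (2::real) \<le> ln 4" "0 \<le> ln (4::real)" by simp_all
    ultimately show ?thesis unfolding 2 by linarith
  next
    case 3
    then have "\<not> prime n" using prime_odd_nat[of n] by auto
    then have "q \<le> n \<longleftrightarrow> q \<le> n - 1" if "prime q" for q using that 3 by (cases "q = n") auto
    then have "primes_upto n = primes_upto (n - 1)"
      unfolding primes_upto_def by blast
    then have "theta n = theta (n - 1)" by (simp add: theta_def)
    also have "\<dots> \<le> real (n - 1) * ln 4" using 3 by (intro less.IH) auto
    also have "\<dots> \<le> real n * ln 4" by (intro mult_right_mono) auto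
    finally show ?thesis .
  next
    case (4 m)
    define A where "A = {p. prime p \<and> m + 1 < p \<and> p \<le> 2 * m + 1}"
    have finA: "finite A" unfolding A_def by (rule finite_subset[of _ "{..2 * m + 1}"]) auto
    have "\<Prod>A dvd (2 * m + 1 choose m)"
    proof (rule prod_primes_dvd[OF finA])
      fix p assume "p \<in> A"
      then have p: "prime p" "m + 1 < p" "p \<le> 2 * m + 1" by (auto simp: A_def)
      then show "prime p" by simp
      have "fact m * fact (2 * m + 1 - m) * (2 * m + 1 choose m) = (fact (2 * m + 1) :: nat)"
        by (rule binomial_fact_lemma) simp
      moreover have "p dvd fact (2 * m + 1)" using p by (simp only: prime_dvd_fact_iff)
      ultimately have "p dvd fact m * fact (2 * m + 1 - m) * (2 * m + 1 choose m)" by simp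
      then have "p dvd fact m \<or> p dvd fact (2 * m + 1 - m) \<or> p dvd (2 * m + 1 choose m)"
        using p(1) by (simp only: prime_dvd_mult_iff) blast
      then show "p dvd (2 * m + 1 choose m)" using p by (simp only: prime_dvd_fact_iff) auto
    qed
    then have "\<Prod>A \<le> (2 * m + 1 choose m)" by (rule dvd_imp_le) (simp add: zero_less_binomial)
    also have "\<dots> \<le> 4 ^ m"
    proof -
      have "(2 * m + 1 choose m) = (2 * m + 1 choose (m + 1))"
        using binomial_symmetric[of m "2 * m + 1"] by simp
      then have "2 * (2 * m + 1 choose m) = (\<Sum>k\<in>{m, m + 1}. 2 * m + 1 choose k)" by simp
      also have "\<dots> \<le> (\<Sum>k\<le>2 * m + 1. 2 * m + 1 choose k)" by (rule sum_mono2) auto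
      also have "\<dots> = 2 ^ (2 * m + 1)" by (rule choose_row_sum)
      also have "\<dots> = 2 * 4 ^ m" by (simp add: power_mult)
      finally show ?thesis by simp
    qed
    finally have "real (\<Prod>A) \<le> 4 ^ m" by (metis of_nat_le_iff of_nat_numeral of_nat_power)
    moreover have "real (\<Prod>A) > 0" unfolding of_nat_prod by (rule prod_pos) (auto simp: A_def prime_gt_0_nat)
    ultimately have "ln (real (\<Prod>A)) \<le> ln (4 ^ m)" by (subst ln_le_cancel_iff) auto
    also have "ln (real (\<Prod>A)) = (\<Sum>p\<in>A. ln (real p))"
      unfolding of_nat_prod by (rule ln_prod) (auto simp: A_def prime_gt_0_nat)
    finally have A: "(\<Sum>p\<in>A. ln (real p)) \<le> real m * ln 4" by (simp add: ln_realpow)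
    have "primes_upto n = primes_upto (m + 1) \<union> A" "primes_upto (m + 1) \<inter> A = {}"
      using 4 by (auto simp: primes_upto_def A_def)
    then have "theta n = theta (m + 1) + (\<Sum>p\<in>A. ln (real p))"
      unfolding theta_def using finA by (simp add: sum.union_disjoint)
    also have "\<dots> \<le> real (m + 1) * ln 4 + real m * ln 4"
      using A less.IH[of "m + 1"] 4 by (intro add_mono) auto
    also have "\<dots> = real n * ln 4" using 4 by (simp add: algebra_simps)
    finally show ?thesis .
  qed
qed

text \<open>From n to n + 1 the quotient by d grows, by 1, exactly for the divisors d of n + 1, and
  over these \<open>mangoldt\<close> sums to ln (n + 1).\<close>

lemma ln_fact_mangoldt: "ln (fact n) = (\<Sum>d=1..n. mangoldt d * real (n div d))"
proof (induction n)
  case (Suc n)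
  have div: "Suc n div d = n div d + (if d dvd Suc n then 1 else 0)" if "d > 0" for d
    using div_Suc[of n d] by (auto simp: dvd_eq_mod_eq_0)
  have "(\<Sum>d=1..Suc n. mangoldt d * real (Suc n div d))
      = (\<Sum>d=1..Suc n. mangoldt d * real (n div d) + (if d dvd Suc n then mangoldt d else 0))"
    by (intro sum.cong refl) (simp add: div algebra_simps)
  also have "\<dots> = (\<Sum>d=1..Suc n. mangoldt d * real (n div d)) + (\<Sum>d=1..Suc n. if d dvd Suc n then mangoldt d else 0)"
    by (rule sum.distrib)
  also have "(\<Sum>d=1..Suc n. mangoldt d * real (n div d)) = (\<Sum>d=1..n. mangoldt d * real (n div d))"
    by simp
  also have "(\<Sum>d=1..Suc n. if d dvd Suc n then mangoldt d else 0) = (\<Sum>d\<in>{d\<in>{1..Suc n}. d dvd Suc n}. mangoldt d)"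
    by (rule sum.inter_filter[symmetric]) simp
  also have "{d\<in>{1..Suc n}. d dvd Suc n} = {d. d dvd Suc n}"
    by (auto simp: dvd_imp_le Suc_le_eq intro!: Nat.gr0I)
  also have "(\<Sum>d | d dvd Suc n. mangoldt d) = ln (real (Suc n))"
    using mangoldt_sum[of "Suc n", where 'a = real] by simp
  finally show ?case using Suc by (simp add: ln_mult del: of_nat_Suc)
qed simp

text \<open>Upper half of Mertens' first theorem: ln n! <= n ln n bounds the sum of the ln p times
  \<open>n div p\<close>, and replacing n / p by its integer part costs ln p per prime, in total at
  most \<open>theta n\<close>.\<close>

lemma sum_ln_primes_over_le:
  assumes "n > 0"
  shows "(\<Sum>p\<in>primes_upto n. ln (real p) / real p) \<le> ln (real n) + ln 4"
proof -
  have "real n * (\<Sum>p\<in>primes_upto n. ln (real p) / real p) = (\<Sum>p\<in>primes_upto n. ln (real p) * (real n / real p))"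
    by (simp add: sum_distrib_left mult_ac)
  also have "\<dots> \<le> (\<Sum>p\<in>primes_upto n. ln (real p) * (real (n div p) + 1))"
  proof (intro sum_mono mult_left_mono)
    fix p assume p: "p \<in> primes_upto n"
    have p0: "real p > 0" using p by (auto simp: primes_upto_def prime_gt_0_nat)
    have "real n = real (n div p) * real p + real (n mod p)"
      by (metis of_nat_add of_nat_mult div_mult_mod_eq)
    moreover have "real (n mod p) \<le> real p" using p0 by (simp add: less_imp_le)
    ultimately have "real n \<le> (real (n div p) + 1) * real p" by (simp add: algebra_simps)
    then show "real n / real p \<le> real (n div p) + 1" using p0 by (simp add: pos_divide_le_eq)
    show "0 \<le> ln (real p)" using p by (auto simp: primes_upto_def dest: prime_ge_1_nat)
  qed
  also have "\<dots> = (\<Sum>p\<in>primes_upto n. mangoldt p * real (n div p)) + theta n"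
    by (simp add: theta_def algebra_simps sum.distrib primes_upto_def)
  also have "(\<Sum>p\<in>primes_upto n. mangoldt p * real (n div p)) \<le> (\<Sum>d=1..n. mangoldt d * real (n div d))"
    by (rule sum_mono2) (auto simp: primes_upto_def mangoldt_nonneg dest: prime_ge_1_nat)
  also have "\<dots> = ln (fact n)" by (rule ln_fact_mangoldt[symmetric])
  also have "ln (fact n) \<le> ln (real n ^ n)"
    using assms fact_le_power[of n, where 'a = real] by (subst ln_le_cancel_iff) auto
  also have "\<dots> = real n * ln (real n)" using assms by (simp add: ln_realpow)
  finally have "real n * (\<Sum>p\<in>primes_upto n. ln (real p) / real p) \<le> real n * (ln (real n) + ln 4)"
    using theta_le[of n] by (simp add: algebra_simps)
  then show ?thesis using assms by simp
qed

lemma ln_fact_ge: "n > 0 \<Longrightarrow> real n * ln (real n) - real n \<le> ln (fact n)"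
proof (induction n rule: nat_induct_non_zero)
  case (Suc n)
  have "1 + 1 / real n = real (Suc n) / real n" using Suc.hyps by (simp add: field_simps)
  then have "ln (real (Suc n)) - ln (real n) = ln (1 + 1 / real n)"
    using Suc.hyps by (simp add: ln_div del: of_nat_Suc)
  also have "\<dots> \<le> 1 / real n" using Suc.hyps by (intro ln_add_one_self_le_self) auto
  finally have "real n * (ln (real (Suc n)) - ln (real n)) \<le> 1"
    using Suc.hyps by (simp add: pos_le_divide_eq mult.commute)
  then have "real (Suc n) * ln (real (Suc n)) - real (Suc n) \<le> ln (real (Suc n)) + (real n * ln (real n) - real n)"
    by (simp add: algebra_simps)
  also have "\<dots> \<le> ln (real (Suc n)) + ln (fact n)" using Suc.IH by simp
  also have "\<dots> = ln (fact (Suc n))" by (simp add: ln_mult del: of_nat_Suc)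
  finally show ?case .
qed simp

text \<open>The exponents k >= 2 of a prime q contribute at most 2 (ln q) / q^2, and ln q <= 2 sqrt
  q turns this into 4 q^(-3/2), which is summable independently of n.\<close>

lemma sum_mangoldt_proper_prime_powers_le:
  "(\<Sum>d\<in>{d\<in>{1..n}. primepow d \<and> \<not> prime d}. mangoldt d / real d) \<le> (\<Sum>n. 4 * real n powr - (3 / 2))"
proof -
  define Q where "Q = {d\<in>{1..n}. primepow d \<and> \<not> prime d}"
  define S where "S = primes_upto n \<times> {2..n}"
  define f where "f = (\<lambda>(q::nat, k::nat). q ^ k)"
  have summ: "summable (\<lambda>n. 4 * real n powr - (3 / 2))" by (intro summable_mult summable_powr) simp
  have "Q \<subseteq> f ` S"
  proof
    fix d assume "d \<in> Q"
    then have d: "d \<le> n" "primepow d" "\<not> prime d" by (auto simp: Q_def)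
    then obtain q k where qk: "prime q" "k > 0" "d = q ^ k" by (auto simp: primepow_def)
    have "k \<noteq> 1" using d qk by auto
    then have k2: "k \<ge> 2" using qk by simp
    have "k < 2 ^ k" by (rule less_exp)
    also have "2 ^ k \<le> q ^ k" using prime_ge_2_nat[OF qk(1)] by (intro power_mono) auto
    finally have "k \<le> n" using qk d by simp
    moreover have "q ^ 1 \<le> q ^ k" using qk prime_ge_1_nat[OF qk(1)] by (intro power_increasing) auto
    then have "q \<le> n" using qk d by simp
    ultimately show "d \<in> f ` S" using qk k2 by (auto simp: f_def S_def primes_upto_def intro!: image_eqI[of _ _ "(q, k)"])
  qed
  then have "(\<Sum>d\<in>Q. mangoldt d / real d) \<le> (\<Sum>d\<in>f ` S. mangoldt d / real d)"
    by (intro sum_mono2) (auto simp: S_def mangoldt_nonneg)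
  also have "\<dots> \<le> (\<Sum>x\<in>S. ((\<lambda>d. mangoldt d / real d) \<circ> f) x)"
    by (rule sum_image_le) (auto simp: S_def mangoldt_nonneg)
  also have "\<dots> = (\<Sum>q\<in>primes_upto n. \<Sum>k=2..n. ln (real q) * (1 / real q) ^ k)"
    unfolding S_def sum.cartesian_product
    by (intro sum.cong refl) (auto simp: f_def primes_upto_def power_divide)
  also have "\<dots> \<le> (\<Sum>q\<in>primes_upto n. 4 * real q powr - (3 / 2))"
  proof (rule sum_mono)
    fix q assume "q \<in> primes_upto n"
    then have q: "prime q" "q \<le> n" by (auto simp: primes_upto_def)
    have q2: "real q \<ge> 2" using prime_ge_2_nat[OF q(1)] by simp
    define x where "x = 1 / real q"
    have x: "0 < x" "x \<le> 1 / 2" using q2 by (auto simp: x_def field_simps)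
    have n2: "n \<ge> 2" using q prime_ge_2_nat[OF q(1)] by simp
    have "(\<Sum>k=2..n. x ^ k) = (x ^ 2 - x ^ Suc n) / (1 - x)"
      by (subst sum_gp) (use x n2 in auto)
    also have "\<dots> \<le> x ^ 2 / (1 / 2)" using x by (intro frac_le) auto
    finally have 1: "(\<Sum>k=2..n. x ^ k) \<le> 2 * x ^ 2" by simp
    have "ln (sqrt (real q)) \<le> sqrt (real q)" using q2 ln_bound[of "sqrt (real q)"] by simp
    then have 2: "ln (real q) \<le> 2 * sqrt (real q)" using q2 by (simp add: ln_sqrt)
    have "(\<Sum>k=2..n. ln (real q) * (1 / real q) ^ k) = ln (real q) * (\<Sum>k=2..n. x ^ k)"
      by (simp add: x_def sum_distrib_left)
    also have "\<dots> \<le> (2 * sqrt (real q)) * (2 * x ^ 2)"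
      using 1 2 q2 x by (intro mult_mono sum_nonneg) auto
    also have "\<dots> = 4 * real q powr - (3 / 2)"
    proof -
      have "real q powr (1 / 2 + - 2) = sqrt (real q) * (1 / real q ^ 2)"
        unfolding powr_add using q2 by (simp add: powr_half_sqrt powr_minus inverse_eq_divide)
      then show ?thesis by (simp add: x_def power_divide)
    qed
    finally show "(\<Sum>k=2..n. ln (real q) * (1 / real q) ^ k) \<le> 4 * real q powr - (3 / 2)" .
  qed
  also have "\<dots> \<le> (\<Sum>n. 4 * real n powr - (3 / 2))" by (rule sum_le_suminf[OF summ]) auto
  finally show ?thesis by (simp add: Q_def)
qed

text \<open>Lower half of Mertens' first theorem: the lower bound for ln n! from
  \<open>ln_fact_ge\<close>, with the proper prime powers moved into the constant.\<close>

lemma sum_ln_primes_over_ge: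
  obtains K where "\<And>n. n > 0 \<Longrightarrow> ln (real n) - K \<le> (\<Sum>p\<in>primes_upto n. ln (real p) / real p)"
proof -
  define K where "K = 1 + (\<Sum>n. 4 * real n powr - (3 / 2))"
  have "ln (real n) - K \<le> (\<Sum>p\<in>primes_upto n. ln (real p) / real p)" if n: "n > 0" for n
  proof -
    define Q where "Q = {d\<in>{1..n}. primepow d \<and> \<not> prime d}"
    have "real n * ln (real n) - real n \<le> ln (fact n)" using n by (rule ln_fact_ge)
    also have "\<dots> = (\<Sum>d=1..n. mangoldt d * real (n div d))" by (rule ln_fact_mangoldt)
    also have "\<dots> \<le> (\<Sum>d=1..n. mangoldt d * (real n / real d))"
      by (intro sum_mono mult_left_mono of_nat_div_le_of_nat mangoldt_nonneg)
    also have "\<dots> = (\<Sum>d\<in>primes_upto n \<union> Q. mangoldt d * (real n / real d))"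
      by (rule sum.mono_neutral_right) (auto simp: primes_upto_def Q_def mangoldt_def dest: prime_ge_1_nat)
    also have "\<dots> = (\<Sum>d\<in>primes_upto n. mangoldt d * (real n / real d)) + (\<Sum>d\<in>Q. mangoldt d * (real n / real d))"
      by (rule sum.union_disjoint) (auto simp: Q_def primes_upto_def)
    also have "(\<Sum>d\<in>primes_upto n. mangoldt d * (real n / real d)) = real n * (\<Sum>p\<in>primes_upto n. ln (real p) / real p)"
      by (simp add: sum_distrib_left primes_upto_def mult_ac)
    also have "(\<Sum>d\<in>Q. mangoldt d * (real n / real d)) = real n * (\<Sum>d\<in>Q. mangoldt d / real d)"
      by (simp add: sum_distrib_left mult_ac)
    also have "\<dots> \<le> real n * (\<Sum>n. 4 * real n powr - (3 / 2))"
      unfolding Q_def by (intro mult_left_mono sum_mangoldt_proper_prime_powers_le) auto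
    finally have "real n * (ln (real n) - K) \<le> real n * (\<Sum>p\<in>primes_upto n. ln (real p) / real p)"
      by (simp add: K_def algebra_simps)
    then show ?thesis using n by simp
  qed
  then show thesis by (rule that)
qed

section \<open>The sum of prime reciprocals and its constant\<close>

text \<open>The weights (1 - z) z^k have total mass 1 and, as z tends to 1, leave every finite set
  of indices.\<close>

lemma abel_mean:
  fixes D :: "nat \<Rightarrow> real"
  assumes D: "D \<longlonglongrightarrow> l"
  shows "((\<lambda>z. (1 - z) * (\<Sum>k. D k * z ^ k)) \<longlongrightarrow> l) (at_left 1)"
proof (rule tendstoI)
  fix e :: real assume e: "e > 0"
  obtain N where N: "\<And>k. k \<ge> N \<Longrightarrow> \<bar>D k - l\<bar> \<le> e / 2"
    using D e unfolding LIMSEQ_iff by (metis half_gt_zero less_imp_le real_norm_def)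
  define A where "A = (\<Sum>k<N. \<bar>D k - l\<bar>)"
  have A: "A \<ge> 0" by (simp add: A_def sum_nonneg)
  have "Bseq (\<lambda>k. D k - l)" by (rule convergent_imp_Bseq[OF convergentI[OF LIM_zero[OF D]]])
  then obtain B where B: "\<And>k. \<bar>D k - l\<bar> \<le> B" by (auto simp: Bseq_def)
  have main: "\<bar>(1 - z) * (\<Sum>k. D k * z ^ k) - l\<bar> \<le> (1 - z) * A + e / 2" if z: "0 < z" "z < 1" for z
  proof -
    have geo: "(\<lambda>k. z ^ k) sums (1 / (1 - z))" using geometric_sums[of z] z by simp
    have s: "summable (\<lambda>k. \<bar>D k - l\<bar> * z ^ k)"
      by (rule summable_comparison_test'[OF summable_mult[OF sums_summable[OF geo], of B], of 0])
         (use B z in \<open>auto intro!: mult_right_mono\<close>)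
    then have s': "summable (\<lambda>k. (D k - l) * z ^ k)"
      using z by (intro summable_rabs_cancel[of "\<lambda>k. (D k - l) * z ^ k"]) (simp only: abs_mult power_abs abs_of_pos)
    have sl: "(\<lambda>k. l * z ^ k) sums (l / (1 - z))" using sums_mult[OF geo, of l] by simp
    have "(\<Sum>k. D k * z ^ k) = (\<Sum>k. (D k - l) * z ^ k + l * z ^ k)" by (simp add: algebra_simps)
    also have "\<dots> = (\<Sum>k. (D k - l) * z ^ k) + l / (1 - z)"
      using suminf_add[OF s' sums_summable[OF sl]] sl by (simp add: sums_iff)
    finally have "(1 - z) * (\<Sum>k. D k * z ^ k) - l = (1 - z) * (\<Sum>k. (D k - l) * z ^ k)"
      using z by (simp add: field_simps)
    then have "\<bar>(1 - z) * (\<Sum>k. D k * z ^ k) - l\<bar> = (1 - z) * \<bar>\<Sum>k. (D k - l) * z ^ k\<bar>"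
      using z by (simp add: abs_mult)
    moreover have "\<bar>\<Sum>k. (D k - l) * z ^ k\<bar> \<le> (\<Sum>k. \<bar>D k - l\<bar> * z ^ k)"
      using summable_rabs[of "\<lambda>k. (D k - l) * z ^ k"] s z by (simp add: abs_mult)
    moreover have "\<dots> \<le> (\<Sum>k. (if k < N then \<bar>D k - l\<bar> else 0) + e / 2 * z ^ k)"
    proof (rule suminf_le[OF _ s])
      fix k show "\<bar>D k - l\<bar> * z ^ k \<le> (if k < N then \<bar>D k - l\<bar> else 0) + e / 2 * z ^ k"
      proof (cases "k < N")
        case True
        have "\<bar>D k - l\<bar> * z ^ k \<le> \<bar>D k - l\<bar> * 1"
          using z by (intro mult_left_mono power_le_one) auto
        then show ?thesis using True e z by (simp add: add_increasing2)
      next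
        case False
        then show ?thesis using N[of k] z by (auto intro!: mult_right_mono)
      qed
      show "summable (\<lambda>k. (if k < N then \<bar>D k - l\<bar> else 0) + e / 2 * z ^ k)"
        by (intro summable_add summable_mult sums_summable[OF geo] summable_If_finite) simp
    qed
    moreover have "\<dots> = A + e / 2 * (1 / (1 - z))"
    proof -
      have "(\<lambda>k. if k < N then \<bar>D k - l\<bar> else 0) sums A"
        using sums_If_finite_set[of "{..<N}" "\<lambda>k. \<bar>D k - l\<bar>"] by (simp add: A_def)
      from sums_add[OF this sums_mult[OF geo, of "e / 2"]] show ?thesis by (simp add: sums_iff)
    qed
    ultimately have "\<bar>(1 - z) * (\<Sum>k. D k * z ^ k) - l\<bar> \<le> (1 - z) * (A + e / 2 * (1 / (1 - z)))"
      using z by (simp only:) (intro mult_left_mono, auto)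
    also have "\<dots> = (1 - z) * A + e / 2"
    proof -
      have "(1 - z) * (1 / (1 - z)) = 1" using z by simp
      then have "(1 - z) * (e / 2 * (1 / (1 - z))) = e / 2" by (metis mult.left_commute mult.right_neutral)
      then show ?thesis by (simp only: distrib_left)
    qed
    finally show ?thesis .
  qed
  have "((\<lambda>z. (1 - z) * A + e / 2) \<longlongrightarrow> (1 - 1) * A + e / 2) (at_left 1)"
    by (intro tendsto_intros)
  then have "eventually (\<lambda>z. (1 - z) * A + e / 2 < e) (at_left 1)"
    by (rule order_tendstoD(2)) (use e in simp)
  moreover have "eventually (\<lambda>z::real. z \<in> {0<..<1}) (at_left 1)"
    by (rule eventually_at_left_real) simp
  ultimately show "eventually (\<lambda>z. dist ((1 - z) * (\<Sum>k. D k * z ^ k)) l < e) (at_left 1)"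
  proof eventually_elim
    case (elim z)
    then show ?case using main[of z] by (simp add: dist_real_def)
  qed
qed

text \<open>By Mertens' first theorem the sums of (ln p) / p minus the increments of ln n stay
  bounded, so the weights 1 / ln n, which decrease to 0, make the series converge. The increments of
  ln n times these weights differ from those of ln ln n by another convergent series.\<close>

lemma sum_inverse_primes_minus_lnln_convergent:
  "convergent (\<lambda>N. (\<Sum>p\<in>primes_upto N. 1 / real p) - ln (ln (real N)))"
proof -
  define a where "a n = (if prime n then ln (real n) / real n else 0)" for n
  define d where "d n = ln (real (n + 2)) - ln (real (n + 1))" for n
  define c where "c n = a (n + 2) - d n" for n
  define w where "w n = 1 / ln (real (n + 2))" for n :: nat
  have lnpos: "ln (real (n + 2)) > 0" for n by simp
  have sum_a: "(\<Sum>n<N. a (n + 2)) = (\<Sum>p\<in>primes_upto (N + 1). ln (real p) / real p)" for N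
  proof -
    have "(\<Sum>n<N. a (n + 2)) = (\<Sum>n\<in>{2..<N + 2}. a n)"
      by (rule sum.reindex_bij_witness[of _ "\<lambda>n. n - 2" "\<lambda>n. n + 2"]) auto
    also have "\<dots> = (\<Sum>n\<in>{n\<in>{2..<N + 2}. prime n}. ln (real n) / real n)"
      unfolding a_def by (rule sum.inter_filter[symmetric]) simp
    also have "{n\<in>{2..<N + 2}. prime n} = primes_upto (N + 1)"
      by (auto simp: primes_upto_def prime_ge_2_nat)
    finally show ?thesis .
  qed
  have sum_d: "(\<Sum>n<N. d n) = ln (real (N + 1))" for N
    by (induction N) (auto simp: d_def)
  obtain K where K: "\<And>n. n > 0 \<Longrightarrow> ln (real n) - K \<le> (\<Sum>p\<in>primes_upto n. ln (real p) / real p)"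
    by (rule sum_ln_primes_over_ge) blast
  have bd: "norm (\<Sum>n<N. c n) \<le> \<bar>K\<bar> + ln 4" for N
  proof -
    have "(\<Sum>n<N. c n) = (\<Sum>p\<in>primes_upto (N + 1). ln (real p) / real p) - ln (real (N + 1))"
      unfolding c_def sum_subtractf sum_a sum_d ..
    moreover have "ln (4::real) \<ge> 0" by simp
    ultimately show ?thesis
      using K[of "N + 1"] sum_ln_primes_over_le[of "N + 1"] unfolding real_norm_def abs_le_iff by linarith
  qed
  have "w (Suc n) \<le> w n" for n
    unfolding w_def by (intro divide_left_mono mult_pos_pos) auto
  then have wdiff: "\<bar>w n - w (Suc n)\<bar> \<le> w n - w (Suc n)" for n by simp
  have wlim: "w \<longlonglongrightarrow> 0" unfolding w_def by real_asymp
  have "summable (\<lambda>n. w n *\<^sub>R c n)" by (rule bounded_variation_series(1)[OF bd wdiff wlim wlim])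
  then have conv1: "convergent (\<lambda>N. \<Sum>n<N. w n * c n)" by (simp add: summable_iff_convergent)
  define g where "g n = ln (ln (real (n + 3))) - ln (ln (real (n + 2)))" for n :: nat
  \<comment> \<open>\<open>g n\<close> lies between 1 - x / y, which is
    \<open>w (n + 1) * d (n + 1)\<close>, and y / x - 1. The gap (y - x)^2 / (x y) is at most 1 / x
    - 1 / y because y - x <= 1.\<close>
  have "summable (\<lambda>n. g n - w (n + 1) * d (n + 1))"
  proof (rule summable_comparison_test'[where N = 0])
    show "summable (\<lambda>n. w n - w (Suc n))" by (rule telescope_summable'[OF wlim])
    fix n
    define x where "x = ln (real (n + 2))"
    define y where "y = ln (real (n + 3))"
    have x: "x > 0" "x \<le> y" by (auto simp: x_def y_def)
    have e: "g n = ln y - ln x" "w n = 1 / x" "w (Suc n) = 1 / y" "w (n + 1) = 1 / y" "d (n + 1) = y - x"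
      by (simp_all add: g_def w_def d_def x_def y_def add.commute)
    have "ln (y / x) = ln y - ln x" using x by (simp add: ln_div)
    moreover have "ln (y / x) \<le> y / x - 1" using x by (intro ln_le_minus_one) auto
    moreover have "ln (x / y) \<le> x / y - 1" using x by (intro ln_le_minus_one) auto
    moreover have "ln (x / y) = ln x - ln y" using x by (simp add: ln_div)
    ultimately have b: "1 - x / y \<le> ln y - ln x" "ln y - ln x \<le> y / x - 1" by auto
    have y1: "y - x \<le> 1"
    proof -
      have "y - x = ln (real (n + 3) / real (n + 2))" by (simp add: x_def y_def ln_div)
      also have "\<dots> \<le> real (n + 3) / real (n + 2) - 1" by (intro ln_le_minus_one) auto
      also have "\<dots> \<le> 1" by (simp add: field_simps)
      finally show ?thesis .
    qed
    have "1 / y * (y - x) = 1 - x / y" using x by (simp add: right_diff_distrib)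
    moreover have "y / x - 1 - (1 - x / y) = (y - x) * (y - x) * (1 / x) * (1 / y)"
      using x by (simp add: field_simps)
    moreover have "(y - x) * (y - x) * (1 / x) * (1 / y) \<le> 1 * (y - x) * (1 / x) * (1 / y)"
      using x y1 by (intro mult_right_mono) auto
    moreover have "1 * (y - x) * (1 / x) * (1 / y) = 1 / x - 1 / y" using x by (simp add: field_simps)
    ultimately show "norm (g n - w (n + 1) * d (n + 1)) \<le> w n - w (Suc n)"
      using b unfolding e real_norm_def abs_le_iff by linarith
  qed
  then have conv2: "convergent (\<lambda>N. \<Sum>n<N. g n - w (n + 1) * d (n + 1))" by (simp add: summable_iff_convergent)
  have sum_g: "(\<Sum>n<N. g n) = ln (ln (real (N + 2))) - ln (ln 2)" for N
    by (induction N) (auto simp: g_def numeral_eq_Suc)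
  have sum_w: "(\<Sum>n<N. w n * c n) + (\<Sum>n<N. w n * d n) = (\<Sum>p\<in>primes_upto (N + 1). 1 / real p)" for N
  proof -
    have "(\<Sum>n<N. w n * c n) + (\<Sum>n<N. w n * d n) = (\<Sum>n<N. w n * a (n + 2))"
      by (simp add: c_def sum.distrib[symmetric] algebra_simps)
    also have "\<dots> = (\<Sum>n<N. if prime (n + 2) then 1 / real (n + 2) else 0)"
      using lnpos by (intro sum.cong refl) (auto simp: w_def a_def)
    also have "\<dots> = (\<Sum>n\<in>{2..<N + 2}. if prime n then 1 / real n else 0)"
      by (rule sum.reindex_bij_witness[of _ "\<lambda>n. n - 2" "\<lambda>n. n + 2"]) auto
    also have "\<dots> = (\<Sum>n\<in>{n\<in>{2..<N + 2}. prime n}. 1 / real n)"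
      by (rule sum.inter_filter[symmetric]) simp
    also have "{n\<in>{2..<N + 2}. prime n} = primes_upto (N + 1)"
      by (auto simp: primes_upto_def prime_ge_2_nat)
    finally show ?thesis .
  qed
  have eq: "(\<Sum>p\<in>primes_upto (N + 2). 1 / real p) - ln (ln (real (N + 2)))
      = (\<Sum>n<Suc N. w n * c n) - (\<Sum>n<N. g n - w (n + 1) * d (n + 1)) + (w 0 * d 0 - ln (ln 2))" for N
  proof -
    have "(\<Sum>n<Suc N. w n * d n) = w 0 * d 0 + (\<Sum>n<N. w (n + 1) * d (n + 1))"
      by (simp add: sum.lessThan_Suc_shift del: sum.lessThan_Suc)
    then show ?thesis using sum_w[of "Suc N"] sum_g[of N] by (simp add: sum_subtractf)
  qed
  have "convergent (\<lambda>N. \<Sum>n<Suc N. w n * c n)" using conv1 by (subst convergent_Suc_iff)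
  then have "convergent (\<lambda>N. (\<Sum>n<Suc N. w n * c n) - (\<Sum>n<N. g n - w (n + 1) * d (n + 1)) + (w 0 * d 0 - ln (ln 2)))"
    by (intro convergent_add convergent_diff conv2 convergent_const)
  then have "convergent (\<lambda>N. (\<Sum>p\<in>primes_upto (N + 2). 1 / real p) - ln (ln (real (N + 2))))"
    unfolding eq .
  then show ?thesis
    using convergent_ignore_initial_segment[of "\<lambda>N. (\<Sum>p\<in>primes_upto N. 1 / real p) - ln (ln (real N))" 2] by simp
qed

text \<open>The terms of order at least 2 in the logarithmic series of an Euler factor.\<close>

definition ln_excess :: "real \<Rightarrow> real" where
  "ln_excess t = - ln (1 - t) - t"

lemma
  assumes "0 \<le> t" "t \<le> 1 / 2"
  shows ln_excess_nonneg: "0 \<le> ln_excess t" and ln_excess_le: "ln_excess t \<le> 2 * t ^ 2"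
proof -
  show "0 \<le> ln_excess t" using ln_le_minus_one[of "1 - t"] assms by (simp add: ln_excess_def)
  have "norm (1 - complex_of_real t) = norm (complex_of_real (1 - t))" by simp
  also have "\<dots> = 1 - t" unfolding norm_of_real using assms by simp
  finally show "ln_excess t \<le> 2 * t ^ 2"
    using neg_ln_norm_one_minus_le[of "complex_of_real t"] assms by (simp add: ln_excess_def)
qed

definition prime_excess :: "real \<Rightarrow> nat \<Rightarrow> real" where
  "prime_excess s n = (if prime n then ln_excess (real n powr - s) else 0)"

lemma prime_excess_bounds:
  assumes "s \<ge> 1"
  shows "0 \<le> prime_excess s n" "prime_excess s n \<le> 2 * real n powr - 2"
proof -
  have "0 \<le> prime_excess s n \<and> prime_excess s n \<le> 2 * real n powr - 2"
  proof (cases "prime n")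
    case True
    have n: "real n \<ge> 2" using prime_ge_2_nat[OF True] by simp
    define t where "t = real n powr - s"
    have "t \<le> real n powr - 1" unfolding t_def using n assms by (intro powr_mono) auto
    then have t1: "t \<le> 1 / real n" using n by (simp add: powr_minus inverse_eq_divide)
    also have "\<dots> \<le> 1 / 2" using n by (intro divide_left_mono) auto
    finally have t: "0 \<le> t" "t \<le> 1 / 2" by (auto simp: t_def)
    have "t ^ 2 \<le> (1 / real n) ^ 2" using t1 t by (intro power_mono) auto
    also have "\<dots> = real n powr - 2" using n by (simp add: powr_minus inverse_eq_divide power_divide)
    finally show ?thesis
      using ln_excess_nonneg[OF t] ln_excess_le[OF t] True by (simp add: prime_excess_def t_def)
  qed (simp add: prime_excess_def)
  then show "0 \<le> prime_excess s n" "prime_excess s n \<le> 2 * real n powr - 2" by auto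
qed

text \<open>Tannery's theorem, with the majorant 2 n^(-2) uniform in s >= 1.\<close>

lemma prime_excess_limit:
  "((\<lambda>s. \<Sum>n. prime_excess s n) \<longlongrightarrow> (\<Sum>n. prime_excess 1 n)) (at_right 1)"
proof -
  have lim: "((\<lambda>s. prime_excess s n) \<longlongrightarrow> prime_excess 1 n) (at_right 1)" for n
  proof (cases "prime n")
    case True
    have n: "real n \<ge> 2" using prime_ge_2_nat[OF True] by simp
    have "((\<lambda>s. ln_excess (real n powr - s)) \<longlongrightarrow> ln_excess (real n powr - 1)) (at_right 1)"
      unfolding ln_excess_def using n
      by (intro tendsto_intros) (auto simp: powr_minus field_simps)
    then show ?thesis using True by (simp add: prime_excess_def)
  qed (simp add: prime_excess_def)
  have ev: "eventually (\<lambda>(k, s). norm (prime_excess s k) \<le> 2 * real k powr - 2) (at_top \<times>\<^sub>F at_right 1)"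
  proof -
    have "eventually (\<lambda>s::real. s > 1) (at_right 1)" by (rule eventually_at_right_less)
    then show ?thesis unfolding eventually_prod_filter
      by (intro exI[of _ "\<lambda>_. True"] exI[of _ "\<lambda>s. s > 1"]) (use prime_excess_bounds in auto)
  qed
  have "summable (\<lambda>n. 2 * real n powr - 2)" by (intro summable_mult summable_powr) simp
  from tannerys_theorem[OF lim ev this] show ?thesis by simp
qed

lemma prime_zeta_sums:
  assumes s: "s > 1"
  shows "(\<lambda>N. \<Sum>p\<in>primes_upto N. real p powr - s) \<longlonglongrightarrow> ln (\<Sum>n. real n powr - s) - (\<Sum>n. prime_excess s n)"
proof -
  have "(\<lambda>N. \<Sum>q\<in>primes_upto N. - ln (norm (1 - real q powr - s))) \<longlonglongrightarrow> ln (norm (\<Sum>n. real n powr - s))"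
  proof (rule ln_euler_product(2)[of "\<lambda>n. real n powr - s"])
    show "real (m * n) powr - s = real m powr - s * real n powr - s" for m n by (simp add: powr_mult)
    show "summable (\<lambda>n. norm (real n powr - s))" using summable_powr[OF s] by simp
    show "norm (real q powr - s) < 1" if "prime q" for q
    proof -
      have "real q powr - s < real q powr 0"
        using s prime_gt_1_nat[OF that] by (intro powr_less_mono) auto
      then show ?thesis using prime_gt_0_nat[OF that] by simp
    qed
  qed auto
  moreover have "(\<lambda>N. \<Sum>n<Suc N. prime_excess s n) \<longlonglongrightarrow> (\<Sum>n. prime_excess s n)"
  proof -
    have "summable (prime_excess s)"
    proof (rule summable_comparison_test'[where N = 0])
      show "summable (\<lambda>n. 2 * real n powr - 2)" by (intro summable_mult summable_powr) simp
    qed (use prime_excess_bounds[of s] s in auto)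
    from LIMSEQ_Suc[OF summable_LIMSEQ[OF this]] show ?thesis .
  qed
  ultimately have "(\<lambda>N. (\<Sum>q\<in>primes_upto N. - ln (norm (1 - real q powr - s))) - (\<Sum>n<Suc N. prime_excess s n))
     \<longlonglongrightarrow> ln (norm (\<Sum>n. real n powr - s)) - (\<Sum>n. prime_excess s n)" by (rule tendsto_diff)
  moreover have "(\<Sum>q\<in>primes_upto N. - ln (norm (1 - real q powr - s))) - (\<Sum>n<Suc N. prime_excess s n)
     = (\<Sum>p\<in>primes_upto N. real p powr - s)" for N
  proof -
    have "(\<Sum>n<Suc N. prime_excess s n) = (\<Sum>n\<in>{n\<in>{..<Suc N}. prime n}. ln_excess (real n powr - s))"
      unfolding prime_excess_def by (rule sum.inter_filter[symmetric]) simp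
    also have "{n\<in>{..<Suc N}. prime n} = primes_upto N" by (auto simp: primes_upto_def)
    finally have "(\<Sum>q\<in>primes_upto N. - ln (norm (1 - real q powr - s))) - (\<Sum>n<Suc N. prime_excess s n)
      = (\<Sum>q\<in>primes_upto N. - ln (norm (1 - real q powr - s)) - ln_excess (real q powr - s))"
      by (simp add: sum_subtractf)
    also have "\<dots> = (\<Sum>p\<in>primes_upto N. real p powr - s)"
    proof (rule sum.cong[OF refl])
      fix q assume "q \<in> primes_upto N"
      then have q: "real q > 1" using prime_gt_1_nat[of q] by (simp add: primes_upto_def)
      then have "real q powr - s < real q powr 0" using s by (intro powr_less_mono) auto
      then show "- ln (norm (1 - real q powr - s)) - ln_excess (real q powr - s) = real q powr - s"
        using q by (simp add: ln_excess_def)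
    qed
    finally show ?thesis .
  qed
  moreover have "norm (\<Sum>n. real n powr - s) = (\<Sum>n. real n powr - s)"
    using zeta_bounds(1)[OF s] s by (simp add: order_trans[of 0 "1 / (s - 1)"])
  ultimately show ?thesis by simp
qed

text \<open>
  The primes are grouped into the blocks \<open>(exp (k - 1), exp k]\<close>, whose partial sums differ from
  the harmonic numbers by a convergent sequence. Comparing the Abel sums of both series, which are
  \<open>ln (zeta (1 + \<delta>))\<close> up to the excess and \<open>- ln (1 - exp (- \<delta>))\<close>, identifies the constant.
\<close>

theorem sum_inverse_primes_mertens:
  "(\<lambda>N. (\<Sum>p\<in>primes_upto N. 1 / real p) - ln (ln (real N))) \<longlonglongrightarrow> euler_mascheroni - (\<Sum>n. prime_excess 1 n)"
proof -
  obtain M where M: "(\<lambda>N. (\<Sum>p\<in>primes_upto N. 1 / real p) - ln (ln (real N))) \<longlonglongrightarrow> M"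
    using sum_inverse_primes_minus_lnln_convergent by (auto simp: convergent_def)
  define X where "X k = nat \<lfloor>exp (real k)\<rfloor>" for k
  define I where "I k = primes_upto (X (Suc k)) - primes_upto (X k)" for k
  define P where "P k = (\<Sum>p\<in>primes_upto (X k). 1 / real p)" for k
  define b where "b k = P (Suc k) - P k" for k
  define D where "D k = P k - harm k" for k
  have X_le: "real (X k) \<le> exp (real k)" and X_gt: "exp (real k) < real (X k) + 1" for k
    unfolding X_def by (simp_all add: of_nat_nat)
  have Xmono: "X k \<le> X (Suc k)" for k unfolding X_def by (intro nat_mono floor_mono) simp
  have sub: "primes_upto (X k) \<subseteq> primes_upto (X (Suc k))" for k
    using Xmono[of k] by (auto simp: primes_upto_def)
  have I_iff: "p \<in> I k \<longleftrightarrow> prime p \<and> real p \<le> exp (real (Suc k)) \<and> exp (real k) < real p" for p k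
  proof -
    have "p \<le> X j \<longleftrightarrow> real p \<le> exp (real j)" for j
    proof
      assume "real p \<le> exp (real j)"
      then have "real p < real (X j) + 1" using X_gt[of j] by linarith
      then show "p \<le> X j" by linarith
    qed (use X_le[of j] in linarith)
    then show ?thesis by (auto simp: I_def primes_upto_def not_le)
  qed
  have b_I: "b k = (\<Sum>p\<in>I k. 1 / real p)" for k
    unfolding b_def P_def I_def using sum_diff[OF _ sub[of k], of "\<lambda>p. 1 / real p"] by simp
  have P0: "P 0 = 0"
  proof -
    have "primes_upto (X 0) = {}" by (auto simp: X_def primes_upto_def dest: prime_gt_1_nat)
    then show ?thesis by (simp add: P_def)
  qed
  have Xlim: "filterlim X at_top sequentially"
    unfolding X_def by real_asymp
  have Dlim: "D \<longlonglongrightarrow> M - euler_mascheroni"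
  proof -
    have "(\<lambda>k. P k - ln (ln (real (X k)))) \<longlonglongrightarrow> M"
      unfolding P_def by (rule filterlim_compose[OF M Xlim])
    moreover have "(\<lambda>k. ln (ln (real (X k))) - ln (real k)) \<longlonglongrightarrow> 0"
      unfolding X_def by real_asymp
    moreover have "(\<lambda>k. harm k - ln (real k)) \<longlonglongrightarrow> euler_mascheroni" by (rule euler_mascheroni_LIMSEQ)
    ultimately have "(\<lambda>k. (P k - ln (ln (real (X k)))) + (ln (ln (real (X k))) - ln (real k)) - (harm k - ln (real k)))
      \<longlonglongrightarrow> M + 0 - euler_mascheroni" by (intro tendsto_diff tendsto_add)
    then show ?thesis by (simp add: D_def[abs_def])
  qed
  \<comment> \<open>\<open>F z\<close> is the Abel sum of the block sums \<open>b k\<close> with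
    weights z^(k+1) after summation by parts: the harmonic part gives - ln (1 - z), and
    \<open>D\<close> the rest. \<open>E \<delta>\<close> is the sum of p^(-1-\<delta>) over all
    primes.\<close>
  define F where "F z = (1 - z) * (\<Sum>k. D k * z ^ k) - ln (1 - z)" for z :: real
  define E where "E \<delta> = ln (\<Sum>n. real n powr - (1 + \<delta>)) - (\<Sum>n. prime_excess (1 + \<delta>) n)" for \<delta> :: real
  have Flim: "((\<lambda>\<delta>. F (exp (- \<delta>)) + ln (1 - exp (- \<delta>))) \<longlongrightarrow> M - euler_mascheroni) (at_right 0)"
  proof -
    have "filterlim (\<lambda>\<delta>::real. exp (- \<delta>)) (at_left 1) (at_right 0)" by real_asymp
    from filterlim_compose[OF abel_mean[OF Dlim] this] show ?thesis by (simp add: F_def)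
  qed
  have Elim: "((\<lambda>\<delta>. E \<delta> + ln \<delta>) \<longlongrightarrow> - (\<Sum>n. prime_excess 1 n)) (at_right 0)"
  proof -
    have shift: "filterlim (\<lambda>\<delta>::real. 1 + \<delta>) (at_right 1) (at_right 0)" by real_asymp
    have "((\<lambda>\<delta>. ln (\<Sum>n. real n powr - (1 + \<delta>)) + ln \<delta>) \<longlongrightarrow> 0) (at_right 0)"
    proof (rule tendsto_sandwich[of "\<lambda>_. 0" _ _ "\<lambda>\<delta>. ln (1 + \<delta>)"])
      have bounds: "0 \<le> ln (\<Sum>n. real n powr - (1 + \<delta>)) + ln \<delta> \<and> ln (\<Sum>n. real n powr - (1 + \<delta>)) + ln \<delta> \<le> ln (1 + \<delta>)"
        if "\<delta> > 0" for \<delta> :: real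
      proof -
        define Z where "Z = (\<Sum>n. real n powr - (1 + \<delta>))"
        have Z: "1 / \<delta> \<le> Z" "Z \<le> 1 + 1 / \<delta>" using zeta_bounds[of "1 + \<delta>"] that by (auto simp: Z_def)
        moreover have "1 / \<delta> > 0" using that by simp
        ultimately have "Z > 0" by linarith
        then have "ln Z + ln \<delta> = ln (Z * \<delta>)" using that by (simp add: ln_mult)
        moreover have "1 \<le> Z * \<delta>" "Z * \<delta> \<le> 1 + \<delta>" using Z that by (simp_all add: field_simps)
        moreover have "0 \<le> ln (Z * \<delta>)" "ln (Z * \<delta>) \<le> ln (1 + \<delta>)"
          using calculation that by auto
        ultimately have "0 \<le> ln Z + ln \<delta> \<and> ln Z + ln \<delta> \<le> ln (1 + \<delta>)" by linarith
        then show ?thesis by (simp only: Z_def)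
      qed
      show "\<forall>\<^sub>F \<delta> in at_right 0. 0 \<le> ln (\<Sum>n. real n powr - (1 + \<delta>)) + ln \<delta>"
        "\<forall>\<^sub>F \<delta> in at_right 0. ln (\<Sum>n. real n powr - (1 + \<delta>)) + ln \<delta> \<le> ln (1 + \<delta>)"
        using eventually_at_right_less[of "0::real"] by (eventually_elim, use bounds in blast)+
      show "((\<lambda>\<delta>::real. ln (1 + \<delta>)) \<longlongrightarrow> 0) (at_right 0)" by real_asymp
    qed simp
    from tendsto_diff[OF this filterlim_compose[OF prime_excess_limit shift]]
    show ?thesis by (simp add: E_def algebra_simps)
  qed
  \<comment> \<open>For p between exp k and exp (k+1), p^(-\<delta>) lies between z^(k+1) and
    z^(k+1) exp \<delta> with z = exp (-\<delta>).\<close>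
  have FE: "F (exp (- \<delta>)) \<le> E \<delta> \<and> E \<delta> \<le> F (exp (- \<delta>)) * exp \<delta>" if \<delta>: "\<delta> > 0" for \<delta>
  proof -
    define z where "z = exp (- \<delta>)"
    have z: "0 < z" "z < 1" using \<delta> by (auto simp: z_def)
    define EK where "EK K = (\<Sum>p\<in>primes_upto (X K). real p powr - (1 + \<delta>))" for K
    define FK where "FK K = (\<Sum>k<K. b k * z ^ Suc k)" for K
    have "FK K \<le> EK K \<and> EK K \<le> FK K * exp \<delta>" for K
    proof (induction K)
      case 0
      have "primes_upto (X 0) = {}" by (auto simp: X_def primes_upto_def dest: prime_gt_1_nat)
      then show ?case by (simp add: FK_def EK_def)
    next
      case (Suc K)
      have EKS: "EK (Suc K) = EK K + (\<Sum>p\<in>I K. real p powr - (1 + \<delta>))"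
        unfolding EK_def I_def using sum_diff[OF _ sub[of K], of "\<lambda>p. real p powr - (1 + \<delta>)"] by simp
      have pp: "1 / real p * z ^ Suc K \<le> real p powr - (1 + \<delta>) \<and> real p powr - (1 + \<delta>) \<le> 1 / real p * (z ^ Suc K * exp \<delta>)"
        if "p \<in> I K" for p
      proof -
        have p: "prime p" "real p \<le> exp (real (Suc K))" "exp (real K) < real p" using that by (auto simp: I_iff)
        have p0: "real p > 0" using prime_gt_0_nat[OF p(1)] by simp
        have lnp: "ln (real p) \<le> real (Suc K)" "real K \<le> ln (real p)"
          using p p0 ln_mono[of "real p" "exp (real (Suc K))"] by (auto simp: ln_ge_iff)
        have "real p powr - (1 + \<delta>) = 1 / real p * exp (- (\<delta> * ln (real p)))"
        proof -
          have "real p powr - (1 + \<delta>) = real p powr (- 1) * real p powr (- \<delta>)"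
          proof -
            have "- (1 + \<delta>) = - 1 + - \<delta>" by simp
            then show ?thesis by (simp only: powr_add)
          qed
          moreover have "real p powr (- 1) = 1 / real p" using p0 by (simp add: powr_minus inverse_eq_divide)
          moreover have "real p powr (- \<delta>) = exp (- (\<delta> * ln (real p)))" using p0 by (simp add: powr_def)
          ultimately show ?thesis by simp
        qed
        moreover have "z ^ Suc K = exp (- (\<delta> * real (Suc K)))"
        proof -
          have "real (Suc K) * - \<delta> = - (\<delta> * real (Suc K))" by simp
          then show ?thesis unfolding z_def exp_of_nat_mult[symmetric] by simp
        qed
        moreover from this have "z ^ Suc K * exp \<delta> = exp (- (\<delta> * real (Suc K)) + \<delta>)"
          by (simp only: exp_add)
        then have "z ^ Suc K * exp \<delta> = exp (- (\<delta> * real K))" by (simp add: algebra_simps)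
        moreover have "\<delta> * ln (real p) \<le> \<delta> * real (Suc K)" "\<delta> * real K \<le> \<delta> * ln (real p)"
          using lnp \<delta> by (auto intro: mult_left_mono)
        ultimately show ?thesis using p0 by (auto intro!: divide_right_mono)
      qed
      have "b K * z ^ Suc K \<le> (\<Sum>p\<in>I K. real p powr - (1 + \<delta>))"
        unfolding b_I sum_distrib_right by (intro sum_mono) (use pp in blast)
      moreover have "(\<Sum>p\<in>I K. real p powr - (1 + \<delta>)) \<le> b K * (z ^ Suc K * exp \<delta>)"
        unfolding b_I sum_distrib_right by (intro sum_mono) (use pp in blast)
      ultimately show ?case using Suc by (simp add: FK_def EKS algebra_simps)
    qed
    moreover have "EK \<longlonglongrightarrow> E \<delta>"
      unfolding EK_def E_def by (rule filterlim_compose[OF prime_zeta_sums Xlim]) (use \<delta> in simp)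
    moreover have "FK \<longlonglongrightarrow> F z"
    proof -
      have parts: "FK K = (\<Sum>k<K. 1 / real (Suc k) * z ^ Suc k) + D K * z ^ K + (1 - z) * (\<Sum>k<K. D k * z ^ k)" for K
      proof (induction K)
        case 0
        then show ?case by (simp add: FK_def D_def P0 harm_def)
      next
        case (Suc K)
        have "b K = D (Suc K) - D K + 1 / real (Suc K)"
          by (simp add: b_def D_def harm_Suc inverse_eq_divide)
        then have "FK (Suc K) = FK K + (D (Suc K) - D K + 1 / real (Suc K)) * z ^ Suc K"
          by (simp add: FK_def)
        then show ?case using Suc by (simp add: algebra_simps)
      qed
      have geo: "(\<lambda>k. z ^ k) sums (1 / (1 - z))" using geometric_sums[of z] z by simp
      have "Bseq D" using Dlim by (rule convergent_imp_Bseq[OF convergentI])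
      then obtain B where B: "\<And>k. \<bar>D k\<bar> \<le> B" by (auto simp: Bseq_def)
      have s: "summable (\<lambda>k. D k * z ^ k)"
        by (rule summable_comparison_test'[OF summable_mult[OF sums_summable[OF geo], of B], of 0])
           (use B z in \<open>auto simp: abs_mult intro!: mult_right_mono\<close>)
      have l: "(\<lambda>k. 1 / real (Suc k) * z ^ Suc k) sums (- ln (1 - z))"
      proof -
        have "(\<lambda>n. - ((- (- z)) ^ n) / real n) sums ln (1 + (- z))" by (rule ln_series') (use z in auto)
        then have "(\<lambda>n. z ^ n / real n) sums (- ln (1 - z))" using sums_minus by fastforce
        then have "(\<lambda>n. z ^ Suc n / real (Suc n)) sums (- ln (1 - z))" by (subst sums_Suc_iff) simp
        then show ?thesis by (simp add: field_simps)
      qed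
      have "(\<lambda>K. (\<Sum>k<K. 1 / real (Suc k) * z ^ Suc k) + D K * z ^ K + (1 - z) * (\<Sum>k<K. D k * z ^ k))
        \<longlonglongrightarrow> - ln (1 - z) + 0 + (1 - z) * (\<Sum>k. D k * z ^ k)"
        using l s summable_LIMSEQ_zero[OF s] unfolding sums_def
        by (intro tendsto_add tendsto_mult tendsto_const) (auto intro: summable_LIMSEQ)
      then show ?thesis unfolding parts[symmetric] by (simp add: F_def)
    qed
    ultimately show ?thesis unfolding z_def[symmetric]
      by (metis (no_types, lifting) LIMSEQ_le tendsto_mult_right)
  qed
  \<comment> \<open>By \<open>FE\<close> the difference is at most (1 - exp (-\<delta>)) E \<delta>,
    of order \<delta> ln (1 / \<delta>).\<close>
  have "((\<lambda>\<delta>. E \<delta> - F (exp (- \<delta>))) \<longlongrightarrow> 0) (at_right 0)"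
  proof (rule tendsto_sandwich[of "\<lambda>_. 0" _ _ "\<lambda>\<delta>. (1 - exp (- \<delta>)) * ((E \<delta> + ln \<delta>) - ln \<delta>)"])
    have up: "E \<delta> - F (exp (- \<delta>)) \<le> (1 - exp (- \<delta>)) * ((E \<delta> + ln \<delta>) - ln \<delta>)" if "\<delta> > 0" for \<delta>
    proof -
      have "E \<delta> * exp (- \<delta>) \<le> (F (exp (- \<delta>)) * exp \<delta>) * exp (- \<delta>)"
        using FE[OF that] by (intro mult_right_mono) auto
      also have "\<dots> = F (exp (- \<delta>))" by (simp add: mult.assoc exp_minus)
      finally show ?thesis by (simp add: algebra_simps)
    qed
    show "\<forall>\<^sub>F \<delta> in at_right 0. 0 \<le> E \<delta> - F (exp (- \<delta>))"
      using eventually_at_right_less[of "0::real"] by eventually_elim (use FE in auto)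
    show "\<forall>\<^sub>F \<delta> in at_right 0. E \<delta> - F (exp (- \<delta>)) \<le> (1 - exp (- \<delta>)) * ((E \<delta> + ln \<delta>) - ln \<delta>)"
      using eventually_at_right_less[of "0::real"] by eventually_elim (use up in auto)
    have "((\<lambda>\<delta>::real. 1 - exp (- \<delta>)) \<longlongrightarrow> 0) (at_right 0)" by real_asymp
    from tendsto_mult[OF this Elim]
    have "((\<lambda>\<delta>. (1 - exp (- \<delta>)) * (E \<delta> + ln \<delta>)) \<longlongrightarrow> 0) (at_right 0)" by simp
    moreover have "((\<lambda>\<delta>::real. (1 - exp (- \<delta>)) * ln \<delta>) \<longlongrightarrow> 0) (at_right 0)" by real_asymp
    ultimately have "((\<lambda>\<delta>. (1 - exp (- \<delta>)) * (E \<delta> + ln \<delta>) - (1 - exp (- \<delta>)) * ln \<delta>) \<longlongrightarrow> 0 - 0) (at_right 0)"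
      by (rule tendsto_diff)
    then show "((\<lambda>\<delta>. (1 - exp (- \<delta>)) * ((E \<delta> + ln \<delta>) - ln \<delta>)) \<longlongrightarrow> 0) (at_right 0)"
      by (simp only: right_diff_distrib diff_zero)
  qed simp
  moreover have "((\<lambda>\<delta>::real. ln \<delta> - ln (1 - exp (- \<delta>))) \<longlongrightarrow> 0) (at_right 0)" by real_asymp
  ultimately have "((\<lambda>\<delta>. (E \<delta> - F (exp (- \<delta>))) + (ln \<delta> - ln (1 - exp (- \<delta>)))) \<longlongrightarrow> 0 + 0) (at_right 0)"
    by (rule tendsto_add)
  moreover have "((\<lambda>\<delta>. (E \<delta> + ln \<delta>) - (F (exp (- \<delta>)) + ln (1 - exp (- \<delta>))))
     \<longlongrightarrow> - (\<Sum>n. prime_excess 1 n) - (M - euler_mascheroni)) (at_right 0)"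
    by (intro tendsto_diff Elim Flim)
  then have "((\<lambda>\<delta>. (E \<delta> - F (exp (- \<delta>))) + (ln \<delta> - ln (1 - exp (- \<delta>))))
     \<longlongrightarrow> - (\<Sum>n. prime_excess 1 n) - (M - euler_mascheroni)) (at_right 0)"
    by (simp add: algebra_simps)
  ultimately have "- (\<Sum>n. prime_excess 1 n) - (M - euler_mascheroni) = 0 + 0"
    using tendsto_unique[OF trivial_limit_at_right_real] by blast
  then have "M = euler_mascheroni - (\<Sum>n. prime_excess 1 n)" by simp
  then show ?thesis using M by simp
qed

text \<open>Adding the excess turns the sum of reciprocals into minus the logarithm of the product
  and cancels the constant left in \<open>sum_inverse_primes_mertens\<close>.\<close>

theorem mertens_product:
  "(\<lambda>N. (\<Prod>p\<in>primes_upto N. 1 - 1 / real p) * ln (real N)) \<longlonglongrightarrow> exp (- euler_mascheroni)"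
proof -
  have "summable (prime_excess 1)"
  proof (rule summable_comparison_test'[where N = 0])
    show "summable (\<lambda>n. 2 * real n powr - 2)" by (intro summable_mult summable_powr) simp
  qed (use prime_excess_bounds[of 1] in auto)
  from LIMSEQ_Suc[OF summable_LIMSEQ[OF this]]
  have "(\<lambda>N. \<Sum>n<Suc N. prime_excess 1 n) \<longlonglongrightarrow> (\<Sum>n. prime_excess 1 n)" .
  from tendsto_add[OF sum_inverse_primes_mertens this]
  have "(\<lambda>N. - ((\<Sum>p\<in>primes_upto N. 1 / real p) - ln (ln (real N)) + (\<Sum>n<Suc N. prime_excess 1 n)))
     \<longlonglongrightarrow> - euler_mascheroni" by (intro tendsto_minus) simp
  then have lim: "(\<lambda>N. exp (- ((\<Sum>p\<in>primes_upto N. 1 / real p) - ln (ln (real N)) + (\<Sum>n<Suc N. prime_excess 1 n))))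
     \<longlonglongrightarrow> exp (- euler_mascheroni)" by (rule tendsto_exp)
  have "exp (- ((\<Sum>p\<in>primes_upto N. 1 / real p) - ln (ln (real N)) + (\<Sum>n<Suc N. prime_excess 1 n)))
     = (\<Prod>p\<in>primes_upto N. 1 - 1 / real p) * ln (real N)" if "N \<ge> 2" for N
  proof -
    have pos: "1 - 1 / real p > 0" if "p \<in> primes_upto N" for p
      using that prime_gt_1_nat[of p] by (simp add: primes_upto_def)
    then have prod: "(\<Prod>p\<in>primes_upto N. 1 - 1 / real p) > 0" by (rule prod_pos)
    have "(\<Sum>n<Suc N. prime_excess 1 n) = (\<Sum>n\<in>{n\<in>{..<Suc N}. prime n}. ln_excess (real n powr - 1))"
      unfolding prime_excess_def by (rule sum.inter_filter[symmetric]) simp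
    also have "{n\<in>{..<Suc N}. prime n} = primes_upto N" by (auto simp: primes_upto_def)
    also have "(\<Sum>p\<in>primes_upto N. ln_excess (real p powr - 1)) = (\<Sum>p\<in>primes_upto N. - ln (1 - 1 / real p) - 1 / real p)"
      by (intro sum.cong refl) (auto simp: ln_excess_def powr_minus inverse_eq_divide)
    finally have "- ((\<Sum>p\<in>primes_upto N. 1 / real p) - ln (ln (real N)) + (\<Sum>n<Suc N. prime_excess 1 n))
      = (\<Sum>p\<in>primes_upto N. ln (1 - 1 / real p)) + ln (ln (real N))"
      by (simp add: sum_subtractf sum_negf)
    also have "(\<Sum>p\<in>primes_upto N. ln (1 - 1 / real p)) = ln (\<Prod>p\<in>primes_upto N. 1 - 1 / real p)"
    proof (rule ln_prod[symmetric])
      fix p assume "p \<in> primes_upto N"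
      from pos[OF this] show "1 - 1 / real p \<noteq> 0" by linarith
    qed simp
    finally have e: "- ((\<Sum>p\<in>primes_upto N. 1 / real p) - ln (ln (real N)) + (\<Sum>n<Suc N. prime_excess 1 n))
      = ln (\<Prod>p\<in>primes_upto N. 1 - 1 / real p) + ln (ln (real N))" .
    show ?thesis
      unfolding e exp_add using prod \<open>N \<ge> 2\<close> by simp
  qed
  then have "eventually (\<lambda>N. exp (- ((\<Sum>p\<in>primes_upto N. 1 / real p) - ln (ln (real N)) + (\<Sum>n<Suc N. prime_excess 1 n)))
     = (\<Prod>p\<in>primes_upto N. 1 - 1 / real p) * ln (real N)) sequentially"
    using eventually_ge_at_top[of 2] by (rule eventually_mono[rotated])
  from filterlim_cong[OF refl refl this] lim show ?thesis by simp
qed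

section \<open>An upper bound for primes in the residue class 1\<close>

lemma card_residue_class_ge:
  fixes c d n :: nat
  assumes d: "d > 0"
  shows "n div d \<le> card {j\<in>{1..n}. [j = c] (mod d)}"
proof -
  define r where "r = (if c mod d = 0 then d else c mod d)"
  have r: "1 \<le> r" "r \<le> d" "[r = c] (mod d)" using d by (auto simp: r_def Cong.cong_def less_imp_le)
  have "inj_on (\<lambda>i. i * d + r) {..<n div d}" using d by (auto simp: inj_on_def)
  then have "n div d = card ((\<lambda>i. i * d + r) ` {..<n div d})" by (simp add: card_image)
  also have "\<dots> \<le> card {j\<in>{1..n}. [j = c] (mod d)}"
  proof (rule card_mono)
    show "(\<lambda>i. i * d + r) ` {..<n div d} \<subseteq> {j\<in>{1..n}. [j = c] (mod d)}"
    proof (rule image_subsetI)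
      fix i assume "i \<in> {..<n div d}"
      then have "Suc i * d \<le> n div d * d" by (intro mult_le_mono1) auto
      also have "\<dots> \<le> n" by simp
      finally have "i * d + r \<le> n" using r by simp
      moreover have "[i * d + r = c] (mod d)" using r(3) by (simp add: Cong.cong_def)
      ultimately show "i * d + r \<in> {j\<in>{1..n}. [j = c] (mod d)}" using r(1) by simp
    qed
  qed simp
  finally show ?thesis .
qed

text \<open>As p is invertible modulo d, all j of one residue class modulo d qualify.\<close>

lemma card_dvd_progression_ge:
  fixes p d n :: nat
  assumes "coprime p d" "d > 0"
  shows "n div d \<le> card {j\<in>{1..n}. d dvd 1 + j * p}"
proof -
  obtain x where x: "[p * x = 1] (mod d)" using cong_solve_coprime_nat[OF assms(1)] by auto
  \<comment> \<open>\<open>x\<close> inverts p and d - 1 stands for -1, so that c p is congruent to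
    -1 without leaving the naturals.\<close>
  define c where "c = x * (d - 1)"
  have dv: "d dvd 1 + j * p" if "[j = c] (mod d)" for j
  proof -
    have "[1 + j * p = 1 + c * p] (mod d)" by (intro cong_add cong_mult that cong_refl)
    also have "1 + c * p = 1 + (p * x) * (d - 1)" by (simp add: c_def)
    also have "[1 + (p * x) * (d - 1) = 1 + 1 * (d - 1)] (mod d)" by (intro cong_add cong_mult x cong_refl)
    also have "1 + 1 * (d - 1) = d" using assms(2) by simp
    finally show ?thesis using cong_dvd_iff[of "1 + j * p" d d] by simp
  qed
  have "n div d \<le> card {j\<in>{1..n}. [j = c] (mod d)}" by (rule card_residue_class_ge[OF assms(2)])
  also have "\<dots> \<le> card {j\<in>{1..n}. d dvd 1 + j * p}" by (rule card_mono) (use dv in auto)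
  finally show ?thesis .
qed

lemma sum_mangoldt_multiples_le:
  assumes p: "prime p"
  shows "(\<Sum>d\<in>{d\<in>{1..n}. p dvd d}. mangoldt d / real d) \<le> ln (real p)"
proof -
  have p2: "real p \<ge> 2" using prime_ge_2_nat[OF p] by simp
  define x where "x = 1 / real p"
  have x: "0 < x" "x \<le> 1 / 2" using p2 by (auto simp: x_def field_simps)
  have "(\<Sum>d\<in>{d\<in>{1..n}. p dvd d}. mangoldt d / real d) = (\<Sum>d\<in>{d\<in>{1..n}. p dvd d \<and> primepow d}. mangoldt d / real d)"
    by (rule sum.mono_neutral_right) (auto simp: mangoldt_def)
  also have "\<dots> \<le> (\<Sum>d\<in>(\<lambda>k. p ^ k) ` {1..n}. mangoldt d / real d)"
  proof (rule sum_mono2)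
    show "{d\<in>{1..n}. p dvd d \<and> primepow d} \<subseteq> (\<lambda>k. p ^ k) ` {1..n}"
    proof
      fix d assume "d \<in> {d\<in>{1..n}. p dvd d \<and> primepow d}"
      then obtain q k where d: "d \<le> n" "p dvd d" "prime q" "k > 0" "d = q ^ k" by (auto simp: primepow_def)
      then have "p dvd q" using p prime_dvd_power by blast
      then have "p = q" using p d(3) primes_dvd_imp_eq by blast
      have "k < 2 ^ k" by (rule less_exp)
      also have "2 ^ k \<le> q ^ k" using prime_ge_2_nat[OF d(3)] by (intro power_mono) auto
      finally show "d \<in> (\<lambda>k. p ^ k) ` {1..n}" using d \<open>p = q\<close> by auto
    qed
  qed (auto simp: mangoldt_nonneg)
  also have "\<dots> \<le> (\<Sum>k=1..n. ((\<lambda>d. mangoldt d / real d) \<circ> (\<lambda>k. p ^ k)) k)"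
    by (rule sum_image_le) (auto simp: mangoldt_nonneg)
  also have "\<dots> = ln (real p) * (\<Sum>k=1..n. x ^ k)"
    unfolding sum_distrib_left using p by (intro sum.cong refl) (auto simp: x_def power_divide)
  also have "\<dots> \<le> ln (real p) * 1"
  proof (rule mult_left_mono)
    have "(\<Sum>k=1..n. x ^ k) \<le> x / (1 - x)"
    proof (cases "n = 0")
      case False
      then have "(\<Sum>k=1..n. x ^ k) = (x - x ^ Suc n) / (1 - x)"
        by (subst sum_gp) (use x in auto)
      also have "\<dots> \<le> x / (1 - x)" using x by (intro divide_right_mono) auto
      finally show ?thesis .
    qed (use x in simp)
    also have "\<dots> \<le> 1" using x by (simp add: divide_le_eq)
    finally show "(\<Sum>k=1..n. x ^ k) \<le> 1" .
  qed (use p2 in simp)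
  finally show ?thesis by simp
qed

text \<open>
  A substitute for the Brun--Titchmarsh inequality that loses only a factor \<open>ln p\<close>: a prime
  \<open>q \<equiv> 1 (mod p)\<close> in \<open>(n, np + 1]\<close> divides \<open>\<Prod>j\<le>n. (1 + jp)\<close> but not \<open>n!\<close>, while up to powers
  of \<open>p\<close> that product is a multiple of \<open>n!\<close>.
\<close>

lemma sum_ln_primes_1_mod_progression_le:
  assumes p: "prime p" and n: "n > 0"
  shows "(\<Sum>q\<in>{q. prime q \<and> [q = 1] (mod p) \<and> n < q \<and> q \<le> n * p + 1}. ln (real q)) \<le> 3 * real n * ln (real p)"
proof -
  define A where "A = {q. prime q \<and> [q = 1] (mod p) \<and> n < q \<and> q \<le> n * p + 1}"
  define B where "B = {d\<in>{1..n}. \<not> p dvd d}"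
  define c where "c d = card {j\<in>{1..n}. d dvd 1 + j * p}" for d
  have p0: "p > 0" "p > 1" using prime_gt_0_nat[OF p] prime_gt_1_nat[OF p] by auto
  have finA: "finite A" unfolding A_def by (rule finite_subset[of _ "{..n * p + 1}"]) auto
  have cA: "c q \<ge> 1" if "q \<in> A" for q
  proof -
    have q: "prime q" "[q = 1] (mod p)" "q \<le> n * p + 1" using that by (auto simp: A_def)
    then have "p dvd q - 1" using prime_ge_1_nat[OF q(1)] by (metis cong_altdef_nat cong_sym)
    then obtain j where j: "q = 1 + j * p" using prime_ge_1_nat[OF q(1)] by (auto simp: dvd_def algebra_simps)
      (metis Suc_pred less_eq_Suc_le mult.commute)
    have "j \<noteq> 0" using j q(1) by (intro notI) simp
    moreover have "j \<le> n" using j q(3) p0 by simp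
    ultimately have "j \<in> {j\<in>{1..n}. q dvd 1 + j * p}" using j by simp
    then have "{j\<in>{1..n}. q dvd 1 + j * p} \<noteq> {}" by blast
    then show ?thesis unfolding c_def by (simp add: Suc_le_eq card_gt_0_iff)
  qed
  \<comment> \<open>\<open>c d\<close> is the number of factors 1 + j p divisible by d, so the sum
    of \<open>mangoldt d * real (c d)\<close> over all d is the logarithm of the product. The d in
    \<open>B\<close> already account for the part of n! prime to p; the primes in \<open>A\<close>
    exceed n and come on top.\<close>
  have "(\<Sum>d\<in>B. mangoldt d * real (n div d)) + (\<Sum>q\<in>A. ln (real q))
      \<le> (\<Sum>d\<in>B. mangoldt d * real (c d)) + (\<Sum>q\<in>A. mangoldt q * real (c q))"
  proof (intro add_mono sum_mono)
    fix d assume "d \<in> B"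
    then have d: "d > 0" "\<not> p dvd d" by (auto simp: B_def)
    then have "coprime p d" using p prime_imp_coprime by blast
    from card_dvd_progression_ge[OF this d(1), of n]
    show "mangoldt d * real (n div d) \<le> mangoldt d * real (c d)"
      unfolding c_def by (intro mult_left_mono mangoldt_nonneg) simp
  next
    fix q assume q: "q \<in> A"
    then have "prime q" by (simp add: A_def)
    then have "ln (real q) * 1 \<le> ln (real q) * real (c q)"
      using cA[OF q] prime_ge_1_nat by (intro mult_left_mono) auto
    then show "ln (real q) \<le> mangoldt q * real (c q)" using \<open>prime q\<close> by simp
  qed
  also have "\<dots> = (\<Sum>d\<in>B \<union> A. mangoldt d * real (c d))"
    using finA by (intro sum.union_disjoint[symmetric]) (auto simp: A_def B_def)
  also have "\<dots> \<le> (\<Sum>d=1..n * p + 1. mangoldt d * real (c d))"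
  proof (rule sum_mono2)
    have "n \<le> n * p + 1" using p0 by (cases p) auto
    then show "B \<union> A \<subseteq> {1..n * p + 1}"
      by (auto simp: A_def B_def dest: prime_ge_1_nat)
  qed (auto simp: mangoldt_nonneg)
  also have "\<dots> = (\<Sum>d=1..n * p + 1. \<Sum>j=1..n. if d dvd 1 + j * p then mangoldt d else 0)"
  proof (rule sum.cong[OF refl])
    fix d
    have "(\<Sum>j=1..n. if d dvd 1 + j * p then mangoldt d else (0::real)) = (\<Sum>j\<in>{j\<in>{1..n}. d dvd 1 + j * p}. mangoldt d)"
      by (rule sum.inter_filter[symmetric]) simp
    then show "mangoldt d * real (c d) = (\<Sum>j=1..n. if d dvd 1 + j * p then mangoldt d else 0)"
      by (simp add: c_def)
  qed
  also have "\<dots> = (\<Sum>j=1..n. \<Sum>d=1..n * p + 1. if d dvd 1 + j * p then mangoldt d else 0)"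
    by (rule sum.swap)
  also have "\<dots> = (\<Sum>j=1..n. ln (real (1 + j * p)))"
  proof (rule sum.cong[OF refl])
    fix j assume j: "j \<in> {1..n}"
    have "(\<Sum>d=1..n * p + 1. if d dvd 1 + j * p then mangoldt d else (0::real)) = (\<Sum>d\<in>{d\<in>{1..n * p + 1}. d dvd 1 + j * p}. mangoldt d)"
      by (rule sum.inter_filter[symmetric]) simp
    also have "{d\<in>{1..n * p + 1}. d dvd 1 + j * p} = {d. d dvd 1 + j * p}"
    proof -
      have "d \<le> n * p + 1" if "d dvd 1 + j * p" for d
      proof -
        have "d \<le> 1 + j * p" using that by (rule dvd_imp_le) simp
        also have "\<dots> \<le> n * p + 1" using j by simp
        finally show ?thesis .
      qed
      moreover have "1 \<le> d" if "d dvd 1 + j * p" for d using that by (cases d) auto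
      ultimately show ?thesis by auto
    qed
    finally show "(\<Sum>d=1..n * p + 1. if d dvd 1 + j * p then mangoldt d else 0) = ln (real (1 + j * p))"
      using mangoldt_sum[of "1 + j * p", where 'a = real] by simp
  qed
  also have "\<dots> \<le> (\<Sum>j=1..n. 2 * ln (real p) + ln (real j))"
  proof (rule sum_mono)
    fix j assume j: "j \<in> {1..n}"
    \<comment> \<open>From 1 + j p <= j p^2 the product is at most n! p^(2n). The powers of p in n!
      add at most n ln p, which makes 3 n ln p in total.\<close>
    have "1 + j * p \<le> j * (1 + p)" using j by simp
    also have "1 + p \<le> p * p" using p0 by (cases p) auto
    finally have "real (1 + j * p) \<le> real (j * (p * p))" by (simp only: of_nat_le_iff) simp
    then have "ln (real (1 + j * p)) \<le> ln (real (j * (p * p)))" by (subst ln_le_cancel_iff) (use j p0 in \<open>auto simp: add_pos_nonneg\<close>)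
    also have "\<dots> = 2 * ln (real p) + ln (real j)" using j p0 by (simp add: ln_mult)
    finally show "ln (real (1 + j * p)) \<le> 2 * ln (real p) + ln (real j)" .
  qed
  also have "\<dots> = 2 * real n * ln (real p) + ln (fact n)"
  proof -
    have "ln (\<Prod>j=1..n. real j) = (\<Sum>j=1..n. ln (real j))" by (rule ln_prod) auto
    then show ?thesis by (simp add: sum.distrib fact_prod)
  qed
  also have "ln (fact n) = (\<Sum>d\<in>B. mangoldt d * real (n div d)) + (\<Sum>d\<in>{d\<in>{1..n}. p dvd d}. mangoldt d * real (n div d))"
  proof -
    have "{1..n} = B \<union> {d\<in>{1..n}. p dvd d}" by (auto simp: B_def)
    then show ?thesis unfolding ln_fact_mangoldt
      by (metis (no_types, lifting) B_def finite_Collect_conjI finite_atLeastAtMost sum.union_disjoint disjoint_iff mem_Collect_eq finite_Un)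
  qed
  also have "(\<Sum>d\<in>{d\<in>{1..n}. p dvd d}. mangoldt d * real (n div d)) \<le> (\<Sum>d\<in>{d\<in>{1..n}. p dvd d}. mangoldt d * (real n / real d))"
    by (intro sum_mono mult_left_mono of_nat_div_le_of_nat mangoldt_nonneg)
  also have "\<dots> = real n * (\<Sum>d\<in>{d\<in>{1..n}. p dvd d}. mangoldt d / real d)"
    by (simp add: sum_distrib_left mult_ac)
  also have "\<dots> \<le> real n * ln (real p)" by (intro mult_left_mono sum_mangoldt_multiples_le p) auto
  finally show ?thesis by (simp add: A_def)
qed

text \<open>With n = N div p every such prime is at most n p + 1. Those up to n cost at most
  \<open>theta n\<close>, hence 2 n ln p because ln 4 <= 2 ln p; the others cost 3 n ln p.\<close>

lemma sum_ln_primes_1_mod_le: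
  assumes p: "prime p"
  shows "(\<Sum>q\<in>{q\<in>primes_upto N. [q = 1] (mod p)}. ln (real q)) \<le> 5 * (real N / real p) * ln (real p)"
proof -
  define n where "n = N div p"
  have p2: "real p \<ge> 2" using prime_ge_2_nat[OF p] by simp
  have p0: "p > 1" using prime_gt_1_nat[OF p] .
  have form: "q \<le> n * p + 1 \<and> n > 0" if "q \<in> {q\<in>primes_upto N. [q = 1] (mod p)}" for q
  proof -
    have q: "prime q" "q \<le> N" "[q = 1] (mod p)" using that by (auto simp: primes_upto_def)
    then have "p dvd q - 1" using prime_ge_1_nat[OF q(1)] by (metis cong_altdef_nat cong_sym)
    then obtain j where j: "q - 1 = p * j" by auto
    have "q > 1" using prime_gt_1_nat[OF q(1)] .
    then have "j > 0" using j by (cases j) auto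
    have "p * j \<le> N" using j q(2) by linarith
    then have "j \<le> n" unfolding n_def using p0 by (simp add: less_eq_div_iff_mult_less_eq mult.commute)
    then have "p * j \<le> n * p" by (simp add: mult.commute)
    then show ?thesis using j \<open>j > 0\<close> \<open>j \<le> n\<close> by linarith
  qed
  show ?thesis
  proof (cases "n > 0")
    case False
    then have "{q\<in>primes_upto N. [q = 1] (mod p)} = {}" using form by blast
    then show ?thesis using p2 by (simp only: sum.empty) simp
  next
    case True
    define A where "A = {q. prime q \<and> [q = 1] (mod p) \<and> n < q \<and> q \<le> n * p + 1}"
    have finA: "finite A" unfolding A_def by (rule finite_subset[of _ "{..n * p + 1}"]) auto
    have pos: "0 \<le> ln (real q)" if "prime q" for q using prime_ge_1_nat[OF that] by simp
    have "(\<Sum>q\<in>{q\<in>primes_upto N. [q = 1] (mod p)}. ln (real q)) \<le> (\<Sum>q\<in>primes_upto n \<union> A. ln (real q))"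
      using form finA pos by (intro sum_mono2) (auto simp: A_def primes_upto_def not_le)
    also have "\<dots> = theta n + (\<Sum>q\<in>A. ln (real q))"
      unfolding theta_def using finA by (intro sum.union_disjoint) (auto simp: A_def primes_upto_def)
    also have "\<dots> \<le> real n * ln 4 + 3 * real n * ln (real p)"
      unfolding A_def by (intro add_mono theta_le sum_ln_primes_1_mod_progression_le p True)
    also have "ln (4::real) \<le> 2 * ln (real p)"
    proof -
      have "ln (4::real) = ln (2 ^ 2)" by simp
      also have "\<dots> = 2 * ln 2" by (subst ln_realpow) auto
      also have "ln 2 \<le> ln (real p)" using p2 by simp
      finally show ?thesis by simp
    qed
    also have "real n * (2 * ln (real p)) + 3 * real n * ln (real p) = 5 * real n * ln (real p)"
      by (simp add: algebra_simps)
    also have "\<dots> \<le> 5 * (real N / real p) * ln (real p)"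
      unfolding n_def using p2 by (intro mult_right_mono mult_left_mono of_nat_div_le_of_nat) auto
    finally show ?thesis by (simp add: mult_left_mono)
  qed
qed

text \<open>Dyadic decomposition: for q in (2^K, 2^(K+1)] we have q ln q >= 2^K K ln 2, so the block
  contributes at most 15 / K times (ln p) / p, and 15 / K <= 30 (ln (K+1) - ln K) telescopes. The
  induction starts with the empty sum over q <= 2 and ln 1 = 0.\<close>

lemma sum_inverse_primes_1_mod_le:
  assumes p: "prime p" and K: "K \<ge> 1" and N: "N \<le> 2 ^ K"
  shows "(\<Sum>q\<in>{q\<in>primes_upto N. [q = 1] (mod p)}. 1 / real q) \<le> 30 * ln (real K) * (ln (real p) / real p)"
proof -
  have p2: "real p \<ge> 2" using prime_ge_2_nat[OF p] by simp
  define P where "P N = {q\<in>primes_upto N. [q = 1] (mod p)}" for N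
  have fin: "finite (P N)" for N by (simp add: P_def)
  define l where "l = ln (real p) / real p"
  have l: "l \<ge> 0" using p2 by (simp add: l_def)
  have "(\<Sum>q\<in>P (2 ^ K). 1 / real q) \<le> 30 * ln (real K) * l"
    using K
  proof (induction K rule: dec_induct)
    case base
    have "P (2 ^ 1) = {}"
    proof -
      have False if q: "prime q" "q \<le> 2" "[q = 1] (mod p)" for q
      proof -
        have "q = 2" using q prime_ge_2_nat[of q] by simp
        then have "2 mod p = 1 mod p" using q by (simp add: Cong.cong_def)
        then show False using prime_ge_2_nat[OF p] by (cases "p = 2") auto
      qed
      then show ?thesis by (auto simp: P_def primes_upto_def)
    qed
    then show ?case by simp
  next
    case (step K)
    have K: "real K \<ge> 1" using step by simp
    have sub: "P (2 ^ K) \<subseteq> P (2 ^ Suc K)"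
      using power_increasing[of K "Suc K" "2::nat"] by (auto simp: P_def primes_upto_def)
    define c where "c = 2 ^ K * (real K * ln 2)"
    have c: "c > 0" using K by (simp add: c_def)
    have "(\<Sum>q\<in>P (2 ^ Suc K) - P (2 ^ K). 1 / real q) \<le> (\<Sum>q\<in>P (2 ^ Suc K) - P (2 ^ K). ln (real q) / c)"
    proof (rule sum_mono)
      fix q assume "q \<in> P (2 ^ Suc K) - P (2 ^ K)"
      then have q: "2 ^ K < q" by (auto simp: P_def primes_upto_def not_le)
      then have qr: "2 ^ K < real q" by (metis of_nat_less_iff of_nat_numeral of_nat_power)
      have "real K * ln 2 = ln (2 ^ K)" by (simp add: ln_realpow)
      also have "\<dots> \<le> ln (real q)" using qr by (subst ln_le_cancel_iff) auto
      finally have "c \<le> real q * ln (real q)" unfolding c_def using qr K by (intro mult_mono) auto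
      moreover have "real q > 0" using qr by (simp add: less_trans[of 0 "2 ^ K"])
      ultimately show "1 / real q \<le> ln (real q) / c" using c by (simp add: field_simps)
    qed
    also have "\<dots> \<le> (\<Sum>q\<in>P (2 ^ Suc K). ln (real q) / c)"
      using c fin by (intro sum_mono2) (auto simp: P_def primes_upto_def dest: prime_ge_1_nat)
    also have "\<dots> = (\<Sum>q\<in>P (2 ^ Suc K). ln (real q)) / c" by (simp add: sum_divide_distrib)
    also have "\<dots> \<le> (5 * (real (2 ^ Suc K) / real p) * ln (real p)) / c"
      unfolding P_def using c by (intro divide_right_mono sum_ln_primes_1_mod_le p) auto
    also have "\<dots> = 10 / (real K * ln 2) * l"
      using K by (simp add: c_def l_def field_simps)
    also have "\<dots> \<le> 15 / real K * l"
    proof (rule mult_right_mono[OF _ l])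
      have "2 / 3 \<le> ln (2::real)" using ln2_ge_two_thirds by simp
      then have "real K * (2 / 3) \<le> real K * ln 2" using K by (intro mult_left_mono) auto
      then have "10 / (real K * ln 2) \<le> 10 / (real K * (2 / 3))" using K by (intro divide_left_mono) auto
      then show "10 / (real K * ln 2) \<le> 15 / real K" by simp
    qed
    also have "\<dots> \<le> 30 * (ln (real (Suc K)) - ln (real K)) * l"
    proof (rule mult_right_mono[OF _ l])
      have "ln (real K / real (Suc K)) \<le> real K / real (Suc K) - 1" using K by (intro ln_le_minus_one) auto
      moreover have "ln (real K / real (Suc K)) = ln (real K) - ln (real (Suc K))" using K by (simp add: ln_div)
      moreover have "real K / real (Suc K) - 1 = - 1 / real (Suc K)" by (simp add: field_simps)
      ultimately have "1 / real (Suc K) \<le> ln (real (Suc K)) - ln (real K)" by simp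
      then have "30 * (1 / real (Suc K)) \<le> 30 * (ln (real (Suc K)) - ln (real K))" by (intro mult_left_mono) auto
      moreover have "15 / real K \<le> 30 * (1 / real (Suc K))" using K by (simp add: field_simps)
      ultimately show "15 / real K \<le> 30 * (ln (real (Suc K)) - ln (real K))" by (rule order_trans[rotated])
    qed
    finally have "(\<Sum>q\<in>P (2 ^ Suc K) - P (2 ^ K). 1 / real q) \<le> 30 * (ln (real (Suc K)) - ln (real K)) * l" .
    moreover have "(\<Sum>q\<in>P (2 ^ Suc K). 1 / real q) = (\<Sum>q\<in>P (2 ^ Suc K) - P (2 ^ K). 1 / real q) + (\<Sum>q\<in>P (2 ^ K). 1 / real q)"
      by (rule sum.subset_diff[OF sub fin])
    moreover have "30 * (ln (real (Suc K)) - ln (real K)) * l = 30 * ln (real (Suc K)) * l - 30 * ln (real K) * l"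
      by (simp add: algebra_simps)
    ultimately show ?case using step.IH by linarith
  qed
  moreover have "(\<Sum>q\<in>P N. 1 / real q) \<le> (\<Sum>q\<in>P (2 ^ K). 1 / real q)"
    using N fin by (intro sum_mono2) (auto simp: P_def primes_upto_def)
  ultimately show ?thesis unfolding P_def l_def by linarith
qed

section \<open>Sieve bounds for the number of cyclic numbers\<close>

lemma card_multiples: "d > 0 \<Longrightarrow> card {m\<in>{1..N}. d dvd m} = N div d" for d N :: nat
proof -
  assume d: "d > 0"
  have "{m\<in>{1..N}. d dvd m} = (\<lambda>k. d * k) ` {1..N div d}"
  proof (intro equalityI subsetI)
    fix m assume "m \<in> {m\<in>{1..N}. d dvd m}"
    then obtain k where k: "m = d * k" "1 \<le> d * k" "d * k \<le> N" by auto
    then have "k \<noteq> 0" by (intro notI) simp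
    moreover have "k \<le> N div d" using k(3) d by (simp add: less_eq_div_iff_mult_less_eq mult.commute)
    ultimately show "m \<in> (\<lambda>k. d * k) ` {1..N div d}" using k(1) by auto
  next
    fix m assume "m \<in> (\<lambda>k. d * k) ` {1..N div d}"
    then obtain k where "k \<in> {1..N div d}" and k: "m = d * k" by blast
    then have k: "m = d * k" "1 \<le> k" "k \<le> N div d" by auto
    then have "d * k \<le> N" using d by (simp add: less_eq_div_iff_mult_less_eq mult.commute)
    then show "m \<in> {m\<in>{1..N}. d dvd m}" using k d by (auto simp: Suc_le_eq)
  qed
  then show ?thesis using d by (simp add: card_image inj_on_def)
qed

definition sifted :: "nat \<Rightarrow> nat set \<Rightarrow> nat set" where
  "sifted N Q = {m\<in>{1..N}. \<forall>q\<in>Q. \<not> q dvd m}"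

lemma finite_sifted [simp]: "finite (sifted N Q)"
  by (simp add: sifted_def)

text \<open>A further prime q removes the multiples q m of survivors m <= N div q. The errors of the
  two counts add up and rounding N / q costs at most 1, so an error e becomes 2 e + 1; 2^k - 1
  solves this recursion.\<close>

lemma card_sifted_legendre:
  assumes "finite Q" "\<And>q. q \<in> Q \<Longrightarrow> prime q"
  shows "\<bar>real (card (sifted N Q)) - real N * (\<Prod>q\<in>Q. 1 - 1 / real q)\<bar> \<le> 2 ^ card Q - 1"
  using assms
proof (induction Q arbitrary: N rule: finite_induct)
  case empty
  have "sifted N {} = {1..N}" by (auto simp: sifted_def)
  then show ?case by simp
next
  case (insert q Q)
  have q: "prime q" and Q: "\<And>r. r \<in> Q \<Longrightarrow> prime r" using insert.prems by auto
  have q0: "q > 0" using prime_gt_0_nat[OF q] .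
  define W where "W = (\<Prod>q\<in>Q. 1 - 1 / real q)"
  have Pi: "0 \<le> W" "W \<le> 1"
  proof -
    have "0 \<le> 1 - 1 / real r \<and> 1 - 1 / real r \<le> 1" if "r \<in> Q" for r
      using prime_ge_1_nat[OF Q[OF that]] by simp
    then show "0 \<le> W" "W \<le> 1"
      unfolding W_def by (blast intro: prod_nonneg prod_le_1)+
  qed
  have sub: "(\<lambda>m. q * m) ` sifted (N div q) Q \<subseteq> sifted N Q"
  proof
    fix n assume "n \<in> (\<lambda>m. q * m) ` sifted (N div q) Q"
    then obtain m where m: "n = q * m" "1 \<le> m" "m \<le> N div q" "\<forall>r\<in>Q. \<not> r dvd m" by (auto simp: sifted_def)
    have "q * m \<le> N" using m(3) q0 by (simp add: less_eq_div_iff_mult_less_eq mult.commute)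
    moreover have "\<not> r dvd q * m" if "r \<in> Q" for r
      using that m(4) Q[OF that] q insert.hyps(2) primes_dvd_imp_eq by (auto simp: prime_dvd_mult_iff)
    ultimately show "n \<in> sifted N Q" using m q0 by (auto simp: sifted_def Suc_le_eq)
  qed
  have "sifted N (insert q Q) = sifted N Q - (\<lambda>m. q * m) ` sifted (N div q) Q"
  proof (intro equalityI subsetI)
    fix n assume n: "n \<in> sifted N Q - (\<lambda>m. q * m) ` sifted (N div q) Q"
    have "\<not> q dvd n"
    proof
      assume "q dvd n"
      then obtain m where m: "n = q * m" by auto
      have "q * m \<le> N" "1 \<le> q * m" using n m by (auto simp: sifted_def)
      then have "m \<le> N div q" "1 \<le> m" using q0 by (auto simp: less_eq_div_iff_mult_less_eq mult.commute Suc_le_eq)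
      then have "m \<in> sifted (N div q) Q" using n m by (auto simp: sifted_def)
      then show False using n m by blast
    qed
    then show "n \<in> sifted N (insert q Q)" using n by (auto simp: sifted_def)
  qed (auto simp: sifted_def)
  then have "card (sifted N (insert q Q)) = card (sifted N Q) - card (sifted (N div q) Q)"
    using sub q0 by (simp add: card_Diff_subset card_image inj_on_def)
  moreover have "card (sifted (N div q) Q) \<le> card (sifted N Q)"
    using card_mono[OF _ sub] q0 by (simp add: card_image inj_on_def)
  ultimately have eq: "real (card (sifted N (insert q Q))) = real (card (sifted N Q)) - real (card (sifted (N div q) Q))"
    by simp
  have i1: "\<bar>real (card (sifted N Q)) - real N * W\<bar> \<le> 2 ^ card Q - 1"
    and i2: "\<bar>real (card (sifted (N div q) Q)) - real (N div q) * W\<bar> \<le> 2 ^ card Q - 1"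
    unfolding W_def by (intro insert.IH Q; assumption)+
  have i3: "\<bar>real (N div q) * W - real N / real q * W\<bar> \<le> 1"
  proof -
    have "real N = real (N div q) * real q + real (N mod q)"
      by (metis of_nat_add of_nat_mult div_mult_mod_eq)
    moreover have "real (N mod q) \<le> real q" using q0 by (simp add: less_imp_le)
    ultimately have "real N \<le> (real (N div q) + 1) * real q" by (simp add: algebra_simps)
    then have "real N / real q \<le> real (N div q) + 1" using q0 by (simp add: pos_divide_le_eq)
    moreover have "real (N div q) \<le> real N / real q" by (rule of_nat_div_le_of_nat)
    ultimately have "\<bar>real (N div q) - real N / real q\<bar> \<le> 1" by simp
    then have "\<bar>real (N div q) - real N / real q\<bar> * W \<le> 1 * 1" using Pi by (intro mult_mono) auto
    moreover have "\<bar>real (N div q) * W - real N / real q * W\<bar> = \<bar>real (N div q) - real N / real q\<bar> * W"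
      by (simp only: left_diff_distrib[symmetric] abs_mult abs_of_nonneg[OF Pi(1)])
    ultimately show ?thesis by simp
  qed
  have "real N * (\<Prod>q\<in>insert q Q. 1 - 1 / real q) = real N * W - real N / real q * W"
    using insert.hyps by (simp add: W_def algebra_simps)
  then show ?case
    using i1 i2 i3 insert.hyps unfolding eq by (simp add: abs_le_iff)
qed

text \<open>Turan's variance argument, with Chebyshev's inequality for the number of prime factors in \<open>Q\<close>.\<close>

lemma card_sifted_le:
  assumes fin: "finite Q" and prime: "\<And>q. q \<in> Q \<Longrightarrow> prime q" and card: "card Q \<le> X"
    and S: "S = (\<Sum>q\<in>Q. 1 / real q)" "S > 0"
  shows "real (card (sifted X Q)) \<le> 3 * real X / S"
proof -
  define \<omega> where "\<omega> m = (\<Sum>q\<in>Q. if q dvd m then 1 else 0 :: real)" for m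
  have div_le: "real (X div d) \<le> real X / real d" for d by (rule of_nat_div_le_of_nat)
  have count: "(\<Sum>m=1..X. if d dvd m then 1 else 0 :: real) = real (X div d)" if "d > 0" for d
  proof -
    have "(\<Sum>m=1..X. if d dvd m then 1 else 0 :: real) = (\<Sum>m\<in>{m\<in>{1..X}. d dvd m}. 1)"
      by (rule sum.inter_filter[symmetric]) simp
    then show ?thesis using card_multiples[OF that, of X] by simp
  qed
  \<comment> \<open>Each of the at most X primes costs 1 for rounding, hence the loss
    \<open>real X\<close>.\<close>
  have first: "(\<Sum>m=1..X. \<omega> m) \<ge> real X * S - real X"
  proof -
    have "real X * S - real X \<le> (\<Sum>q\<in>Q. real X / real q - 1)"
      using card by (simp add: S(1) sum_distrib_left sum_subtractf)
    also have "\<dots> \<le> (\<Sum>q\<in>Q. real (X div q))"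
    proof (rule sum_mono)
      fix q assume "q \<in> Q"
      then have q0: "real q > 0" using prime prime_gt_0_nat by simp
      have "real X = real (X div q) * real q + real (X mod q)"
        by (metis of_nat_add of_nat_mult div_mult_mod_eq)
      moreover have "real (X mod q) \<le> real q" using q0 by (simp add: less_imp_le)
      ultimately have "real X \<le> (real (X div q) + 1) * real q" by (simp add: algebra_simps)
      then show "real X / real q - 1 \<le> real (X div q)" using q0 by (simp add: pos_divide_le_eq diff_le_eq)
    qed
    also have "\<dots> = (\<Sum>q\<in>Q. \<Sum>m=1..X. if q dvd m then 1 else 0)"
      using prime prime_gt_0_nat by (intro sum.cong refl count[symmetric]) auto
    also have "\<dots> = (\<Sum>m=1..X. \<omega> m)" unfolding \<omega>_def by (rule sum.swap)
    finally show ?thesis .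
  qed
  have second: "(\<Sum>m=1..X. (\<omega> m)\<^sup>2) \<le> real X * S\<^sup>2 + real X * S"
  proof -
    have "(\<Sum>m=1..X. (\<omega> m)\<^sup>2) = (\<Sum>m=1..X. \<Sum>q\<in>Q. \<Sum>r\<in>Q. if q dvd m \<and> r dvd m then 1 else 0)"
      unfolding \<omega>_def power2_eq_square sum_product by (intro sum.cong refl) auto
    also have "\<dots> = (\<Sum>q\<in>Q. \<Sum>r\<in>Q. \<Sum>m=1..X. if q dvd m \<and> r dvd m then 1 else 0)"
      by (subst sum.swap, rule sum.cong[OF refl], rule sum.swap)
    also have "\<dots> \<le> (\<Sum>q\<in>Q. \<Sum>r\<in>Q. real X * (1 / real q * (1 / real r)) + (if q = r then real X / real q else 0))"
    proof (intro sum_mono)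
      fix q r assume "q \<in> Q" "r \<in> Q"
      then have q: "prime q" "prime r" using prime by auto
      then have q0: "q > 0" "r > 0" by (auto intro: prime_gt_0_nat)
      show "(\<Sum>m=1..X. if q dvd m \<and> r dvd m then 1 else 0) \<le> real X * (1 / real q * (1 / real r)) + (if q = r then real X / real q else 0)"
      proof (cases "q = r")
        case True
        then show ?thesis using count[OF q0(1)] div_le[of q] by (simp add: add_increasing)
      next
        case False
        then have "q dvd m \<and> r dvd m \<longleftrightarrow> q * r dvd m" for m
          using q primes_coprime[of q r] by (auto intro: divides_mult dvd_mult_left dvd_mult_right)
        then have "(\<Sum>m=1..X. if q dvd m \<and> r dvd m then 1 else 0 :: real) = real (X div (q * r))"
          using count[of "q * r"] q0 by simp
        also have "\<dots> \<le> real X / real (q * r)" by (rule div_le)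
        finally show ?thesis using False by simp
      qed
    qed
    also have "\<dots> = real X * S\<^sup>2 + real X * S"
    proof -
      have "(\<Sum>q\<in>Q. \<Sum>r\<in>Q. real X * (1 / real q * (1 / real r))) = real X * S\<^sup>2"
        unfolding S(1) power2_eq_square sum_product by (simp add: sum_distrib_left)
      moreover have "(\<Sum>q\<in>Q. \<Sum>r\<in>Q. if q = r then real X / real q else 0) = real X * S"
        using fin by (simp add: S(1) sum_distrib_left)
      ultimately show ?thesis by (simp only: sum.distrib)
    qed
    finally show ?thesis .
  qed
  \<comment> \<open>A sifted m has \<open>\<omega> m = 0\<close> and contributes the square of S to
    the sum of squared deviations, which the two moments bound by 3 X S.\<close>
  have "real (card (sifted X Q)) * S\<^sup>2 = (\<Sum>m\<in>sifted X Q. (\<omega> m - S)\<^sup>2)"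
  proof -
    have "\<omega> m = 0" if "m \<in> sifted X Q" for m
      using that unfolding \<omega>_def sifted_def by (intro sum.neutral) auto
    then show ?thesis by simp
  qed
  also have "\<dots> \<le> (\<Sum>m=1..X. (\<omega> m - S)\<^sup>2)"
    by (rule sum_mono2) (auto simp: sifted_def)
  also have "\<dots> = (\<Sum>m=1..X. (\<omega> m)\<^sup>2) - 2 * S * (\<Sum>m=1..X. \<omega> m) + real X * S\<^sup>2"
    by (simp add: power2_diff sum.distrib sum_subtractf sum_distrib_left mult_ac)
  also have "\<dots> \<le> (real X * S\<^sup>2 + real X * S) - 2 * S * (real X * S - real X) + real X * S\<^sup>2"
    using second first S(2) by (intro add_mono diff_mono mult_left_mono) auto
  also have "\<dots> = 3 * real X * S" by (simp add: power2_eq_square algebra_simps)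
  finally have "real (card (sifted X Q)) * S * S \<le> 3 * real X * S" by (simp add: power2_eq_square mult.assoc)
  then have "real (card (sifted X Q)) * S \<le> 3 * real X" using S(2) by simp
  then show ?thesis using S(2) by (simp add: pos_le_divide_eq)
qed

section \<open>Sieving the cyclic numbers\<close>

definition cyclics_upto :: "nat \<Rightarrow> nat set" where
  "cyclics_upto N = {m. cyclic_number m \<and> m \<le> N}"

lemma finite_cyclics_upto [simp]: "finite (cyclics_upto N)"
  unfolding cyclics_upto_def by (rule finite_subset[of _ "{..N}"]) auto

lemma card_primes_upto_le: "card (primes_upto n) \<le> n"
proof -
  have "primes_upto n \<subseteq> {1..n}" by (auto simp: primes_upto_def dest: prime_ge_1_nat)
  from card_mono[OF _ this] show ?thesis by simp
qed

lemma card_sifted_primes_upto: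
  "\<bar>real (card (sifted N (primes_upto Y))) - real N * (\<Prod>q\<in>primes_upto Y. 1 - 1 / real q)\<bar> \<le> 2 ^ Y"
proof -
  have "\<bar>real (card (sifted N (primes_upto Y))) - real N * (\<Prod>q\<in>primes_upto Y. 1 - 1 / real q)\<bar> \<le> 2 ^ card (primes_upto Y) - 1"
    by (rule card_sifted_legendre) (auto simp: primes_upto_def)
  moreover have "(2::real) ^ card (primes_upto Y) \<le> 2 ^ Y"
    by (intro power_increasing card_primes_upto_le) auto
  ultimately show ?thesis by linarith
qed

text \<open>A cyclic number with a prime factor p <= Y is p m with m <= N / p free of primes q
  congruent to 1 modulo p. By \<open>c1\<close> the reciprocals of these q up to R sum to S >= L /
  (4 p) - 8, by \<open>c2\<close> this is at least L / (8 p), and \<open>card_sifted_le\<close>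
  leaves at most 3 (N / p) / S <= 24 N / L values of m for each p. \<open>Y \<le> R\<close> and
  \<open>R\<^sup>2 \<le> N\<close> ensure R <= N div p, so that there are not more primes q than
  numbers to be sifted.\<close>

lemma card_cyclics_upto_le:
  assumes Y: "Y \<ge> 1" "Y \<le> R" and R: "R\<^sup>2 \<le> N" "R \<ge> 3" and L: "L > 0"
    and c1: "ln (ln (real R)) / 2 - 5 - 2 * real Y * ln (real Y) \<ge> L / 4" and c2: "64 * real Y \<le> L"
  shows "real (card (cyclics_upto N)) \<le> real N * (\<Prod>q\<in>primes_upto Y. 1 - 1 / real q) + 2 ^ Y + 24 * real N * real Y / L"
proof -
  define Q where "Q p = {q\<in>primes_upto R. [q = 1] (mod p)}" for p
  have sub: "cyclics_upto N \<subseteq> sifted N (primes_upto Y) \<union> (\<Union>p\<in>primes_upto Y. (\<lambda>m. p * m) ` sifted (N div p) (Q p))"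
  proof
    fix n assume "n \<in> cyclics_upto N"
    then have cyc: "cyclic_number n" and nN: "n \<le> N" by (auto simp: cyclics_upto_def)
    have n0: "n > 0" using cyc by (simp add: cyclic_number_def)
    show "n \<in> sifted N (primes_upto Y) \<union> (\<Union>p\<in>primes_upto Y. (\<lambda>m. p * m) ` sifted (N div p) (Q p))"
    proof (cases "\<exists>p\<in>primes_upto Y. p dvd n")
      case False
      then show ?thesis using n0 nN by (auto simp: sifted_def)
    next
      case True
      then obtain p m where p: "p \<in> primes_upto Y" "n = p * m" by (auto simp: dvd_def)
      have pr: "prime p" using p by (simp add: primes_upto_def)
      have p0: "p > 0" using prime_gt_0_nat[OF pr] .
      have "m \<le> N div p" using nN p p0 by (simp add: less_eq_div_iff_mult_less_eq mult.commute)
      moreover have "m \<ge> 1" using n0 p by (cases m) auto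
      moreover have "\<not> q dvd m" if "q \<in> Q p" for q
      proof
        assume "q dvd m"
        then have "q dvd n" using p by simp
        moreover have "prime q" "[q = 1] (mod p)" using that by (auto simp: Q_def primes_upto_def)
        ultimately show False using not_cyclic_number_if_congruent_primes[OF pr, of n q] p cyc by simp
      qed
      ultimately have "m \<in> sifted (N div p) (Q p)" by (auto simp: sifted_def)
      then show ?thesis using p by blast
    qed
  qed
  have "card (cyclics_upto N) \<le> card (sifted N (primes_upto Y) \<union> (\<Union>p\<in>primes_upto Y. (\<lambda>m. p * m) ` sifted (N div p) (Q p)))"
    by (rule card_mono[OF _ sub]) auto
  also have "\<dots> \<le> card (sifted N (primes_upto Y)) + card (\<Union>p\<in>primes_upto Y. (\<lambda>m. p * m) ` sifted (N div p) (Q p))"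
    by (rule card_Un_le)
  also have "card (\<Union>p\<in>primes_upto Y. (\<lambda>m. p * m) ` sifted (N div p) (Q p)) \<le> (\<Sum>p\<in>primes_upto Y. card ((\<lambda>m. p * m) ` sifted (N div p) (Q p)))"
    by (rule card_UN_le) simp
  also have "\<dots> \<le> (\<Sum>p\<in>primes_upto Y. card (sifted (N div p) (Q p)))"
    by (intro sum_mono card_image_le) simp
  finally have "real (card (cyclics_upto N)) \<le> real (card (sifted N (primes_upto Y))) + (\<Sum>p\<in>primes_upto Y. real (card (sifted (N div p) (Q p))))"
    by (simp flip: of_nat_sum of_nat_add)
  also have "(\<Sum>p\<in>primes_upto Y. real (card (sifted (N div p) (Q p)))) \<le> (\<Sum>p\<in>primes_upto Y. 24 * real N / L)"
  proof (rule sum_mono)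
    fix p assume "p \<in> primes_upto Y"
    then have p: "prime p" "p \<le> Y" by (auto simp: primes_upto_def)
    have p2: "real p \<ge> 2" using prime_ge_2_nat[OF p(1)] by simp
    define S where "S = (\<Sum>q\<in>Q p. 1 / real q)"
    have S: "S \<ge> L / (8 * real p)"
    proof -
      have "real p * ln (real p) \<le> real Y * ln (real Y)"
        using p p2 by (intro mult_mono ln_mono) auto
      then have "L / 4 \<le> ln (ln (real R)) / 2 - 5 - 2 * real p * ln (real p)" using c1 by linarith
      then have "L / 4 / real (p - 1) - 8 \<le> (ln (ln (real R)) / 2 - 5 - 2 * real p * ln (real p)) / real (p - 1) - 8"
        by (intro diff_right_mono divide_right_mono) auto
      also have "\<dots> \<le> S" unfolding S_def Q_def by (rule sum_inverse_primes_1_mod_ge[OF p(1) R(2)])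
      finally have "L / 4 / real (p - 1) - 8 \<le> S" .
      moreover have "L / (4 * real p) \<le> L / 4 / real (p - 1)"
        using L p2 by (simp add: frac_le of_nat_diff)
      moreover have "8 \<le> L / (8 * real p)"
      proof -
        have "64 * real p \<le> L" using c2 p(2) by (simp add: order_trans[of _ "64 * real Y"])
        then show ?thesis using p2 by (simp add: pos_le_divide_eq)
      qed
      moreover have "L / (4 * real p) = L / (8 * real p) + L / (8 * real p)" by simp
      ultimately have "L / (8 * real p) + 8 \<le> L / 4 / real (p - 1)" and "L / 4 / real (p - 1) \<le> S + 8"
        by argo+
      then show ?thesis by argo
    qed
    have S0: "S > 0" using S L p2 by (auto intro: less_le_trans[of 0 "L / (8 * real p)"])
    have "card (Q p) \<le> card (primes_upto R)"
      by (rule card_mono) (auto simp: Q_def)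
    also have "\<dots> \<le> R" by (rule card_primes_upto_le)
    also have "\<dots> \<le> N div p"
    proof -
      have "R * p \<le> R * R" using p(2) Y(2) by (intro mult_le_mono2) simp
      also have "\<dots> \<le> N" using R(1) by (simp add: power2_eq_square)
      finally show ?thesis using p2 by (simp add: less_eq_div_iff_mult_less_eq)
    qed
    finally have "real (card (sifted (N div p) (Q p))) \<le> 3 * real (N div p) / S"
      by (intro card_sifted_le S_def S0) (auto simp: Q_def primes_upto_def)
    also have "\<dots> \<le> 3 * (real N / real p) / (L / (8 * real p))"
      using S L p2 by (intro frac_le mult_left_mono of_nat_div_le_of_nat) auto
    also have "\<dots> = 24 * real N / L" using p2 by (simp add: field_simps)
    finally show "real (card (sifted (N div p) (Q p))) \<le> 24 * real N / L" .
  qed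
  also have "\<dots> = real (card (primes_upto Y)) * (24 * real N / L)" by simp
  also have "\<dots> \<le> real Y * (24 * real N / L)"
  proof (rule mult_right_mono)
    show "real (card (primes_upto Y)) \<le> real Y" using card_primes_upto_le[of Y] by simp
  qed (use L in simp)
  also have "real (card (sifted N (primes_upto Y))) \<le> real N * (\<Prod>q\<in>primes_upto Y. 1 - 1 / real q) + 2 ^ Y"
  proof -
    show ?thesis using card_sifted_primes_upto[of N Y] by linarith
  qed
  finally show ?thesis by (simp add: mult_ac)
qed

text \<open>A number without prime factors up to Y that is not cyclic is divisible by some p^2 or p
  q with p > Y and q congruent to 1 modulo p. The reciprocals of these q sum to at most 30 (ln K)
  (ln p) / p, and ln p <= p^\<eta> / \<eta> lets a single tail of the series of p^(\<eta>-2) bound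
  both kinds. Here \<open>\<eta>\<close> is a free parameter, unrelated to the constant used for the
  L-series.\<close>

lemma card_cyclics_upto_ge:
  assumes Y: "Y \<ge> 1" and K: "K \<ge> 1" "N \<le> 2 ^ K" and \<eta>: "0 < \<eta>" "\<eta> < 1"
  shows "real (card (cyclics_upto N)) \<ge> real N * (\<Prod>q\<in>primes_upto Y. 1 - 1 / real q) - 2 ^ Y
     - real N * real Y powr (\<eta> - 1) / (1 - \<eta>) * (1 + 30 * ln (real K) / \<eta>)"
proof -
  define P where "P = primes_upto N - primes_upto Y"
  define Q where "Q p = {q\<in>primes_upto N. [q = 1] (mod p)}" for p
  define A where "A = (\<Union>p\<in>P. {m\<in>{1..N}. p\<^sup>2 dvd m})"
  define B where "B = (\<Union>p\<in>P. \<Union>q\<in>Q p. {m\<in>{1..N}. p * q dvd m})"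
  have finP: "finite P" and finQ: "finite (Q p)" for p by (simp_all add: P_def Q_def)
  have sub: "sifted N (primes_upto Y) \<subseteq> cyclics_upto N \<union> (A \<union> B)"
  proof
    fix n assume "n \<in> sifted N (primes_upto Y)"
    then have n: "1 \<le> n" "n \<le> N" and nY: "\<And>p. prime p \<Longrightarrow> p \<le> Y \<Longrightarrow> \<not> p dvd n"
      by (auto simp: sifted_def primes_upto_def)
    have inP: "p \<in> P" if p: "prime p" "p dvd n" for p
      using p n nY[OF p(1)] dvd_imp_le[OF p(2)] by (auto simp: P_def primes_upto_def)
    show "n \<in> cyclics_upto N \<union> (A \<union> B)"
    proof (rule ccontr)
      assume neg: "n \<notin> cyclics_upto N \<union> (A \<union> B)"
      have "\<not> p\<^sup>2 dvd n" if "prime p" for p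
      proof
        assume d: "p\<^sup>2 dvd n"
        then have "p dvd n" by (simp add: power2_eq_square dvd_mult_left)
        then have "n \<in> A" using inP[OF that] d n by (auto simp: A_def)
        with neg show False by blast
      qed
      moreover have "\<not> [q = 1] (mod p)" if pq: "prime p" "prime q" "p dvd n" "q dvd n" for p q
      proof
        assume c: "[q = 1] (mod p)"
        have "p \<noteq> q" using c prime_gt_1_nat[OF pq(1)] by (auto simp: Cong.cong_def)
        then have "p * q dvd n" using pq by (intro divides_mult primes_coprime)
        moreover have "q \<in> Q p" using pq c n dvd_imp_le[of q n] by (auto simp: Q_def primes_upto_def)
        ultimately have "n \<in> B" using inP[OF pq(1,3)] n by (auto simp: B_def)
        with neg show False by blast
      qed
      ultimately have "coprime n (totient n)"
        using n by (intro coprime_totient_if_no_congruent_primes) auto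
      then have "cyclic_number n" using n by (intro cyclic_number_if_coprime_totient) auto
      then have "n \<in> cyclics_upto N" using n by (simp add: cyclics_upto_def)
      with neg show False by blast
    qed
  qed
  have finAB: "finite A" "finite B" using finP finQ by (auto simp: A_def B_def)
  have "card (sifted N (primes_upto Y)) \<le> card (cyclics_upto N \<union> (A \<union> B))"
    by (rule card_mono[OF _ sub]) (use finAB in auto)
  also have "\<dots> \<le> card (cyclics_upto N) + (card A + card B)"
    by (intro order_trans[OF card_Un_le] add_left_mono card_Un_le)
  finally have 1: "real (card (sifted N (primes_upto Y))) \<le> real (card (cyclics_upto N)) + (real (card A) + real (card B))"
    by (simp flip: of_nat_add)
  have P_pos: "prime p" "p > Y" "p > 0" "real p \<ge> 1" if "p \<in> P" for p
  proof -
    show "prime p" "p > Y" using that by (auto simp: P_def primes_upto_def)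
    then show "p > 0" "real p \<ge> 1" using prime_gt_0_nat[of p] by auto
  qed
  have "real (card A) \<le> (\<Sum>p\<in>P. real N * real p powr (\<eta> - 2))"
  proof -
    have "card A \<le> (\<Sum>p\<in>P. card {m\<in>{1..N}. p\<^sup>2 dvd m})" unfolding A_def by (rule card_UN_le[OF finP])
    also have "\<dots> = (\<Sum>p\<in>P. N div p\<^sup>2)" using P_pos by (intro sum.cong refl card_multiples) auto
    finally have "real (card A) \<le> (\<Sum>p\<in>P. real (N div p\<^sup>2))" by (simp flip: of_nat_sum)
    also have "\<dots> \<le> (\<Sum>p\<in>P. real N * real p powr (\<eta> - 2))"
    proof (rule sum_mono)
      fix p assume p: "p \<in> P"
      have "real (N div p\<^sup>2) \<le> real N / real (p\<^sup>2)" by (rule of_nat_div_le_of_nat)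
      also have "\<dots> = real N * real p powr (- 2)"
        using P_pos[OF p] by (simp add: powr_minus divide_inverse)
      also have "\<dots> \<le> real N * real p powr (\<eta> - 2)"
        using P_pos[OF p] \<eta> by (intro mult_left_mono powr_mono) auto
      finally show "real (N div p\<^sup>2) \<le> real N * real p powr (\<eta> - 2)" .
    qed
    finally show ?thesis .
  qed
  also have "\<dots> = real N * (\<Sum>p\<in>P. real p powr (\<eta> - 2))" by (simp add: sum_distrib_left)
  finally have A: "real (card A) \<le> real N * (\<Sum>p\<in>P. real p powr (\<eta> - 2))" .
  have lnK: "ln (real K) \<ge> 0" using K by simp
  have "real (card B) \<le> (\<Sum>p\<in>P. real N * (30 * ln (real K) / \<eta> * real p powr (\<eta> - 2)))"
  proof -
    have "card B \<le> (\<Sum>p\<in>P. card (\<Union>q\<in>Q p. {m\<in>{1..N}. p * q dvd m}))" unfolding B_def by (rule card_UN_le[OF finP])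
    also have "\<dots> \<le> (\<Sum>p\<in>P. \<Sum>q\<in>Q p. card {m\<in>{1..N}. p * q dvd m})" by (intro sum_mono card_UN_le finQ)
    also have "\<dots> = (\<Sum>p\<in>P. \<Sum>q\<in>Q p. N div (p * q))"
      using P_pos by (intro sum.cong refl card_multiples) (auto simp: Q_def primes_upto_def prime_gt_0_nat)
    finally have "real (card B) \<le> (\<Sum>p\<in>P. \<Sum>q\<in>Q p. real (N div (p * q)))" by (simp flip: of_nat_sum)
    also have "\<dots> \<le> (\<Sum>p\<in>P. real N * (30 * ln (real K) / \<eta> * real p powr (\<eta> - 2)))"
    proof (rule sum_mono)
      fix p assume p: "p \<in> P"
      have "(\<Sum>q\<in>Q p. real (N div (p * q))) \<le> (\<Sum>q\<in>Q p. real N / real (p * q))"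
        by (intro sum_mono of_nat_div_le_of_nat)
      also have "\<dots> = real N / real p * (\<Sum>q\<in>Q p. 1 / real q)" by (simp add: sum_distrib_left)
      also have "\<dots> \<le> real N / real p * (30 * ln (real K) * (ln (real p) / real p))"
        unfolding Q_def using P_pos[OF p] by (intro mult_left_mono sum_inverse_primes_1_mod_le K) auto
      also have "\<dots> \<le> real N / real p * (30 * ln (real K) * ((real p powr \<eta> / \<eta>) / real p))"
      proof (intro mult_left_mono divide_right_mono)
        have "\<eta> * ln (real p) = ln (real p powr \<eta>)" using P_pos[OF p] by (simp add: ln_powr)
        also have "\<dots> \<le> real p powr \<eta>" using P_pos[OF p] by (intro ln_bound) auto
        finally show "ln (real p) \<le> real p powr \<eta> / \<eta>" using \<eta> by (simp add: pos_le_divide_eq mult.commute)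
      qed (use lnK in auto)
      also have "\<dots> = real N * (30 * ln (real K) / \<eta> * real p powr (\<eta> - 2))"
        using P_pos[OF p] by (simp add: powr_diff power2_eq_square)
      finally show "(\<Sum>q\<in>Q p. real (N div (p * q))) \<le> real N * (30 * ln (real K) / \<eta> * real p powr (\<eta> - 2))" .
    qed
    finally show ?thesis .
  qed
  also have "\<dots> = real N * (30 * ln (real K) / \<eta>) * (\<Sum>p\<in>P. real p powr (\<eta> - 2))"
    by (simp add: sum_distrib_left sum_divide_distrib mult_ac)
  finally have B: "real (card B) \<le> real N * (30 * ln (real K) / \<eta>) * (\<Sum>p\<in>P. real p powr (\<eta> - 2))" .
  have tail: "(\<Sum>p\<in>P. real p powr (\<eta> - 2)) \<le> real Y powr (\<eta> - 1) / (1 - \<eta>)"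
  proof -
    define s where "s = 2 - \<eta>"
    have s: "s > 1" using \<eta> by (simp add: s_def)
    have "(\<Sum>p\<in>P. real p powr (\<eta> - 2)) = (\<Sum>n\<in>(\<lambda>q. q - Suc Y) ` P. real (n + Suc Y) powr - s)"
    proof (subst sum.reindex)
      show "inj_on (\<lambda>q. q - Suc Y) P"
        using P_pos(2) by (intro inj_onI) (metis Suc_leI eq_diff_iff)
      show "(\<Sum>p\<in>P. real p powr (\<eta> - 2)) = sum ((\<lambda>n. real (n + Suc Y) powr - s) \<circ> (\<lambda>q. q - Suc Y)) P"
      proof (rule sum.cong[OF refl])
        fix q assume "q \<in> P"
        then have "q - Suc Y + Suc Y = q" using P_pos(2)[of q] by simp
        moreover have "\<eta> - 2 = - s" by (simp add: s_def)
        ultimately show "real q powr (\<eta> - 2) = ((\<lambda>n. real (n + Suc Y) powr - s) \<circ> (\<lambda>q. q - Suc Y)) q"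
          by (simp only: o_def)
      qed
    qed
    also have "\<dots> \<le> (\<Sum>n. real (n + Suc Y) powr - s)"
      by (rule sum_le_suminf) (use finP summable_ignore_initial_segment[OF summable_powr[OF s], of "Suc Y"] in auto)
    also have "\<dots> \<le> real Y powr (1 - s) / (s - 1)" by (rule suminf_powr_tail_le[OF s]) (use Y in simp)
    finally show ?thesis by (simp add: s_def)
  qed
  have "real (card A) + real (card B) \<le> real N * (1 + 30 * ln (real K) / \<eta>) * (\<Sum>p\<in>P. real p powr (\<eta> - 2))"
    using A B by (simp add: algebra_simps)
  also have "\<dots> \<le> real N * (1 + 30 * ln (real K) / \<eta>) * (real Y powr (\<eta> - 1) / (1 - \<eta>))"
    using tail lnK \<eta> by (intro mult_left_mono) auto
  finally have 2: "real (card A) + real (card B) \<le> real N * real Y powr (\<eta> - 1) / (1 - \<eta>) * (1 + 30 * ln (real K) / \<eta>)"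
    by (simp add: mult_ac)
  have 3: "real (card (sifted N (primes_upto Y))) \<ge> real N * (\<Prod>q\<in>primes_upto Y. 1 - 1 / real q) - 2 ^ Y"
    using card_sifted_primes_upto[of N Y] by linarith
  show ?thesis using 1 2 3 by linarith
qed

section \<open>The density of the cyclic numbers\<close>

abbreviation (input) lnlnln :: "real \<Rightarrow> real" where "lnlnln x \<equiv> ln (ln (ln x))"

definition level :: "real \<Rightarrow> nat \<Rightarrow> nat" where
  "level a N = nat \<lfloor>ln (ln (real N)) powr a\<rfloor>"

lemma filterlim_level: "a > 0 \<Longrightarrow> filterlim (level a) at_top sequentially"
  unfolding level_def by real_asymp

lemma level_le: "real (level a N) \<le> ln (ln (real N)) powr a"
  unfolding level_def by (simp add: of_nat_nat)

lemma level_ge: "ln (ln (real N)) powr a - 1 \<le> real (level a N)"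
  unfolding level_def by (simp add: of_nat_nat)

text \<open>The logarithm of \<open>level a N\<close> is asymptotic to a ln ln ln N, which produces
  the factor 1 / a.\<close>

lemma mertens_level:
  assumes "a > 0"
  shows "(\<lambda>N. (\<Prod>p\<in>primes_upto (level a N). 1 - 1 / real p) * lnlnln (real N))
    \<longlonglongrightarrow> exp (- euler_mascheroni) / a"
proof -
  have "(\<lambda>N. (\<Prod>p\<in>primes_upto (level a N). 1 - 1 / real p) * ln (real (level a N))) \<longlonglongrightarrow> exp (- euler_mascheroni)"
    by (rule filterlim_compose[OF mertens_product filterlim_level[OF assms]])
  moreover have "(\<lambda>N. lnlnln (real N) / ln (real (level a N))) \<longlonglongrightarrow> inverse a"
    unfolding level_def using assms by real_asymp
  ultimately have "(\<lambda>N. ((\<Prod>p\<in>primes_upto (level a N). 1 - 1 / real p) * ln (real (level a N))) *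
      (lnlnln (real N) / ln (real (level a N)))) \<longlonglongrightarrow> exp (- euler_mascheroni) * inverse a"
    by (rule tendsto_mult)
  moreover have "eventually (\<lambda>N. ln (real (level a N)) > 0) sequentially"
    using eventually_compose_filterlim[OF eventually_gt_at_top[of "1::nat"] filterlim_level[OF assms]]
    by eventually_elim simp
  then have "eventually (\<lambda>N. ((\<Prod>p\<in>primes_upto (level a N). 1 - 1 / real p) * ln (real (level a N))) *
      (lnlnln (real N) / ln (real (level a N))) = (\<Prod>p\<in>primes_upto (level a N). 1 - 1 / real p) * lnlnln (real N)) sequentially"
    by eventually_elim simp
  ultimately show ?thesis unfolding divide_inverse[of _ a] by (simp add: filterlim_cong)
qed

text \<open>This is the error of Legendre's sieve. Eventually (ln ln N)^a is at most (ln N) / 2, so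
  \<open>2 ^ level a N\<close> is at most the square root of N.\<close>

lemma two_power_level:
  assumes "a > 0"
  shows "(\<lambda>N. 2 ^ level a N * lnlnln (real N) / real N) \<longlonglongrightarrow> 0"
proof (rule Lim_null_comparison)
  have "eventually (\<lambda>N. lnlnln (real N) \<ge> 0) sequentially" by real_asymp
  moreover have "eventually (\<lambda>N. ln (ln (real N)) powr a \<le> ln (real N) / 2) sequentially"
    using assms by real_asymp
  moreover have "eventually (\<lambda>N::nat. N > 0) sequentially" by (rule eventually_gt_at_top)
  ultimately show "eventually (\<lambda>N. norm (2 ^ level a N * lnlnln (real N) / real N)
    \<le> sqrt (real N) * lnlnln (real N) / real N) sequentially"
  proof eventually_elim
    case (elim N)
    have "(2::real) ^ level a N \<le> exp 1 ^ level a N"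
      using exp_ge_add_one_self[of "1::real"] by (intro power_mono) auto
    also have "\<dots> = exp (real (level a N))" by (simp add: exp_of_nat_mult[symmetric])
    also have "\<dots> \<le> exp (ln (real N) / 2)" using level_le[of a N] elim(2) by simp
    also have "\<dots> = sqrt (real N)" using elim(3) by (simp add: ln_sqrt[symmetric])
    finally show ?case using elim by (simp add: abs_mult divide_right_mono mult_right_mono)
  qed
  show "(\<lambda>N. sqrt (real N) * lnlnln (real N) / real N) \<longlonglongrightarrow> 0"
    by real_asymp
qed

text \<open>\<open>card_cyclics_upto_le\<close> with L = ln ln N and R the integer part of sqrt N.
  The condition a < 1 makes the third term of \<open>U\<close>, of size L^(a-1) ln L, vanish and
  keeps Y ln Y small against L.\<close>

lemma cyclics_density_upper:
  assumes a: "0 < a" "a < 1" and c: "c > exp (- euler_mascheroni) / a"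
  shows "eventually (\<lambda>N. real (card (cyclics_upto N)) * lnlnln (real N) / real N < c) sequentially"
proof -
  define U where "U N = (\<Prod>p\<in>primes_upto (level a N). 1 - 1 / real p) * lnlnln (real N)
     + 2 ^ level a N * lnlnln (real N) / real N
     + 24 * (ln (ln (real N)) powr a) / ln (ln (real N)) * lnlnln (real N)" for N
  define R where "R N = nat \<lfloor>sqrt (real N)\<rfloor>" for N
  have "(\<lambda>N. 24 * (ln (ln (real N)) powr a) / ln (ln (real N)) * lnlnln (real N)) \<longlonglongrightarrow> 0"
    using a by real_asymp
  from tendsto_add[OF tendsto_add[OF mertens_level[OF a(1)] two_power_level[OF a(1)]] this]
  have "U \<longlonglongrightarrow> exp (- euler_mascheroni) / a + 0 + 0" unfolding U_def .
  then have "U \<longlonglongrightarrow> exp (- euler_mascheroni) / a" by simp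
  from order_tendstoD(2)[OF this c] have e1: "eventually (\<lambda>N. U N < c) sequentially" .
  have e2: "eventually (\<lambda>N. ln (ln (real N)) powr a - 1 \<ge> 1) sequentially" using a by real_asymp
  have e3: "eventually (\<lambda>N. ln (ln (real N)) powr a \<le> sqrt (real N) - 1) sequentially" using a by real_asymp
  have e4: "eventually (\<lambda>N. sqrt (real N) - 1 \<ge> 3) sequentially" by real_asymp
  have e5: "eventually (\<lambda>N. ln (ln (sqrt (real N) - 1)) / 2 - 5 - 2 * (ln (ln (real N)) powr a) * ln (ln (ln (real N)) powr a) \<ge> ln (ln (real N)) / 4) sequentially"
    using a by real_asymp
  have e6: "eventually (\<lambda>N. 64 * (ln (ln (real N)) powr a) \<le> ln (ln (real N))) sequentially"
    using a by real_asymp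
  have e7: "eventually (\<lambda>N. lnlnln (real N) > 0 \<and> ln (ln (real N)) > 0 \<and> real N > 0) sequentially"
    by (intro eventually_conj; real_asymp)
  show ?thesis
    using e1 e2 e3 e4 e5 e6 e7
  proof eventually_elim
    case (elim N)
    define Y where "Y = level a N"
    define L where "L = ln (ln (real N))"
    have Y: "real Y \<le> L powr a" "L powr a - 1 \<le> real Y"
      using level_le[of a N] level_ge[of N a] by (simp_all add: Y_def L_def)
    then have Y1: "real Y \<ge> 1" using elim(2) by (simp add: L_def)
    have R: "real (R N) \<le> sqrt (real N)" "sqrt (real N) - 1 \<le> real (R N)"
      unfolding R_def by (simp_all add: of_nat_nat)
    have "real ((R N)\<^sup>2) \<le> sqrt (real N) ^ 2" unfolding of_nat_power using R by (intro power_mono) auto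
    then have R2: "(R N)\<^sup>2 \<le> N" by simp
    have R3: "R N \<ge> 3" using R(2) elim(4) by simp
    have YR: "Y \<le> R N" using Y R elim(3) by (simp add: L_def)
    have "ln (real Y) \<le> ln (L powr a)" using Y Y1 by (intro ln_mono) linarith+
    then have "real Y * ln (real Y) \<le> (L powr a) * ln (L powr a)"
      by (rule mult_mono[OF Y(1)]) (use Y1 in auto)
    moreover have "ln (ln (sqrt (real N) - 1)) \<le> ln (ln (real (R N)))"
    proof -
      have "exp 1 \<le> sqrt (real N) - 1" using exp_le elim(4) by linarith
      then have "1 \<le> ln (sqrt (real N) - 1)" using elim(4) by (subst ln_ge_iff) linarith+
      moreover have "ln (sqrt (real N) - 1) \<le> ln (real (R N))" using R elim(4) by (intro ln_mono) linarith+
      ultimately show ?thesis by - (rule ln_mono; linarith)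
    qed
    ultimately have c1: "ln (ln (real (R N))) / 2 - 5 - 2 * real Y * ln (real Y) \<ge> L / 4"
      using elim(5) by (simp add: L_def)
    have c2: "64 * real Y \<le> L" using elim(6) Y(1) by (simp add: L_def)
    have L: "L > 0" and g: "ln L > 0" and N: "real N > 0" using elim(7) by (auto simp: L_def)
    have "real (card (cyclics_upto N)) \<le> real N * (\<Prod>q\<in>primes_upto Y. 1 - 1 / real q) + 2 ^ Y + 24 * real N * real Y / L"
      by (rule card_cyclics_upto_le[OF _ YR R2 R3 L c1 c2]) (use Y1 in simp)
    also have "24 * real N * real Y / L \<le> 24 * real N * (L powr a) / L"
      using Y(1) L by (intro divide_right_mono mult_left_mono) auto
    finally have "real (card (cyclics_upto N)) \<le> real N * (\<Prod>q\<in>primes_upto Y. 1 - 1 / real q) + 2 ^ Y + 24 * real N * (L powr a) / L"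
      by simp
    then have "real (card (cyclics_upto N)) * ln L / real N
      \<le> (real N * (\<Prod>q\<in>primes_upto Y. 1 - 1 / real q) + 2 ^ Y + 24 * real N * (L powr a) / L) * ln L / real N"
      using g N by (intro divide_right_mono mult_right_mono) auto
    also have "\<dots> = U N" using N by (simp add: U_def Y_def L_def field_simps)
    also have "\<dots> < c" by (rule elim(1))
    finally show ?case by (simp add: L_def)
  qed
qed

lemma cyclics_density_lower:
  assumes a: "a > 1" and c: "c < exp (- euler_mascheroni) / a"
  shows "eventually (\<lambda>N. c < real (card (cyclics_upto N)) * lnlnln (real N) / real N) sequentially"
proof -
  \<comment> \<open>The choice makes a (1 - \<eta>) = (a + 1) / 2 exceed 1, so that Y^(\<eta>-1)
    outweighs the factor L coming from ln K.\<close>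
  define \<eta> where "\<eta> = (a - 1) / (2 * a)"
  have \<eta>: "0 < \<eta>" "\<eta> < 1" using a by (simp_all add: \<eta>_def field_simps)
  have a\<eta>: "a * (\<eta> - 1) = - ((a + 1) / 2)" using a by (simp add: \<eta>_def field_simps)
  define b where "b = (a + 1) / 2"
  have b: "b > 1" using a by (simp add: b_def)
  define V where "V N = (\<Prod>p\<in>primes_upto (level a N). 1 - 1 / real p) * lnlnln (real N)
     - 2 ^ level a N * lnlnln (real N) / real N
     - (2 powr (1 - \<eta>) / (1 - \<eta>)) * (ln (ln (real N)) powr (- b) * (1 + 30 * (ln (ln (real N)) + 2) / \<eta>) * lnlnln (real N))" for N
  have "(\<lambda>N. ln (ln (real N)) powr (- b) * (1 + 30 * (ln (ln (real N)) + 2) / \<eta>) * lnlnln (real N)) \<longlonglongrightarrow> 0"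
    using b \<eta> by real_asymp
  from tendsto_mult_left[OF this, of "2 powr (1 - \<eta>) / (1 - \<eta>)"]
  have "(\<lambda>N. (2 powr (1 - \<eta>) / (1 - \<eta>)) * (ln (ln (real N)) powr (- b) * (1 + 30 * (ln (ln (real N)) + 2) / \<eta>) * lnlnln (real N))) \<longlonglongrightarrow> 0"
    by simp
  from tendsto_diff[OF tendsto_diff[OF mertens_level[of a] two_power_level[of a]] this]
  have "V \<longlonglongrightarrow> exp (- euler_mascheroni) / a - 0 - 0" unfolding V_def using a by simp
  then have "V \<longlonglongrightarrow> exp (- euler_mascheroni) / a" by simp
  from order_tendstoD(1)[OF this c] have e1: "eventually (\<lambda>N. c < V N) sequentially" .
  have e2: "eventually (\<lambda>N. ln (ln (real N)) powr a - 1 \<ge> ln (ln (real N)) powr a / 2 \<and> ln (ln (real N)) powr a - 1 \<ge> 1) sequentially"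
    using a by (intro eventually_conj; real_asymp)
  have e3: "eventually (\<lambda>N. ln (2 * ln (real N) + 1) \<le> ln (ln (real N)) + 2) sequentially" by real_asymp
  have e7: "eventually (\<lambda>N. lnlnln (real N) > 0 \<and> ln (ln (real N)) > 0 \<and> ln (real N) > 1 \<and> real N > 0) sequentially"
    by (intro eventually_conj; real_asymp)
  show ?thesis
    using e1 e2 e3 e7
  proof eventually_elim
    case (elim N)
    define Y where "Y = level a N"
    define L where "L = ln (ln (real N))"
    \<comment> \<open>The factor 2 ensures N <= 2^K, as 2 ln 2 > 1, and ln K remains at most L +
      2.\<close>
    define K where "K = nat \<lceil>2 * ln (real N)\<rceil>"
    have L: "L > 0" and g: "ln L > 0" and N: "real N > 0" and lnN: "ln (real N) > 1" using elim(4) by (auto simp: L_def)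
    have Y: "L powr a - 1 \<le> real Y" using level_ge[of N a] by (simp add: Y_def L_def)
    have Yhalf: "L powr a / 2 \<le> real Y" and Y1: "real Y \<ge> 1" using Y elim(2) by (auto simp: L_def)
    have K: "2 * ln (real N) \<le> real K" "real K \<le> 2 * ln (real N) + 1"
      unfolding K_def using lnN by (simp_all add: of_nat_nat)
    have K1: "K \<ge> 1" using K(1) lnN by (simp add: Suc_le_eq)
    have NK: "N \<le> 2 ^ K"
    proof -
      have "ln (real N) \<le> 2 * ln (real N) * (2 / 3)" using lnN by simp
      also have "\<dots> \<le> real K * ln 2" using K(1) lnN ln2_ge_two_thirds by (intro mult_mono) auto
      also have "\<dots> = ln (2 ^ K)" by (simp add: ln_realpow)
      finally have "real N \<le> 2 ^ K" using N by simp
      then show ?thesis by (metis of_nat_le_iff of_nat_numeral of_nat_power)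
    qed
    have lnK: "ln (real K) \<le> L + 2" "0 \<le> ln (real K)"
    proof -
      have "ln (real K) \<le> ln (2 * ln (real N) + 1)" using K K1 by simp
      then show "ln (real K) \<le> L + 2" using elim(3) by (simp add: L_def)
      show "0 \<le> ln (real K)" using K1 by simp
    qed
    have Ypow: "real Y powr (\<eta> - 1) \<le> 2 powr (1 - \<eta>) * L powr (- b)"
    proof -
      have "real Y powr (\<eta> - 1) \<le> (L powr a / 2) powr (\<eta> - 1)"
        using Yhalf L \<eta> by (intro powr_mono2') auto
      also have "\<dots> = (L powr a) powr (\<eta> - 1) / 2 powr (\<eta> - 1)" using L by (simp add: powr_divide)
      also have "(L powr a) powr (\<eta> - 1) = L powr (- b)" by (simp add: powr_powr a\<eta> b_def)
      also have "L powr (- b) / 2 powr (\<eta> - 1) = 2 powr (1 - \<eta>) * L powr (- b)"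
        by (simp add: powr_diff field_simps)
      finally show ?thesis .
    qed
    have "real N * real Y powr (\<eta> - 1) / (1 - \<eta>) * (1 + 30 * ln (real K) / \<eta>)
       \<le> real N * (2 powr (1 - \<eta>) * L powr (- b)) / (1 - \<eta>) * (1 + 30 * (L + 2) / \<eta>)"
      using Ypow lnK \<eta> L by (intro mult_mono divide_right_mono mult_left_mono add_left_mono) auto
    moreover have "real (card (cyclics_upto N)) \<ge> real N * (\<Prod>q\<in>primes_upto Y. 1 - 1 / real q) - 2 ^ Y
     - real N * real Y powr (\<eta> - 1) / (1 - \<eta>) * (1 + 30 * ln (real K) / \<eta>)"
      by (rule card_cyclics_upto_ge[OF _ K1 NK \<eta>]) (use Y1 in simp)
    ultimately have "real (card (cyclics_upto N)) \<ge> real N * (\<Prod>q\<in>primes_upto Y. 1 - 1 / real q) - 2 ^ Y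
     - real N * (2 powr (1 - \<eta>) * L powr (- b)) / (1 - \<eta>) * (1 + 30 * (L + 2) / \<eta>)" by linarith
    then have "(real N * (\<Prod>q\<in>primes_upto Y. 1 - 1 / real q) - 2 ^ Y
     - real N * (2 powr (1 - \<eta>) * L powr (- b)) / (1 - \<eta>) * (1 + 30 * (L + 2) / \<eta>)) * ln L / real N
     \<le> real (card (cyclics_upto N)) * ln L / real N"
      using g N by (intro divide_right_mono mult_right_mono) auto
    moreover have "V N = (real N * (\<Prod>q\<in>primes_upto Y. 1 - 1 / real q) - 2 ^ Y
     - real N * (2 powr (1 - \<eta>) * L powr (- b)) / (1 - \<eta>) * (1 + 30 * (L + 2) / \<eta>)) * ln L / real N"
    proof -
      have *: "(x * A - B - x * C / u * D) * l / x = A * l - B * l / x - C / u * D * l" if "x \<noteq> 0" for x A B C D l u :: real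
        using that by (simp add: diff_divide_distrib left_diff_distrib)
      show ?thesis using N by (subst *) (simp_all add: V_def Y_def L_def mult_ac)
    qed
    ultimately show ?case using elim(1) by (simp add: L_def)
  qed
qed

theorem cyclics_density:
  "(\<lambda>N. real (card (cyclics_upto N)) * lnlnln (real N) / real N) \<longlonglongrightarrow> exp (- euler_mascheroni)"
proof -
  have lim: "((\<lambda>e. exp (- euler_mascheroni) / (1 + e)) \<longlongrightarrow> exp (- euler_mascheroni) / (1 + 0)) (at_right (0::real))"
    "((\<lambda>e. exp (- euler_mascheroni) / (1 - e)) \<longlongrightarrow> exp (- euler_mascheroni) / (1 - 0)) (at_right (0::real))"
    by (intro tendsto_intros; simp)+
  have pos: "eventually (\<lambda>e::real. e \<in> {0<..<1}) (at_right 0)" by (rule eventually_at_right_real) simp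
  show ?thesis
  proof (rule order_tendstoI)
    fix c assume "c < exp (- euler_mascheroni :: real)"
    then have "eventually (\<lambda>e. c < exp (- euler_mascheroni) / (1 + e)) (at_right (0::real))"
      by (intro order_tendstoD(1)[OF lim(1)]) simp
    from eventually_happens[OF eventually_conj[OF this pos]] obtain e :: real
      where "c < exp (- euler_mascheroni) / (1 + e)" "e > 0" by auto
    then show "eventually (\<lambda>N. c < real (card (cyclics_upto N)) * lnlnln (real N) / real N) sequentially"
      by (intro cyclics_density_lower) auto
  next
    fix c assume "c > exp (- euler_mascheroni :: real)"
    then have "eventually (\<lambda>e. exp (- euler_mascheroni) / (1 - e) < c) (at_right (0::real))"
      by (intro order_tendstoD(2)[OF lim(2)]) simp
    from eventually_happens[OF eventually_conj[OF this pos]] obtain e :: real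
      where "exp (- euler_mascheroni) / (1 - e) < c" "0 < e" "e < 1" by auto
    then show "eventually (\<lambda>N. real (card (cyclics_upto N)) * lnlnln (real N) / real N < c) sequentially"
      by (intro cyclics_density_upper) auto
  qed
qed

section \<open>Power sums of cyclic numbers\<close>

lemma stolz_cesaro:
  fixes A B :: "nat \<Rightarrow> real"
  assumes B: "filterlim B at_top sequentially" and inc: "eventually (\<lambda>n. B n < B (Suc n)) sequentially"
    and lim: "(\<lambda>n. (A (Suc n) - A n) / (B (Suc n) - B n)) \<longlonglongrightarrow> l"
  shows "(\<lambda>n. A n / B n) \<longlonglongrightarrow> l"
proof (rule tendstoI)
  fix e :: real assume e: "e > 0"
  from tendstoD[OF lim half_gt_zero[OF e]]
  have "eventually (\<lambda>n. \<bar>(A (Suc n) - A n) / (B (Suc n) - B n) - l\<bar> < e / 2 \<and> B n < B (Suc n)) sequentially"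
    by (intro eventually_conj inc) (simp add: dist_real_def)
  then obtain M where M: "\<And>n. n \<ge> M \<Longrightarrow> \<bar>(A (Suc n) - A n) / (B (Suc n) - B n) - l\<bar> < e / 2" "\<And>n. n \<ge> M \<Longrightarrow> B n < B (Suc n)"
    by (auto simp: eventually_at_top_linorder)
  have step: "\<bar>(A (Suc n) - A n) - l * (B (Suc n) - B n)\<bar> \<le> e / 2 * (B (Suc n) - B n)" if "n \<ge> M" for n
  proof -
    have d: "B (Suc n) - B n > 0" using M(2)[OF that] by simp
    have "(A (Suc n) - A n) - l * (B (Suc n) - B n) = ((A (Suc n) - A n) / (B (Suc n) - B n) - l) * (B (Suc n) - B n)"
      using d by (simp add: field_simps)
    then have "\<bar>(A (Suc n) - A n) - l * (B (Suc n) - B n)\<bar> = \<bar>(A (Suc n) - A n) / (B (Suc n) - B n) - l\<bar> * (B (Suc n) - B n)"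
      using d by (simp add: abs_mult)
    then show ?thesis using M(1)[OF that] d by (simp add: mult_right_mono)
  qed
  note bound = step
  have tele: "\<bar>(A n - A M) - l * (B n - B M)\<bar> \<le> e / 2 * (B n - B M)" if "n \<ge> M" for n
    using that
  proof (induction n rule: dec_induct)
    case (step n)
    have "(A (Suc n) - A M) - l * (B (Suc n) - B M) = ((A n - A M) - l * (B n - B M)) + ((A (Suc n) - A n) - l * (B (Suc n) - B n))"
      by (simp add: algebra_simps)
    also have "\<bar>\<dots>\<bar> \<le> e / 2 * (B n - B M) + e / 2 * (B (Suc n) - B n)"
      using step.IH bound[OF step.hyps(1)] by linarith
    also have "\<dots> = e / 2 * (B (Suc n) - B M)" by (simp only: distrib_left[symmetric]) simp
    finally show ?case .
  qed simp
  define c where "c = \<bar>A M\<bar> + \<bar>l * B M\<bar> + e / 2 * \<bar>B M\<bar>"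
  have "eventually (\<lambda>n. B n > 2 * c / e + 1) sequentially"
    using B by (simp add: filterlim_at_top_dense)
  then show "eventually (\<lambda>n. dist (A n / B n) l < e) sequentially"
    using eventually_ge_at_top[of M]
  proof eventually_elim
    case (elim n)
    have c: "c \<ge> 0" using e by (simp add: c_def)
    then have Bn: "B n > 0" using elim(1) e by (smt (verit) divide_nonneg_pos)
    have "\<bar>A n - l * B n\<bar> \<le> \<bar>(A n - A M) - l * (B n - B M)\<bar> + \<bar>A M\<bar> + \<bar>l * B M\<bar>"
      by (simp add: algebra_simps abs_if)
    also have "\<dots> \<le> e / 2 * (B n - B M) + \<bar>A M\<bar> + \<bar>l * B M\<bar>" using tele[OF elim(2)] by simp
    also have "\<dots> \<le> e / 2 * B n + c"
    proof -
      have "e / 2 * (- B M) \<le> e / 2 * \<bar>B M\<bar>" using e by (intro mult_left_mono) auto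
      then show ?thesis by (simp add: c_def algebra_simps)
    qed
    also have "c < e / 2 * B n" using elim(1) e by (simp add: field_simps)
    finally have "\<bar>A n - l * B n\<bar> < e * B n" by simp
    moreover have "A n / B n - l = (A n - l * B n) / B n" using Bn by (simp add: diff_divide_distrib)
    ultimately show ?case using Bn by (simp add: dist_real_def abs_divide divide_less_eq)
  qed
qed

text \<open>For u n = F (n+1) / F n, the limit of n (u n - 1) is the growth exponent of F. Exponents
  add because u v - 1 = (u - 1) v + (v - 1) and v tends to 1.\<close>

lemma relative_increment_mult:
  fixes u v :: "nat \<Rightarrow> real"
  assumes u: "(\<lambda>n. real n * (u n - 1)) \<longlonglongrightarrow> a" and v: "(\<lambda>n. real n * (v n - 1)) \<longlonglongrightarrow> b"
  shows "(\<lambda>n. real n * (u n * v n - 1)) \<longlonglongrightarrow> a + b"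
proof -
  have "(\<lambda>n. real n * (v n - 1) * (1 / real n) + 1) \<longlonglongrightarrow> b * 0 + 1"
    by (intro tendsto_intros v lim_1_over_n)
  moreover have "eventually (\<lambda>n. real n * (v n - 1) * (1 / real n) + 1 = v n) sequentially"
    using eventually_gt_at_top[of 0] by eventually_elim simp
  ultimately have "v \<longlonglongrightarrow> 1" by (simp add: filterlim_cong)
  from tendsto_add[OF tendsto_mult[OF u this] v]
  have "(\<lambda>n. real n * (u n - 1) * v n + real n * (v n - 1)) \<longlonglongrightarrow> a * 1 + b" .
  then show ?thesis by (simp add: algebra_simps)
qed

lemma relative_increment_power:
  fixes u :: "nat \<Rightarrow> real"
  assumes "(\<lambda>n. real n * (u n - 1)) \<longlonglongrightarrow> a"
  shows "(\<lambda>n. real n * (u n ^ k - 1)) \<longlonglongrightarrow> real k * a"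
proof (induction k)
  case (Suc k)
  from relative_increment_mult[OF assms Suc] show ?case by (simp add: algebra_simps)
qed simp

text \<open>Stolz-Cesaro against B n = n^(k+1) (ln ln ln n)^k. The growth exponent of n is 1 and
  that of ln ln ln n is 0, so B increases by about (k + 1) B n / n, which is asymptotically k + 1
  times the increment f (n+1)^k of the sum.\<close>

lemma sum_power_lnlnln:
  fixes f :: "nat \<Rightarrow> real"
  assumes f: "f \<sim>[at_top] (\<lambda>n. real n * lnlnln (real n))"
  shows "(\<lambda>n. \<Sum>i=1..n. f i ^ k) \<sim>[at_top] (\<lambda>n. real n ^ (k + 1) * lnlnln (real n) ^ k / (real k + 1))"
proof -
  define A where "A n = (\<Sum>i=1..n. f i ^ k)" for n
  define B where "B n = real n ^ (k + 1) * lnlnln (real n) ^ k" for n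
  define u where "u n = real (Suc n) / real n" for n
  define v where "v n = lnlnln (real (Suc n)) / lnlnln (real n)" for n
  define w where "w n = u n ^ (k + 1) * v n ^ k" for n
  have u: "(\<lambda>n. real n * (u n - 1)) \<longlonglongrightarrow> 1" unfolding u_def by real_asymp
  have v: "(\<lambda>n. real n * (v n - 1)) \<longlonglongrightarrow> 0"
  proof (rule real_tendsto_sandwich[of "\<lambda>_. 0" _ _ "\<lambda>n. 1 / (ln (real n) * ln (ln (real n)) * lnlnln (real n))"])
    show "(\<lambda>n. 1 / (ln (real n) * ln (ln (real n)) * lnlnln (real n))) \<longlonglongrightarrow> 0" by real_asymp
    have ev: "eventually (\<lambda>n. lnlnln (real n) > 0 \<and> ln (ln (real n)) > 0 \<and> ln (real n) > 0 \<and> real n > 0) sequentially"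
      by (intro eventually_conj; real_asymp)
    \<comment> \<open>Three applications carry the increment 1 of n through the three
      logarithms.\<close>
    have ln: "ln b - ln a \<le> (b - a) / a" "ln a \<le> ln b" if "0 < a" "a \<le> b" for a b :: real
      using that ln_diff_le[of b a] by simp_all
    have "real n * (v n - 1) \<le> 1 / (ln (real n) * ln (ln (real n)) * lnlnln (real n)) \<and> 0 \<le> real n * (v n - 1)"
      if pos: "lnlnln (real n) > 0 \<and> ln (ln (real n)) > 0 \<and> ln (real n) > 0 \<and> real n > 0" for n
    proof -
      define m where "m = real (Suc n)"
      have m: "real n \<le> m" "m - real n = 1" by (simp_all add: m_def)
      have i1: "ln m - ln (real n) \<le> 1 / real n" "ln (real n) \<le> ln m"
        using ln[of "real n" m] m pos by simp_all
      have i2: "ln (ln m) - ln (ln (real n)) \<le> 1 / real n / ln (real n)" "ln (ln (real n)) \<le> ln (ln m)"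
        using ln[of "ln (real n)" "ln m"] i1 pos divide_right_mono[OF i1(1), of "ln (real n)"] by linarith+
      have i3: "lnlnln m - lnlnln (real n) \<le> 1 / real n / ln (real n) / ln (ln (real n))" "lnlnln (real n) \<le> lnlnln m"
        using ln[of "ln (ln (real n))" "ln (ln m)"] i2 pos divide_right_mono[OF i2(1), of "ln (ln (real n))"] by linarith+
      have "r * (y / z - 1) = r * (y - z) / z" if "z > 0" for r y z :: real
        using that by (simp add: field_simps)
      then have eq: "real n * (v n - 1) = real n * (lnlnln m - lnlnln (real n)) / lnlnln (real n)"
        unfolding v_def m_def using pos by blast
      also have "\<dots> \<le> real n * (1 / real n / ln (real n) / ln (ln (real n))) / lnlnln (real n)"
        using i3 pos by (intro divide_right_mono mult_left_mono) auto
      also have "\<dots> = 1 / (ln (real n) * ln (ln (real n)) * lnlnln (real n))"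
      proof -
        have "r * (1 / r / a / b) / c = 1 / (a * b * c)" if "r > 0" for r a b c :: real
          using that by simp
        then show ?thesis using pos by blast
      qed
      finally have "real n * (v n - 1) \<le> 1 / (ln (real n) * ln (ln (real n)) * lnlnln (real n))" .
      moreover have "0 \<le> real n * (v n - 1)"
        unfolding eq using i3(2) pos by (intro divide_nonneg_nonneg mult_nonneg_nonneg) auto
      ultimately show ?thesis ..
    qed
    with ev show "eventually (\<lambda>n. real n * (v n - 1) \<le> 1 / (ln (real n) * ln (ln (real n)) * lnlnln (real n))) sequentially"
      "eventually (\<lambda>n. 0 \<le> real n * (v n - 1)) sequentially"
      by (auto elim: eventually_mono)
  qed simp
  from relative_increment_mult[OF relative_increment_power[OF u, of "k + 1"] relative_increment_power[OF v, of k]]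
  have w: "(\<lambda>n. real n * (w n - 1)) \<longlonglongrightarrow> real k + 1" by (simp add: w_def add.commute)
  have ev: "eventually (\<lambda>n. lnlnln (real n) > 0 \<and> real n > 0) sequentially"
    by (intro eventually_conj; real_asymp)
  have Bdiff: "eventually (\<lambda>n. B (Suc n) - B n = real n ^ k * lnlnln (real n) ^ k * (real n * (w n - 1))) sequentially"
    using ev
  proof eventually_elim
    case (elim n)
    have "real n ^ (k + 1) * u n ^ (k + 1) = real (Suc n) ^ (k + 1)"
      unfolding u_def power_mult_distrib[symmetric] using elim by simp
    moreover have "lnlnln (real n) ^ k * v n ^ k = lnlnln (real (Suc n)) ^ k"
      unfolding v_def power_mult_distrib[symmetric] using elim by simp
    ultimately have "B (Suc n) = real n ^ (k + 1) * lnlnln (real n) ^ k * w n"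
      unfolding B_def w_def by (metis mult.assoc mult.left_commute)
    then show ?case unfolding B_def by (simp add: algebra_simps)
  qed
  have fr: "(\<lambda>n. f (Suc n) / (real n * lnlnln (real n))) \<longlonglongrightarrow> 1"
  proof -
    have 1: "(\<lambda>n. f (Suc n)) \<sim>[at_top] (\<lambda>n. real (Suc n) * lnlnln (real (Suc n)))"
      using asymp_equiv_compose'[OF f filterlim_Suc] by simp
    have 2: "(\<lambda>n. real (Suc n) * lnlnln (real (Suc n))) \<sim>[at_top] (\<lambda>n. real n * lnlnln (real n))"
      by real_asymp
    show ?thesis
      by (rule asymp_equivD_strong[OF asymp_equiv_trans[OF 1 2]]) (use ev in \<open>auto elim: eventually_mono\<close>)
  qed
  have "(\<lambda>n. (f (Suc n) / (real n * lnlnln (real n))) ^ k / (real n * (w n - 1))) \<longlonglongrightarrow> 1 ^ k / (real k + 1)"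
    by (intro tendsto_intros fr w) auto
  moreover have "eventually (\<lambda>n. (f (Suc n) / (real n * lnlnln (real n))) ^ k / (real n * (w n - 1))
     = (A (Suc n) - A n) / (B (Suc n) - B n)) sequentially"
    using ev Bdiff
  proof eventually_elim
    case (elim n)
    have "A (Suc n) - A n = f (Suc n) ^ k" by (simp add: A_def)
    then show ?case unfolding elim(2) by (simp add: power_divide power_mult_distrib)
  qed
  ultimately have lim: "(\<lambda>n. (A (Suc n) - A n) / (B (Suc n) - B n)) \<longlonglongrightarrow> 1 / (real k + 1)"
    by (simp add: filterlim_cong)
  have inc: "eventually (\<lambda>n. B n < B (Suc n)) sequentially"
  proof -
    have "eventually (\<lambda>n. real n * (w n - 1) > 0) sequentially"
      by (rule order_tendstoD(1)[OF w]) simp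
    with ev Bdiff show ?thesis
    proof eventually_elim
      case (elim n)
      then have "real n ^ k * lnlnln (real n) ^ k * (real n * (w n - 1)) > 0"
        by (intro mult_pos_pos zero_less_power) (auto simp: zero_less_mult_iff)
      then show ?case using elim(2) by simp
    qed
  qed
  have Btop: "filterlim B at_top sequentially"
  proof (rule filterlim_at_top_mono[OF filterlim_real_sequentially])
    have "eventually (\<lambda>n. lnlnln (real n) \<ge> 1 \<and> real n \<ge> 1) sequentially"
      by (intro eventually_conj; real_asymp)
    then show "eventually (\<lambda>n. real n \<le> B n) sequentially"
    proof eventually_elim
      case (elim n)
      have "real n * 1 * 1 \<le> real n * real n ^ k * lnlnln (real n) ^ k"
        using elim by (intro mult_mono one_le_power) auto
      then show ?case by (simp add: B_def)
    qed
  qed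
  have "(\<lambda>n. A n / B n * (real k + 1)) \<longlonglongrightarrow> 1 / (real k + 1) * (real k + 1)"
    by (rule tendsto_mult_right[OF stolz_cesaro[OF Btop inc lim]])
  then have "(\<lambda>n. A n / (B n / (real k + 1))) \<longlonglongrightarrow> 1" by (simp add: field_simps)
  then have "A \<sim>[at_top] (\<lambda>n. B n / (real k + 1))"
    by (rule asymp_equivI')
  then show ?thesis by (simp add: A_def[abs_def] B_def[abs_def])
qed

section \<open>From the count to the enumeration\<close>

text \<open>Positivity of cyclic numbers settles negative x, where
  \<open>nat \<lfloor>x\<rfloor>\<close> is 0.\<close>

lemma cyclic_count_conv: "cyclic_count x = card (cyclics_upto (nat \<lfloor>x\<rfloor>))"
proof -
  have "m \<le> nat \<lfloor>x\<rfloor> \<longleftrightarrow> real m \<le> x" if "cyclic_number m" for m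
    using that by (auto simp: cyclic_number_def le_nat_iff le_floor_iff) linarith
  then show ?thesis unfolding cyclic_count_def cyclics_upto_def by metis
qed

lemma cyclic_count_asymp:
  "(\<lambda>x. real (cyclic_count x)) \<sim>[at_top] (\<lambda>x. exp (- euler_mascheroni) * (x / lnlnln x))"
proof -
  have "filterlim (\<lambda>x::real. nat \<lfloor>x\<rfloor>) at_top at_top" by real_asymp
  from filterlim_compose[OF cyclics_density this]
  have 1: "((\<lambda>x. real (cyclic_count x) * lnlnln (real (nat \<lfloor>x\<rfloor>)) / real (nat \<lfloor>x\<rfloor>)) \<longlongrightarrow> exp (- euler_mascheroni)) at_top"
    by (simp only: cyclic_count_conv)
  have 2: "((\<lambda>x::real. real (nat \<lfloor>x\<rfloor>) / lnlnln (real (nat \<lfloor>x\<rfloor>)) * (lnlnln x / x)) \<longlongrightarrow> 1) at_top"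
    by real_asymp
  have "((\<lambda>x. (real (cyclic_count x) * lnlnln (real (nat \<lfloor>x\<rfloor>)) / real (nat \<lfloor>x\<rfloor>)) *
     (real (nat \<lfloor>x\<rfloor>) / lnlnln (real (nat \<lfloor>x\<rfloor>)) * (lnlnln x / x)) / exp (- euler_mascheroni)) \<longlongrightarrow>
     exp (- euler_mascheroni) * 1 / exp (- euler_mascheroni)) at_top"
    by (intro tendsto_intros 1 2) simp
  moreover have "eventually (\<lambda>x::real. lnlnln (real (nat \<lfloor>x\<rfloor>)) > 0 \<and> real (nat \<lfloor>x\<rfloor>) > 0 \<and> lnlnln x > 0 \<and> x > 0) at_top"
    by (intro eventually_conj; real_asymp)
  then have "eventually (\<lambda>x. (real (cyclic_count x) * lnlnln (real (nat \<lfloor>x\<rfloor>)) / real (nat \<lfloor>x\<rfloor>)) *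
     (real (nat \<lfloor>x\<rfloor>) / lnlnln (real (nat \<lfloor>x\<rfloor>)) * (lnlnln x / x)) / exp (- euler_mascheroni)
     = real (cyclic_count x) / (exp (- euler_mascheroni) * (x / lnlnln x))) at_top"
  proof eventually_elim
    case (elim x)
    have "(c * l / r) * (r / l * (g / y)) / E = c / (E * (y / g))"
      if "l > 0" "r > 0" "g > 0" "y > 0" for c l r g y E :: real
      using that by (simp add: divide_simps)
    then show ?case using elim by blast
  qed
  ultimately have "((\<lambda>x. real (cyclic_count x) / (exp (- euler_mascheroni) * (x / lnlnln x))) \<longlongrightarrow> 1) at_top"
    by (simp add: filterlim_cong)
  then show ?thesis by (rule asymp_equivI')
qed

lemma nth_cyclic_mem: "cyclic_number (nth_cyclic n)"
  using enumerate_in_set[OF infinite_cyclic_numbers, of "n - 1"] by (simp add: nth_cyclic_def)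

lemma nth_cyclic_image:
  assumes "n \<ge> 1"
  shows "nth_cyclic ` {1..n} = {m. cyclic_number m \<and> m \<le> nth_cyclic n}"
proof (intro equalityI subsetI)
  fix m assume "m \<in> nth_cyclic ` {1..n}"
  then obtain i where "1 \<le> i" "i \<le> n" "m = nth_cyclic i" by auto
  then show "m \<in> {m. cyclic_number m \<and> m \<le> nth_cyclic n}"
    using nth_cyclic_mem by (simp add: nth_cyclic_def infinite_cyclic_numbers diff_le_mono)
next
  fix m assume m: "m \<in> {m. cyclic_number m \<and> m \<le> nth_cyclic n}"
  then obtain j where j: "enumerate {m. cyclic_number m} j = m"
    using enumerate_Ex[OF infinite_cyclic_numbers] by auto
  then have "j \<le> n - 1" using m infinite_cyclic_numbers by (auto simp: nth_cyclic_def)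
  then have "Suc j \<in> {1..n}" using assms by auto
  moreover have "nth_cyclic (Suc j) = m" using j by (simp add: nth_cyclic_def)
  ultimately show "m \<in> nth_cyclic ` {1..n}" by blast
qed

lemma inj_nth_cyclic: "inj_on nth_cyclic {1..n}"
proof (rule inj_onI)
  fix i j assume ij: "i \<in> {1..n}" "j \<in> {1..n}" "nth_cyclic i = nth_cyclic j"
  then have "i - 1 = j - 1"
    using inj_enumerate[OF infinite_cyclic_numbers] by (simp add: nth_cyclic_def inj_def)
  then show "i = j" using ij by auto
qed

lemma cyclic_count_nth: "n \<ge> 1 \<Longrightarrow> cyclic_count (real (nth_cyclic n)) = n"
  using nth_cyclic_image[of n] card_image[OF inj_nth_cyclic[of n]] by (simp add: cyclic_count_def)

lemma nth_cyclic_ge: "n \<le> nth_cyclic n"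
proof (cases "n = 0")
  case False
  have "0 < nth_cyclic n" using nth_cyclic_mem[of n] by (simp add: cyclic_number_def)
  moreover have "n - 1 \<le> nth_cyclic n" unfolding nth_cyclic_def by (rule le_enumerate[OF infinite_cyclic_numbers])
  moreover have "n = card (nth_cyclic ` {1..n})" using card_image[OF inj_nth_cyclic[of n]] by simp
  moreover have "nth_cyclic ` {1..n} \<subseteq> {1..nth_cyclic n}"
    using nth_cyclic_image[of n] False by (auto simp: cyclic_number_def)
  then have "card (nth_cyclic ` {1..n}) \<le> card {1..nth_cyclic n}" by (intro card_mono) auto
  ultimately show ?thesis by simp
qed simp

text \<open>Passing to the square root halves the logarithm and shifts ln ln by a constant, which
  disappears under one more logarithm. This is why very crude bounds suffice for inverting the
  count.\<close>

lemma lnlnln_asymp_between: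
  assumes lo: "eventually (\<lambda>x. sqrt (g x) \<le> f x) F" and hi: "eventually (\<lambda>x. f x \<le> g x) F"
    and g: "filterlim g at_top F"
  shows "(\<lambda>x. lnlnln (f x)) \<sim>[F] (\<lambda>x. lnlnln (g x))"
proof (rule asymp_equiv_sandwich_real)
  have "(\<lambda>y::real. lnlnln (sqrt y)) \<sim>[at_top] (\<lambda>y. lnlnln y)" by real_asymp
  from asymp_equiv_compose'[OF this g]
  show "(\<lambda>x. lnlnln (sqrt (g x))) \<sim>[F] (\<lambda>x. lnlnln (g x))" .
  have "eventually (\<lambda>y::real. ln (ln (sqrt y)) > 0 \<and> ln (sqrt y) > 0 \<and> sqrt y > 0) at_top"
    by (intro eventually_conj; real_asymp)
  from eventually_compose_filterlim[OF this g] lo hi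
  show "eventually (\<lambda>x. lnlnln (f x) \<in> {lnlnln (sqrt (g x))..lnlnln (g x)}) F"
  proof eventually_elim
    case (elim x)
    have mono: "a > 0 \<Longrightarrow> a \<le> b \<Longrightarrow> ln a \<le> ln b" for a b :: real by simp
    have 1: "ln (sqrt (g x)) \<le> ln (f x)" "ln (f x) \<le> ln (g x)"
      using elim by (intro mono; linarith)+
    have 2: "ln (ln (sqrt (g x))) \<le> ln (ln (f x))" "ln (ln (f x)) \<le> ln (ln (g x))"
      using 1 elim by (intro mono; linarith)+
    have "lnlnln (sqrt (g x)) \<le> lnlnln (f x)" "lnlnln (f x) \<le> lnlnln (g x)"
      using 2 elim by - (rule mono; linarith)+
    then show ?case unfolding atLeastAtMost_iff ..
  qed
qed auto

text \<open>At x = c_n the count says that n is asymptotic to exp (-gamma) c_n / ln ln ln c_n. The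
  crude bounds sqrt c_n <= n <= c_n let ln ln ln n replace ln ln ln c_n.\<close>

lemma nth_cyclic_asymp:
  "(\<lambda>n. real (nth_cyclic n)) \<sim>[at_top] (\<lambda>n. exp euler_mascheroni * (real n * lnlnln (real n)))"
proof -
  have top: "filterlim (\<lambda>n. real (nth_cyclic n)) at_top sequentially"
    by (rule filterlim_at_top_mono[OF filterlim_real_sequentially]) (simp add: nth_cyclic_ge)
  have "(\<lambda>n. real (cyclic_count (real (nth_cyclic n)))) \<sim>[at_top]
      (\<lambda>n. exp (- euler_mascheroni) * (real (nth_cyclic n) / lnlnln (real (nth_cyclic n))))"
    by (rule asymp_equiv_compose'[OF cyclic_count_asymp top])
  moreover have "(\<lambda>n. real n) \<sim>[at_top] (\<lambda>n. real (cyclic_count (real (nth_cyclic n))))"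
    by (intro asymp_equiv_refl_ev eventually_mono[OF eventually_ge_at_top[of 1]]) (simp add: cyclic_count_nth)
  ultimately have 1: "(\<lambda>n. real n) \<sim>[at_top] (\<lambda>n. exp (- euler_mascheroni) * (real (nth_cyclic n) / lnlnln (real (nth_cyclic n))))"
    by (blast intro: asymp_equiv_trans)
  have "eventually (\<lambda>y::real. sqrt y \<le> exp (- euler_mascheroni) / 2 * (y / lnlnln y) \<and> lnlnln y > 0) at_top"
    by (intro eventually_conj; real_asymp)
  from eventually_compose_filterlim[OF this top]
  have ev: "eventually (\<lambda>n. sqrt (real (nth_cyclic n)) \<le> exp (- euler_mascheroni) / 2 * (real (nth_cyclic n) / lnlnln (real (nth_cyclic n)))
      \<and> lnlnln (real (nth_cyclic n)) > 0) sequentially" .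
  have "eventually (\<lambda>n. 1 / 2 * norm (exp (- euler_mascheroni) * (real (nth_cyclic n) / lnlnln (real (nth_cyclic n)))) \<le> norm (real n)) sequentially"
    by (rule asymp_equiv_imp_eventually_ge[OF 1]) simp
  then have lo: "eventually (\<lambda>n. sqrt (real (nth_cyclic n)) \<le> real n) sequentially"
    using ev by eventually_elim (simp add: abs_mult)
  have G: "(\<lambda>n. lnlnln (real n)) \<sim>[at_top] (\<lambda>n. lnlnln (real (nth_cyclic n)))"
    by (rule lnlnln_asymp_between[OF lo _ top]) (simp add: nth_cyclic_ge)
  have "(\<lambda>n. exp euler_mascheroni * (real n * lnlnln (real n))) \<sim>[at_top]
    (\<lambda>n. exp euler_mascheroni * ((exp (- euler_mascheroni) * (real (nth_cyclic n) / lnlnln (real (nth_cyclic n)))) * lnlnln (real (nth_cyclic n))))"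
    by (intro asymp_equiv_intros 1 G)
  moreover have "(\<lambda>n. exp euler_mascheroni * ((exp (- euler_mascheroni) * (real (nth_cyclic n) / lnlnln (real (nth_cyclic n)))) * lnlnln (real (nth_cyclic n))))
     \<sim>[at_top] (\<lambda>n. real (nth_cyclic n))"
    by (intro asymp_equiv_refl_ev eventually_mono[OF ev]) (auto simp: exp_minus)
  ultimately have "(\<lambda>n. exp euler_mascheroni * (real n * lnlnln (real n))) \<sim>[at_top] (\<lambda>n. real (nth_cyclic n))"
    by (rule asymp_equiv_trans)
  then show ?thesis by (rule asymp_equiv_symI)
qed

lemma filterlim_cyclic_count: "filterlim cyclic_count at_top at_top"
proof -
  have "filterlim (\<lambda>x. real (cyclic_count x)) at_top at_top"
  proof (subst asymp_equiv_at_top_transfer[OF asymp_equiv_symI[OF cyclic_count_asymp]])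
    show "filterlim (\<lambda>x. exp (- euler_mascheroni) * (x / lnlnln x)) at_top at_top" by real_asymp
  qed simp
  then show ?thesis by (simp add: filterlim_sequentially_iff_filterlim_real)
qed

text \<open>Inserting n = C(x) into the asymptotics of c_n and using those of C(x), the factors with
  gamma and ln ln ln x cancel. This allows x to replace the last cyclic number up to x.\<close>

lemma nth_cyclic_count_asymp:
  "(\<lambda>x. real (nth_cyclic (cyclic_count x))) \<sim>[at_top] (\<lambda>x. x)"
proof -
  have 1: "(\<lambda>x. real (nth_cyclic (cyclic_count x))) \<sim>[at_top]
     (\<lambda>x. exp euler_mascheroni * (real (cyclic_count x) * lnlnln (real (cyclic_count x))))"
    by (rule asymp_equiv_compose'[OF nth_cyclic_asymp filterlim_cyclic_count])
  have hi: "eventually (\<lambda>x. real (cyclic_count x) \<le> x) at_top"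
    using eventually_ge_at_top[of 0]
  proof eventually_elim
    case (elim x)
    have "cyclics_upto (nat \<lfloor>x\<rfloor>) \<subseteq> {1..nat \<lfloor>x\<rfloor>}" by (auto simp: cyclics_upto_def cyclic_number_def)
    then have "card (cyclics_upto (nat \<lfloor>x\<rfloor>)) \<le> card {1..nat \<lfloor>x\<rfloor>}" by (intro card_mono) auto
    then have "real (cyclic_count x) \<le> real (nat \<lfloor>x\<rfloor>)" by (simp add: cyclic_count_conv)
    also have "\<dots> \<le> x" using elim by (simp add: of_nat_nat)
    finally show ?case .
  qed
  have "eventually (\<lambda>y::real. sqrt y \<le> exp (- euler_mascheroni) / 2 * (y / lnlnln y) \<and> lnlnln y > 0 \<and> y > 0) at_top"
    by (intro eventually_conj; real_asymp)
  moreover have "eventually (\<lambda>x. 1 / 2 * norm (exp (- euler_mascheroni) * (x / lnlnln x)) \<le> norm (real (cyclic_count x))) at_top"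
    by (rule asymp_equiv_imp_eventually_ge[OF cyclic_count_asymp]) simp
  ultimately have lo: "eventually (\<lambda>x. sqrt x \<le> real (cyclic_count x)) at_top"
    by eventually_elim (simp add: abs_mult)
  have G: "(\<lambda>x. lnlnln (real (cyclic_count x))) \<sim>[at_top] (\<lambda>x. lnlnln x)"
    by (rule lnlnln_asymp_between[OF lo hi filterlim_ident])
  have "(\<lambda>x. exp euler_mascheroni * (real (cyclic_count x) * lnlnln (real (cyclic_count x)))) \<sim>[at_top]
     (\<lambda>x. exp euler_mascheroni * ((exp (- euler_mascheroni) * (x / lnlnln x)) * lnlnln x))"
    by (intro asymp_equiv_intros cyclic_count_asymp G)
  moreover have "eventually (\<lambda>x::real. lnlnln x > 0) at_top" by real_asymp
  then have "(\<lambda>x. exp euler_mascheroni * ((exp (- euler_mascheroni) * (x / lnlnln x)) * lnlnln x)) \<sim>[at_top] (\<lambda>x. x)"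
    by (intro asymp_equiv_refl_ev) (auto elim!: eventually_mono simp: exp_minus)
  ultimately have "(\<lambda>x. exp euler_mascheroni * (real (cyclic_count x) * lnlnln (real (cyclic_count x)))) \<sim>[at_top] (\<lambda>x. x)"
    by (rule asymp_equiv_trans)
  with 1 show ?thesis by (rule asymp_equiv_trans)
qed

section \<open>Power sums\<close>

text \<open>Dividing every c_n by exp gamma brings the sequence into the form required by
  \<open>sum_power_lnlnln\<close>; the factor returns to the power k.\<close>

lemma sum_nth_cyclic_power_explicit:
  "(\<lambda>n. \<Sum>i=1..n. real (nth_cyclic i) ^ k) \<sim>[at_top]
     (\<lambda>n. real n ^ (k + 1) * exp (real k * euler_mascheroni) * lnlnln (real n) ^ k / (real k + 1))"
proof -
  define f where "f n = exp (- euler_mascheroni) * real (nth_cyclic n)" for n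
  have "f \<sim>[at_top] (\<lambda>n. exp (- euler_mascheroni) * (exp euler_mascheroni * (real n * lnlnln (real n))))"
    unfolding f_def by (intro asymp_equiv_intros nth_cyclic_asymp)
  moreover have "exp (- euler_mascheroni) * (exp euler_mascheroni * y) = y" for y :: real
    by (simp add: exp_minus)
  ultimately have "f \<sim>[at_top] (\<lambda>n. real n * lnlnln (real n))" by simp
  from sum_power_lnlnln[OF this, of k]
  have "(\<lambda>n. exp euler_mascheroni ^ k * (\<Sum>i=1..n. f i ^ k)) \<sim>[at_top]
     (\<lambda>n. exp euler_mascheroni ^ k * (real n ^ (k + 1) * lnlnln (real n) ^ k / (real k + 1)))"
    by (intro asymp_equiv_intros)
  moreover have "exp euler_mascheroni ^ k * (\<Sum>i=1..n. f i ^ k) = (\<Sum>i=1..n. real (nth_cyclic i) ^ k)" for n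
    unfolding sum_distrib_left f_def power_mult_distrib[symmetric]
    by (simp add: mult.assoc[symmetric] exp_minus)
  moreover have "exp euler_mascheroni ^ k = exp (real k * euler_mascheroni)" by (simp add: exp_of_nat_mult)
  ultimately show ?thesis by (simp add: mult_ac)
qed

lemma nth_cyclic_power_explicit:
  "(\<lambda>n. real n * real (nth_cyclic n) ^ k / (real k + 1)) \<sim>[at_top]
     (\<lambda>n. real n ^ (k + 1) * exp (real k * euler_mascheroni) * lnlnln (real n) ^ k / (real k + 1))"
proof -
  have "(\<lambda>n. real n * real (nth_cyclic n) ^ k / (real k + 1)) \<sim>[at_top]
    (\<lambda>n. real n * (exp euler_mascheroni * (real n * lnlnln (real n))) ^ k / (real k + 1))"
    by (intro asymp_equiv_intros nth_cyclic_asymp)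
  then show ?thesis by (simp add: power_mult_distrib exp_of_nat_mult exp_of_nat2_mult mult_ac)
qed

lemma sum_nth_cyclic_power:
  "(\<lambda>n. \<Sum>i=1..n. real (nth_cyclic i) ^ k) \<sim>[at_top] (\<lambda>n. real n * real (nth_cyclic n) ^ k / (real k + 1))"
  by (rule asymp_equiv_trans[OF sum_nth_cyclic_power_explicit asymp_equiv_symI[OF nth_cyclic_power_explicit]])

lemma sum_cyclic_power_eq:
  "(\<Sum>c | cyclic_number c \<and> real c \<le> x. real c ^ k) = (\<Sum>i=1..cyclic_count x. real (nth_cyclic i) ^ k)"
proof -
  define S where "S = {c. cyclic_number c \<and> real c \<le> x}"
  have S: "finite S" unfolding S_def
    by (rule finite_subset[of _ "{..nat \<lfloor>x\<rfloor>}"]) (auto simp: le_nat_floor)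
  have "nth_cyclic ` {1..card S} = S"
  proof (cases "S = {}")
    case False
    then have "Max S \<in> S" using S by simp
    then obtain j where j: "enumerate {m. cyclic_number m} j = Max S"
      using enumerate_Ex[OF infinite_cyclic_numbers] by (auto simp: S_def)
    have "nth_cyclic ` {1..Suc j} = {m. cyclic_number m \<and> m \<le> nth_cyclic (Suc j)}"
      by (rule nth_cyclic_image) simp
    also have "\<dots> = {m. cyclic_number m \<and> m \<le> Max S}" using j by (simp add: nth_cyclic_def)
    also have "\<dots> = S"
    proof (intro equalityI subsetI)
      fix m assume "m \<in> {m. cyclic_number m \<and> m \<le> Max S}"
      moreover have "real (Max S) \<le> x" using \<open>Max S \<in> S\<close> by (simp add: S_def)
      ultimately show "m \<in> S" by (simp add: S_def)
    qed (use S in \<open>auto simp: S_def\<close>)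
    finally have e: "nth_cyclic ` {1..Suc j} = S" .
    then have "card S = Suc j" using card_image[OF inj_nth_cyclic[of "Suc j"]] by simp
    with e show ?thesis by simp
  qed simp
  then have "(\<Sum>c\<in>S. real c ^ k) = (\<Sum>i=1..card S. real (nth_cyclic i) ^ k)"
    using sum.reindex[OF inj_nth_cyclic[of "card S"], of "\<lambda>c. real c ^ k"] by simp
  then show ?thesis by (simp add: S_def cyclic_count_def)
qed

lemma sum_cyclic_power:
  "(\<lambda>x. \<Sum>c | cyclic_number c \<and> real c \<le> x. real c ^ k) \<sim>[at_top]
    (\<lambda>x. real (cyclic_count x) * real (nth_cyclic (cyclic_count x)) ^ k / (real k + 1))"
  unfolding sum_cyclic_power_eq
  by (rule asymp_equiv_compose'[OF sum_nth_cyclic_power filterlim_cyclic_count])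

lemma cyclic_count_nth_power:
  "(\<lambda>x. real (cyclic_count x) * real (nth_cyclic (cyclic_count x)) ^ k / (real k + 1)) \<sim>[at_top]
    (\<lambda>x. real (cyclic_count x) * x ^ k / (real k + 1))"
  by (intro asymp_equiv_intros nth_cyclic_count_asymp)

lemma cyclic_count_power:
  "(\<lambda>x. real (cyclic_count x) * x ^ k / (real k + 1)) \<sim>[at_top]
    (\<lambda>x. x ^ (k + 1) / ((real k + 1) * exp euler_mascheroni * lnlnln x) * (1 - euler_mascheroni / lnlnln x))"
proof -
  have "(\<lambda>x. real (cyclic_count x) * x ^ k / (real k + 1)) \<sim>[at_top]
    (\<lambda>x. exp (- euler_mascheroni) * (x / lnlnln x) * x ^ k / (real k + 1))"
    by (intro asymp_equiv_intros cyclic_count_asymp)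
  moreover have "(\<lambda>x::real. 1) \<sim>[at_top] (\<lambda>x. 1 - euler_mascheroni / lnlnln x)" by real_asymp
  ultimately have "(\<lambda>x. real (cyclic_count x) * x ^ k / (real k + 1) * 1) \<sim>[at_top]
    (\<lambda>x. exp (- euler_mascheroni) * (x / lnlnln x) * x ^ k / (real k + 1) * (1 - euler_mascheroni / lnlnln x))"
    by (rule asymp_equiv_mult)
  moreover have "exp (- euler_mascheroni) * (x / lnlnln x) * x ^ k / (real k + 1)
    = x ^ (k + 1) / ((real k + 1) * exp euler_mascheroni * lnlnln x)" for x :: real
    by (simp add: exp_minus divide_simps)
  ultimately show ?thesis by (simp only: mult_1_right)
qed

theorem theorem1:
  fixes k :: nat
  shows
    "((\<lambda>n::nat. \<Sum>i=1..n. real (nth_cyclic i) ^ k)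
         \<sim>[at_top] (\<lambda>n. real n * real (nth_cyclic n) ^ k / (real k + 1))) \<and>
     ((\<lambda>n::nat. real n * real (nth_cyclic n) ^ k / (real k + 1))
         \<sim>[at_top] (\<lambda>n. real n ^ (k + 1) * exp (real k * euler_mascheroni)
                          * ln (ln (ln (real n))) ^ k / (real k + 1))) \<and>
     ((\<lambda>n::nat. \<Sum>i=1..n. real (nth_cyclic i))
         \<sim>[at_top] (\<lambda>n. real n * real (nth_cyclic n) / 2)) \<and>
     ((\<lambda>n::nat. real n * real (nth_cyclic n) / 2)
         \<sim>[at_top] (\<lambda>n. real n ^ 2 * exp euler_mascheroni * ln (ln (ln (real n))) / 2)) \<and>
     ((\<lambda>x::real. \<Sum>c | cyclic_number c \<and> real c \<le> x. real c ^ k)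
         \<sim>[at_top] (\<lambda>x. real (cyclic_count x) * real (nth_cyclic (cyclic_count x)) ^ k
                          / (real k + 1))) \<and>
     ((\<lambda>x::real. real (cyclic_count x) * real (nth_cyclic (cyclic_count x)) ^ k / (real k + 1))
         \<sim>[at_top] (\<lambda>x. real (cyclic_count x) * x ^ k / (real k + 1))) \<and>
     ((\<lambda>x::real. real (cyclic_count x) * x ^ k / (real k + 1))
         \<sim>[at_top] (\<lambda>x. x ^ (k + 1) / ((real k + 1) * exp euler_mascheroni * ln (ln (ln x)))
                          * (1 - euler_mascheroni / ln (ln (ln x))))) \<and>
     ((\<lambda>x::real. \<Sum>c | cyclic_number c \<and> real c \<le> x. real c)
         \<sim>[at_top] (\<lambda>x. real (cyclic_count x) * x / 2)) \<and>
     ((\<lambda>x::real. real (cyclic_count x) * x / 2)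
         \<sim>[at_top] (\<lambda>x. x ^ 2 / (2 * exp euler_mascheroni * ln (ln (ln x)))
                          * (1 - euler_mascheroni / ln (ln (ln x)))))"
proof (intro conjI)
  have two: "real 1 + 1 = 2" by simp
  show "(\<lambda>n::nat. \<Sum>i=1..n. real (nth_cyclic i)) \<sim>[at_top] (\<lambda>n. real n * real (nth_cyclic n) / 2)"
    using sum_nth_cyclic_power[of 1] by (simp only: power_one_right two)
  show "(\<lambda>n::nat. real n * real (nth_cyclic n) / 2)
         \<sim>[at_top] (\<lambda>n. real n ^ 2 * exp euler_mascheroni * ln (ln (ln (real n))) / 2)"
    using nth_cyclic_power_explicit[of 1] by (simp only: power_one_right two one_add_one of_nat_1 mult_1_left)
  show "(\<lambda>x::real. \<Sum>c | cyclic_number c \<and> real c \<le> x. real c) \<sim>[at_top] (\<lambda>x. real (cyclic_count x) * x / 2)"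
    using asymp_equiv_trans[OF sum_cyclic_power[of 1] cyclic_count_nth_power[of 1]] by (simp only: power_one_right two)
  show "(\<lambda>x::real. real (cyclic_count x) * x / 2)
         \<sim>[at_top] (\<lambda>x. x ^ 2 / (2 * exp euler_mascheroni * ln (ln (ln x))) * (1 - euler_mascheroni / ln (ln (ln x))))"
    using cyclic_count_power[of 1] by (simp only: power_one_right two one_add_one)
qed (fact sum_nth_cyclic_power nth_cyclic_power_explicit sum_cyclic_power cyclic_count_nth_power cyclic_count_power)+

end
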